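(* Assume $\diamondsuit$ holds and ZFC is consistent. Then there is a family of $2^{\omega_1}$ many $\omega_1$-like models $\langle M,\in^M\rangle$ of ZFC whose inclusion structures $\langle M,\subseteq^M\rangle$ are pairwise non-isomorphic.
   Context: A model $\langle M,\in^M\rangle$ of set theory is $\omega_1$-like if it is uncountable but for every $a\in M$ the set $\{b\in M\mid b\in^M a\}$ is countable. For $\langle M,\in^M\rangle$, $a\subseteq^M b$ iff for all $c\in M$, $c\in^M a\Rightarrow c\in^M b$. $\diamondsuit$ is Jensen's diamond principle: there is a sequence $\langle A_\alpha\mid\alpha<\omega_1\rangle$ with $A_\alpha\subseteq\alpha$ such that for every $A\subseteq\omega_1$ the set $\{\alpha\mid A\cap\alpha=A_\alpha\}$ is stationary. *)

theory Defs
  imports Main "HOL-Library.Countable_Set_Type"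
begin

unbundle cardinal_syntax

subsection \<open>The ordinal \<open>\<omega>\<^sub>1\<close> and the diamond principle\<close>

text \<open>The elements of the following type are the countable ordinals; the ordinal
  \<open>\<alpha>\<close>, regarded as a set of ordinals, is \<open>{..<\<alpha>}\<close>, and
  \<open>\<omega>\<^sub>1\<close> itself is \<open>UNIV\<close>.\<close>

typedef omega1 = "Field (cardSuc natLeq)"
  using Field_cardSuc_not_empty[OF natLeq_Card_order] by blast

instantiation omega1 :: wellorder
begin

definition less_eq_omega1 :: "omega1 \<Rightarrow> omega1 \<Rightarrow> bool" where
  "\<alpha> \<le> \<beta> \<longleftrightarrow> (Rep_omega1 \<alpha>, Rep_omega1 \<beta>) \<in> cardSuc natLeq"

definition less_omega1 :: "omega1 \<Rightarrow> omega1 \<Rightarrow> bool" where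
  "\<alpha> < \<beta> \<longleftrightarrow> (Rep_omega1 \<alpha>, Rep_omega1 \<beta>) \<in> cardSuc natLeq - Id"

instance
proof
  have wo: "Well_order (cardSuc natLeq)"
    by (rule cardSuc_Well_order[OF natLeq_Card_order])
  note props = wo[unfolded well_order_on_def linear_order_on_def partial_order_on_def preorder_on_def]
  fix x y z :: omega1
  show "(x < y) = (x \<le> y \<and> \<not> y \<le> x)"
    using props unfolding less_eq_omega1_def less_omega1_def
    by (auto simp: Rep_omega1_inject dest: antisymD)
  show "x \<le> x"
    using props Rep_omega1[of x] unfolding less_eq_omega1_def refl_on_def by blast
  show "x \<le> z" if "x \<le> y" "y \<le> z"
    using props that unfolding less_eq_omega1_def by (blast dest: transD)
  show "x = y" if "x \<le> y" "y \<le> x"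
    using props that unfolding less_eq_omega1_def
    by (metis Rep_omega1_inject antisymD)
  show "x \<le> y \<or> y \<le> x"
    using props Rep_omega1[of x] Rep_omega1[of y]
    unfolding less_eq_omega1_def total_on_def refl_on_def by metis
next
  fix P :: "omega1 \<Rightarrow> bool" and a
  assume step: "\<And>x. (\<And>y. y < x \<Longrightarrow> P y) \<Longrightarrow> P x"
  have "wf (cardSuc natLeq - Id)"
    using cardSuc_Well_order[OF natLeq_Card_order] by (simp add: well_order_on_def)
  then have "wf (inv_image (cardSuc natLeq - Id) Rep_omega1)"
    by (rule wf_inv_image)
  then show "P a"
    by (induction a rule: wf_induct_rule) (use step in \<open>auto simp: less_omega1_def\<close>)
qed

end

lemma range_Rep_omega1: "range Rep_omega1 = Field (cardSuc natLeq)"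
  using type_definition.Rep_range[OF type_definition_omega1] .

lemma card_of_omega1: "|UNIV :: omega1 set| =o cardSuc natLeq"
proof -
  have "|UNIV :: omega1 set| =o |Field (cardSuc natLeq)|"
    using range_Rep_omega1 by (intro card_of_ordIsoI[of Rep_omega1])
      (auto simp: bij_betw_def inj_on_def Rep_omega1_inject)
  then show ?thesis
    using card_of_Field_ordIso[OF cardSuc_Card_order[OF natLeq_Card_order]] ordIso_transitive
    by blast
qed

lemma uncountable_omega1: "uncountable (UNIV :: omega1 set)"
  using cardSuc_greater[OF natLeq_Card_order] card_of_omega1 not_ordLess_ordLeq
    ordIso_ordLeq_trans ordIso_symmetric
  unfolding countable_card_le_natLeq by blast

lemma countable_lessThan_omega1: "countable {..<\<alpha> :: omega1}"
proof -
  let ?r = "cardSuc natLeq"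
  have "|underS ?r (Rep_omega1 \<alpha>)| <o ?r"
    using card_of_underS[OF cardSuc_Card_order[OF natLeq_Card_order] Rep_omega1] .
  then have "countable (underS ?r (Rep_omega1 \<alpha>))"
    unfolding countable_card_le_natLeq
    using cardSuc_ordLeq_ordLess[OF natLeq_Card_order card_of_Card_order] by blast
  moreover have "Rep_omega1 ` {..<\<alpha>} \<subseteq> underS ?r (Rep_omega1 \<alpha>)"
    by (auto simp: underS_def less_omega1_def)
  ultimately show ?thesis
    by (meson countable_image_inj_on countable_subset Rep_omega1_inject inj_onI)
qed

definition club :: "omega1 set \<Rightarrow> bool" where
  "club C \<longleftrightarrow>
     (\<forall>\<alpha>. \<exists>\<beta>\<in>C. \<alpha> < \<beta>) \<and>
     (\<forall>\<alpha>. (\<exists>\<gamma>. \<gamma> < \<alpha>) \<and> (\<forall>\<gamma><\<alpha>. \<exists>\<beta>\<in>C. \<gamma> < \<beta> \<and> \<beta> < \<alpha>) \<longrightarrow> \<alpha> \<in> C)"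

definition stationary :: "omega1 set \<Rightarrow> bool" where
  "stationary S \<longleftrightarrow> (\<forall>C. club C \<longrightarrow> S \<inter> C \<noteq> {})"

definition diamond :: bool where
  "diamond \<longleftrightarrow>
     (\<exists>A :: omega1 \<Rightarrow> omega1 set.
        (\<forall>\<alpha>. A \<alpha> \<subseteq> {..<\<alpha>}) \<and> (\<forall>X. stationary {\<alpha>. X \<inter> {..<\<alpha>} = A \<alpha>}))"

subsection \<open>First-order logic in the language of set theory\<close>

text \<open>Variables are de Bruijn indices: under a quantifier, index \<open>0\<close> is the variable bound
  by it and the outer index \<open>n\<close> becomes \<open>Suc n\<close>.\<close>

datatype fm =
    Mem nat nat
  | Equal nat nat
  | Falsum
  | Implies fm fm
  | Forall fm

definition Neg :: "fm \<Rightarrow> fm" where "Neg p = Implies p Falsum"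
definition Conj :: "fm \<Rightarrow> fm \<Rightarrow> fm" where "Conj p q = Neg (Implies p (Neg q))"
definition Disj :: "fm \<Rightarrow> fm \<Rightarrow> fm" where "Disj p q = Implies (Neg p) q"
definition Iff :: "fm \<Rightarrow> fm \<Rightarrow> fm" where "Iff p q = Conj (Implies p q) (Implies q p)"
definition Exists :: "fm \<Rightarrow> fm" where "Exists p = Neg (Forall (Neg p))"

primrec fv :: "fm \<Rightarrow> nat set" where
  "fv (Mem i j) = {i, j}"
| "fv (Equal i j) = {i, j}"
| "fv Falsum = {}"
| "fv (Implies p q) = fv p \<union> fv q"
| "fv (Forall p) = {n. Suc n \<in> fv p}"

primrec rename :: "(nat \<Rightarrow> nat) \<Rightarrow> fm \<Rightarrow> fm" where
  "rename f (Mem i j) = Mem (f i) (f j)"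
| "rename f (Equal i j) = Equal (f i) (f j)"
| "rename f Falsum = Falsum"
| "rename f (Implies p q) = Implies (rename f p) (rename f q)"
| "rename f (Forall p) = Forall (rename (case_nat 0 (\<lambda>n. Suc (f n))) p)"

text \<open>The language has no function symbols, so the only terms to instantiate a
  quantifier with are variables.\<close>

definition inst :: "nat \<Rightarrow> fm \<Rightarrow> fm" where
  "inst t p = rename (case_nat t (\<lambda>n. n)) p"

text \<open>Classical natural deduction with equality. In \<open>AllI\<close> the hypotheses are
  shifted, which makes index \<open>0\<close> a fresh variable.\<close>

inductive proves :: "fm set \<Rightarrow> fm \<Rightarrow> bool"  (infix \<open>\<turnstile>\<close> 50) where
  Assm: "p \<in> \<Gamma> \<Longrightarrow> \<Gamma> \<turnstile> p"
| ImpI: "insert p \<Gamma> \<turnstile> q \<Longrightarrow> \<Gamma> \<turnstile> Implies p q"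
| ImpE: "\<Gamma> \<turnstile> Implies p q \<Longrightarrow> \<Gamma> \<turnstile> p \<Longrightarrow> \<Gamma> \<turnstile> q"
| RAA: "insert (Neg p) \<Gamma> \<turnstile> Falsum \<Longrightarrow> \<Gamma> \<turnstile> p"
| AllI: "rename Suc ` \<Gamma> \<turnstile> p \<Longrightarrow> \<Gamma> \<turnstile> Forall p"
| AllE: "\<Gamma> \<turnstile> Forall p \<Longrightarrow> \<Gamma> \<turnstile> inst t p"
| EqRefl: "\<Gamma> \<turnstile> Equal t t"
| EqSubst: "\<Gamma> \<turnstile> Equal s t \<Longrightarrow> \<Gamma> \<turnstile> inst s p \<Longrightarrow> \<Gamma> \<turnstile> inst t p"

definition consistent :: "fm set \<Rightarrow> bool" where
  "consistent T \<longleftrightarrow> \<not> T \<turnstile> Falsum"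

text \<open>A structure is given by a carrier \<open>M\<close> and a relation \<open>E\<close> interpreting
  membership.\<close>

primrec sat :: "'a set \<Rightarrow> 'a rel \<Rightarrow> (nat \<Rightarrow> 'a) \<Rightarrow> fm \<Rightarrow> bool" where
  "sat M E v (Mem i j) \<longleftrightarrow> (v i, v j) \<in> E"
| "sat M E v (Equal i j) \<longleftrightarrow> v i = v j"
| "sat M E v Falsum \<longleftrightarrow> False"
| "sat M E v (Implies p q) \<longleftrightarrow> (sat M E v p \<longrightarrow> sat M E v q)"
| "sat M E v (Forall p) \<longleftrightarrow> (\<forall>a\<in>M. sat M E (case_nat a v) p)"

definition models :: "'a set \<Rightarrow> 'a rel \<Rightarrow> fm set \<Rightarrow> bool" where
  "models M E T \<longleftrightarrow> M \<noteq> {} \<and> (\<forall>p\<in>T. \<forall>v. range v \<subseteq> M \<longrightarrow> sat M E v p)"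

lemma sat_connectives [simp]:
  "sat M E v (Neg p) \<longleftrightarrow> \<not> sat M E v p"
  "sat M E v (Conj p q) \<longleftrightarrow> sat M E v p \<and> sat M E v q"
  "sat M E v (Disj p q) \<longleftrightarrow> sat M E v p \<or> sat M E v q"
  "sat M E v (Iff p q) \<longleftrightarrow> (sat M E v p \<longleftrightarrow> sat M E v q)"
  "sat M E v (Exists p) \<longleftrightarrow> (\<exists>a\<in>M. sat M E (case_nat a v) p)"
  by (auto simp: Neg_def Conj_def Disj_def Iff_def Exists_def)

lemma sat_rename: "sat M E v (rename f p) \<longleftrightarrow> sat M E (\<lambda>n. v (f n)) p"
proof (induction p arbitrary: v f)
  case (Forall p)
  have "(\<lambda>n. case_nat a v (case_nat 0 (\<lambda>n. Suc (f n)) n)) = case_nat a (\<lambda>n. v (f n))" for a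
    by (auto split: nat.split)
  then show ?case by (simp add: Forall)
qed auto

subsection \<open>The axioms of ZFC\<close>

text \<open>Each axiom is followed by its meaning in a structure, written with bound variables.\<close>

definition Extensionality :: fm where
  "Extensionality =
     Forall (Forall (Implies (Forall (Iff (Mem 0 2) (Mem 0 1))) (Equal 1 0)))"

lemma sat_Extensionality:
  "sat M E v Extensionality \<longleftrightarrow>
     (\<forall>x\<in>M. \<forall>y\<in>M. (\<forall>z\<in>M. (z, x) \<in> E \<longleftrightarrow> (z, y) \<in> E) \<longrightarrow> x = y)"
  by (simp only: Extensionality_def sat_connectives sat.simps nat.case One_nat_def numeral_2_eq_2 numeral_3_eq_3)

definition Foundation :: fm where
  "Foundation =
     Forall (Implies (Exists (Mem 0 1))
       (Exists (Conj (Mem 0 1) (Neg (Exists (Conj (Mem 0 2) (Mem 0 1)))))))"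

lemma sat_Foundation:
  "sat M E v Foundation \<longleftrightarrow>
     (\<forall>x\<in>M. (\<exists>y\<in>M. (y, x) \<in> E) \<longrightarrow>
        (\<exists>y\<in>M. (y, x) \<in> E \<and> \<not> (\<exists>z\<in>M. (z, x) \<in> E \<and> (z, y) \<in> E)))"
  by (simp only: Foundation_def sat_connectives sat.simps nat.case One_nat_def numeral_2_eq_2 numeral_3_eq_3)

definition Pairing :: fm where
  "Pairing =
     Forall (Forall (Exists (Forall (Iff (Mem 0 1) (Disj (Equal 0 3) (Equal 0 2))))))"

lemma sat_Pairing:
  "sat M E v Pairing \<longleftrightarrow>
     (\<forall>x\<in>M. \<forall>y\<in>M. \<exists>z\<in>M. \<forall>w\<in>M. (w, z) \<in> E \<longleftrightarrow> w = x \<or> w = y)"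
  by (simp only: Pairing_def sat_connectives sat.simps nat.case One_nat_def numeral_2_eq_2 numeral_3_eq_3)

definition Union_ax :: fm where
  "Union_ax =
     Forall (Exists (Forall (Iff (Mem 0 1) (Exists (Conj (Mem 1 0) (Mem 0 3))))))"

lemma sat_Union_ax:
  "sat M E v Union_ax \<longleftrightarrow>
     (\<forall>x\<in>M. \<exists>u\<in>M. \<forall>z\<in>M. (z, u) \<in> E \<longleftrightarrow> (\<exists>y\<in>M. (z, y) \<in> E \<and> (y, x) \<in> E))"
  by (simp only: Union_ax_def sat_connectives sat.simps nat.case One_nat_def numeral_2_eq_2 numeral_3_eq_3)

definition Power_set :: fm where
  "Power_set =
     Forall (Exists (Forall (Iff (Mem 0 1) (Forall (Implies (Mem 0 1) (Mem 0 3))))))"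

lemma sat_Power_set:
  "sat M E v Power_set \<longleftrightarrow>
     (\<forall>x\<in>M. \<exists>y\<in>M. \<forall>z\<in>M. (z, y) \<in> E \<longleftrightarrow> (\<forall>w\<in>M. (w, z) \<in> E \<longrightarrow> (w, x) \<in> E))"
  by (simp only: Power_set_def sat_connectives sat.simps nat.case One_nat_def numeral_2_eq_2 numeral_3_eq_3)

definition Infinity :: fm where
  "Infinity =
     Exists (Conj
       (Exists (Conj (Mem 0 1) (Forall (Neg (Mem 0 1)))))
       (Forall (Implies (Mem 0 1)
         (Exists (Conj (Mem 0 2) (Forall (Iff (Mem 0 1) (Disj (Mem 0 2) (Equal 0 2)))))))))"

lemma sat_Infinity:
  "sat M E v Infinity \<longleftrightarrow>
     (\<exists>x\<in>M. (\<exists>e\<in>M. (e, x) \<in> E \<and> (\<forall>w\<in>M. (w, e) \<notin> E)) \<and>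
        (\<forall>y\<in>M. (y, x) \<in> E \<longrightarrow>
           (\<exists>s\<in>M. (s, x) \<in> E \<and> (\<forall>w\<in>M. (w, s) \<in> E \<longleftrightarrow> (w, y) \<in> E \<or> w = y))))"
  by (simp only: Infinity_def sat_connectives sat.simps nat.case One_nat_def numeral_2_eq_2 numeral_3_eq_3)

definition Choice :: fm where
  "Choice =
     Forall (Implies
       (Conj (Forall (Implies (Mem 0 1) (Exists (Mem 0 1))))
             (Forall (Forall (Implies (Conj (Mem 1 2) (Conj (Mem 0 2) (Neg (Equal 1 0))))
                (Neg (Exists (Conj (Mem 0 2) (Mem 0 1))))))))
       (Exists (Forall (Implies (Mem 0 2)
          (Exists (Forall (Iff (Conj (Mem 0 2) (Mem 0 3)) (Equal 0 1))))))))"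

lemma sat_Choice:
  "sat M E v Choice \<longleftrightarrow>
     (\<forall>F\<in>M. (\<forall>x\<in>M. (x, F) \<in> E \<longrightarrow> (\<exists>y\<in>M. (y, x) \<in> E)) \<and>
        (\<forall>x\<in>M. \<forall>y\<in>M. (x, F) \<in> E \<and> (y, F) \<in> E \<and> x \<noteq> y \<longrightarrow>
           \<not> (\<exists>z\<in>M. (z, x) \<in> E \<and> (z, y) \<in> E)) \<longrightarrow>
        (\<exists>C\<in>M. \<forall>x\<in>M. (x, F) \<in> E \<longrightarrow>
           (\<exists>z\<in>M. \<forall>w\<in>M. (w, x) \<in> E \<and> (w, C) \<in> E \<longleftrightarrow> w = z)))"
  by (simp only: Choice_def sat_connectives sat.simps nat.case One_nat_def numeral_2_eq_2 numeral_3_eq_3)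

text \<open>In \<open>Separation p\<close>, index \<open>0\<close> of \<open>p\<close> is the element, index \<open>1\<close> the given set, and the
  indices from \<open>2\<close> on are parameters.\<close>

definition Separation :: "fm \<Rightarrow> fm" where
  "Separation p =
     Forall (Exists (Forall (Iff (Mem 0 1) (Conj (Mem 0 2) (rename (case_nat 0 (\<lambda>n. n + 2)) p)))))"

lemma sat_Separation:
  "sat M E v (Separation p) \<longleftrightarrow>
     (\<forall>a\<in>M. \<exists>y\<in>M. \<forall>x\<in>M.
        (x, y) \<in> E \<longleftrightarrow> (x, a) \<in> E \<and> sat M E (case_nat x (case_nat a v)) p)"
proof -
  have "(\<lambda>n. case_nat x (case_nat y (case_nat a v)) (case_nat 0 (\<lambda>n. n + 2) n)) =
      case_nat x (case_nat a v)" for x y a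
    by (auto split: nat.split)
  then show ?thesis
    by (simp only: Separation_def sat_rename sat_connectives sat.simps nat.case One_nat_def
        numeral_2_eq_2)
qed

text \<open>In \<open>Replacement p\<close>, index \<open>1\<close> of \<open>p\<close> is the argument, index \<open>0\<close> the value, and the
  indices from \<open>2\<close> on are parameters.\<close>

definition Replacement :: "fm \<Rightarrow> fm" where
  "Replacement p =
     Implies
       (Forall (Forall (Forall (Implies
          (Conj (rename Suc p) (rename (case_nat 0 (\<lambda>n. n + 2)) p)) (Equal 1 0)))))
       (Forall (Exists (Forall (Iff (Mem 0 1)
          (Exists (Conj (Mem 0 3) (rename (case_nat 1 (case_nat 0 (\<lambda>n. n + 4))) p)))))))"

lemma sat_Replacement:
  "sat M E v (Replacement p) \<longleftrightarrow>
     (\<forall>x\<in>M. \<forall>y\<in>M. \<forall>z\<in>M.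
        sat M E (case_nat y (case_nat x v)) p \<and> sat M E (case_nat z (case_nat x v)) p \<longrightarrow> y = z) \<longrightarrow>
     (\<forall>a\<in>M. \<exists>b\<in>M. \<forall>y\<in>M.
        (y, b) \<in> E \<longleftrightarrow> (\<exists>x\<in>M. (x, a) \<in> E \<and> sat M E (case_nat y (case_nat x v)) p))"
proof -
  have "(\<lambda>n. case_nat z (case_nat y (case_nat x v)) (case_nat 0 (\<lambda>n. n + 2) n)) =
      case_nat z (case_nat x v)" for x y z
    by (auto split: nat.split)
  moreover have "(\<lambda>n. case_nat x (case_nat y (case_nat b (case_nat a v)))
        (case_nat 1 (case_nat 0 (\<lambda>n. n + 4)) n)) = case_nat y (case_nat x v)" for x y a b
    by (auto split: nat.split simp: numeral_eq_Suc)
  ultimately show ?thesis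
    by (simp only: Replacement_def sat_rename sat_connectives sat.simps nat.case One_nat_def
        numeral_2_eq_2 numeral_3_eq_3)
qed

text \<open>The parameters of the schemes are universally quantified. Quantifiers beyond those
  needed to close the formula are vacuous.\<close>

definition closures :: "fm \<Rightarrow> fm set" where
  "closures p = {(Forall ^^ n) p | n. fv p \<subseteq> {..<n}}"

definition ZFC :: "fm set" where
  "ZFC =
     {Extensionality, Foundation, Pairing, Union_ax, Power_set, Infinity, Choice} \<union>
     (\<Union>p. closures (Separation p)) \<union> (\<Union>p. closures (Replacement p))"

subsection \<open>\<open>\<omega>\<^sub>1\<close>-like structures and inclusion\<close>

definition omega1_like :: "'a set \<Rightarrow> 'a rel \<Rightarrow> bool" where
  "omega1_like M E \<longleftrightarrow> uncountable M \<and> (\<forall>a\<in>M. countable {b\<in>M. (b, a) \<in> E})"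

definition inclusion :: "'a set \<Rightarrow> 'a rel \<Rightarrow> 'a rel" where
  "inclusion M E = {(a, b) \<in> M \<times> M. \<forall>c\<in>M. (c, a) \<in> E \<longrightarrow> (c, b) \<in> E}"

definition isomorphic :: "'a set \<Rightarrow> 'a rel \<Rightarrow> 'b set \<Rightarrow> 'b rel \<Rightarrow> bool" where
  "isomorphic M R N S \<longleftrightarrow>
     (\<exists>f. bij_betw f M N \<and> (\<forall>x\<in>M. \<forall>y\<in>M. (x, y) \<in> R \<longleftrightarrow> (f x, f y) \<in> S))"

end

theory Submission
  imports Defs "HOL-Library.Countable"
begin

text \<open>Call the trace of \<open>d\<close> on a countable model \<open>M\<close> the set of members of \<open>d\<close> in \<open>M\<close>, where \<open>d\<close>
  belongs to an elementary end extension of \<open>M\<close>. An extension with an element \<open>c\<close> that has all of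
  \<open>M\<close> as members realizes only countably many traces on \<open>M\<close>, and later elementary end extensions
  realize no further ones, because the power set of \<open>c\<close> does not grow. On the other hand, a variant of
  the Keisler--Morley construction yields, for countably many given traces, an extension that
  realizes a different one. An isomorphism of inclusion structures preserves singletons, hence
  transports traces. So one builds a tree of countable models \<open>M\<^sub>s\<close>, and when \<open>\<diamondsuit>\<close> guesses distinct branches \<open>s\<close>, \<open>t\<close> and
  an isomorphism between \<open>M\<^sub>s\<close> and \<open>M\<^sub>t\<close>, one first extends \<open>M\<^sub>t\<close> and then extends \<open>M\<^sub>s\<close> with
  a trace that is not the preimage of a trace in the extension of \<open>M\<^sub>t\<close>.

  The Keisler--Morley construction needs a notion of largeness for definable classes of candidates for \<open>d\<close>
  such that a large class split into set many pieces has a large piece, while every large class is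
  split by some \<open>x\<close>, according to whether \<open>x\<close> belongs to \<open>d\<close>, into two large pieces. Genericity in
  the sense of category would do, but the Baire argument needs a transfinite recursion inside the
  model. Here a class is large if all patterns on some column of sets occur in it; the omitted
  patterns of set many pieces are glued along disjoint subcolumns, without recursion.

  Collection is needed for gluing. To avoid the recursion that gives the cumulative hierarchy and
  transitive closures, one passes to the class of all members of levels, defined as by
  Potter and Button through histories; this class satisfies the axioms of ZFC and collection.\<close>

subsection \<open>Syntax and satisfaction\<close>

text \<open>The step at \<alpha> looks circular: the model on one branch is to be extended with
  knowledge of the extension on another branch of the same height. It is not, because the guess
  orders the two branches: the branch \<open>guess1 \<alpha>\<close> is extended with nothing to
  avoid, and the countably many elements of that extension determine the countably many traces
  forbidden on the branch \<open>guess0 \<alpha>\<close>. Membership is read through inclusion: u is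
  a member of d iff {u} is included in d, and f turns this into the inclusion of f{u} in f d. The
  image f d may appear only at a much later stage on the other branch. Its intersection with the
  element c created at stage \<alpha> already exists at stage \<alpha>, however, and includes the
  same sets from before \<alpha>. This is why c and d are produced together, by one generic
  construction over classes of pairs.\<close>

instance fm :: countable
  by countable_datatype

lemma range_case_nat [simp]: "range (case_nat a v) \<subseteq> M \<longleftrightarrow> a \<in> M \<and> range v \<subseteq> M"
proof -
  have "range (case_nat a v) \<subseteq> M \<longleftrightarrow> (\<forall>n. case_nat a v n \<in> M)" by blast
  also have "\<dots> \<longleftrightarrow> case_nat a v 0 \<in> M \<and> (\<forall>n. case_nat a v (Suc n) \<in> M)"
    using not0_implies_Suc by metis
  finally show ?thesis by auto
qed

lemma finite_fv [simp]: "finite (fv p)"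
proof (induction p)
  case (Forall p)
  have "fv (Forall p) \<subseteq> (\<lambda>n. n - 1) ` fv p" by force
  then show ?case using Forall by (meson finite_imageI finite_subset)
qed auto

lemma sat_cong_fv: "(\<And>n. n \<in> fv p \<Longrightarrow> v n = w n) \<Longrightarrow> sat M E v p \<longleftrightarrow> sat M E w p"
proof (induction p arbitrary: v w)
  case (Forall p)
  have "sat M E (case_nat a v) p \<longleftrightarrow> sat M E (case_nat a w) p" for a
    by (rule Forall.IH) (auto simp: Forall.prems split: nat.split)
  then show ?case by simp
next
  case (Implies p q)
  show ?case
    using Implies.IH(1)[of v w] Implies.IH(2)[of v w] Implies.prems by simp
qed simp_all

lemma rename_cong_fv: "(\<And>n. n \<in> fv p \<Longrightarrow> f n = g n) \<Longrightarrow> rename f p = rename g p"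
proof (induction p arbitrary: f g)
  case (Forall p)
  show ?case
    by (simp, rule Forall.IH) (auto simp: Forall.prems split: nat.split)
next
  case (Implies p q)
  show ?case
    using Implies.IH(1)[of f g] Implies.IH(2)[of f g] Implies.prems by simp
qed simp_all

lemma case_nat_Suc_id: "case_nat 0 (\<lambda>n. Suc n) = (\<lambda>n. n)"
  by (rule ext) (auto split: nat.split)

lemma rename_id [simp]: "rename (\<lambda>n. n) p = p"
  by (induction p) (auto simp: case_nat_Suc_id)

lemma rename_rename: "rename f (rename g p) = rename (\<lambda>n. f (g n)) p"
proof (induction p arbitrary: f g)
  case (Forall p)
  have "(\<lambda>n. case_nat 0 (\<lambda>n. Suc (f n)) (case_nat 0 (\<lambda>n. Suc (g n)) n))
      = case_nat 0 (\<lambda>n. Suc (f (g n)))"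
    by (rule ext) (auto split: nat.split)
  then show ?case by (simp add: Forall)
qed auto

lemma rename_Neg [simp]: "rename f (Neg p) = Neg (rename f p)"
  by (simp add: Neg_def)

lemma rename_inst: "rename f (inst t p) = inst (f t) (rename (case_nat 0 (\<lambda>n. Suc (f n))) p)"
proof -
  have "(\<lambda>n. f (case_nat t (\<lambda>n. n) n)) =
      (\<lambda>n. case_nat (f t) (\<lambda>n. n) (case_nat 0 (\<lambda>n. Suc (f n)) n))"
    by (rule ext) (auto split: nat.split)
  then show ?thesis by (simp add: inst_def rename_rename)
qed

lemma inst_rename: "inst t (rename (case_nat 0 (\<lambda>n. Suc (f n))) p) = rename (case_nat t f) p"
proof -
  have "(\<lambda>n. case_nat t (\<lambda>n. n) (case_nat 0 (\<lambda>n. Suc (f n)) n)) = case_nat t f"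
    by (rule ext) (auto split: nat.split)
  then show ?thesis by (simp add: inst_def rename_rename)
qed

lemma sat_inst: "sat M E v (inst t p) \<longleftrightarrow> sat M E (case_nat (v t) v) p"
proof -
  have "(\<lambda>n. v (case_nat t (\<lambda>n. n) n)) = case_nat (v t) v"
    by (rule ext) (auto split: nat.split)
  then show ?thesis by (simp add: inst_def sat_rename)
qed

definition valid :: "'a set \<Rightarrow> 'a rel \<Rightarrow> fm \<Rightarrow> bool" where
  "valid M E p \<longleftrightarrow> (\<forall>v. range v \<subseteq> M \<longrightarrow> sat M E v p)"

lemma valid_Forall: "valid M E (Forall p) \<longleftrightarrow> valid M E p"
proof
  assume L: "valid M E (Forall p)"
  show "valid M E p"
    unfolding valid_def
  proof (intro allI impI)
    fix v :: "nat \<Rightarrow> 'a"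
    assume v: "range v \<subseteq> M"
    have "sat M E (case_nat (v 0) (\<lambda>n. v (Suc n))) p"
      using L v by (auto simp: valid_def image_subset_iff)
    moreover have "case_nat (v 0) (\<lambda>n. v (Suc n)) = v"
      by (rule ext) (auto split: nat.split)
    ultimately show "sat M E v p" by simp
  qed
qed (auto simp: valid_def)

lemma valid_Forall_pow: "valid M E ((Forall ^^ n) p) \<longleftrightarrow> valid M E p"
  by (induction n) (auto simp: valid_Forall)

lemma fv_Forall_pow: "fv ((Forall ^^ n) p) = {k. k + n \<in> fv p}"
  by (induction n) auto

lemma ex_closure: "\<exists>n. fv p \<subseteq> {..<n} \<and> fv ((Forall ^^ n) p) = {}"
proof -
  obtain n where "fv p \<subseteq> {..<n}"
    using finite_nat_iff_bounded[of "fv p"] by auto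
  then show ?thesis by (intro exI[of _ n]) (auto simp: fv_Forall_pow)
qed

lemma valid_closures: "(\<forall>q\<in>closures p. valid M E q) \<longleftrightarrow> valid M E p"
proof -
  obtain n where "(Forall ^^ n) p \<in> closures p"
    using ex_closure[of p] unfolding closures_def by blast
  then show ?thesis
    unfolding closures_def using valid_Forall_pow by blast
qed

lemma models_ZFC_iff:
  "models M E ZFC \<longleftrightarrow> M \<noteq> {} \<and>
     (\<forall>p\<in>{Extensionality, Foundation, Pairing, Union_ax, Power_set, Infinity, Choice}. valid M E p) \<and>
     (\<forall>p. valid M E (Separation p)) \<and> (\<forall>p. valid M E (Replacement p))"
proof -
  have "models M E ZFC \<longleftrightarrow> M \<noteq> {} \<and> (\<forall>p\<in>ZFC. valid M E p)"
    by (auto simp: models_def valid_def)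
  also have "\<dots> \<longleftrightarrow> M \<noteq> {} \<and>
     (\<forall>p\<in>{Extensionality, Foundation, Pairing, Union_ax, Power_set, Infinity, Choice}. valid M E p) \<and>
     (\<forall>p. \<forall>q\<in>closures (Separation p). valid M E q) \<and> (\<forall>p. \<forall>q\<in>closures (Replacement p). valid M E q)"
    unfolding ZFC_def by blast
  finally show ?thesis by (simp only: valid_closures)
qed

lemma ZFC_closed: "p \<in> ZFC \<Longrightarrow> fv p = {}"
  unfolding ZFC_def
proof (elim UnE)
  assume "p \<in> {Extensionality, Foundation, Pairing, Union_ax, Power_set, Infinity, Choice}"
  then show ?thesis
    by (auto simp: Extensionality_def Foundation_def Pairing_def Union_ax_def Power_set_def
        Infinity_def Choice_def Neg_def Conj_def Disj_def Iff_def Exists_def)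
qed (auto simp: closures_def fv_Forall_pow)

subsection \<open>The proof calculus\<close>

lemma proves_mono: "\<Gamma> \<turnstile> p \<Longrightarrow> \<Gamma> \<subseteq> \<Delta> \<Longrightarrow> \<Delta> \<turnstile> p"
proof (induction arbitrary: \<Delta> rule: proves.induct)
  case (Assm p \<Gamma>)
  then show ?case by (auto intro: proves.Assm)
next
  case (ImpI p \<Gamma> q)
  then show ?case by (meson insert_mono proves.ImpI)
next
  case (ImpE \<Gamma> p q)
  then show ?case by (meson proves.ImpE)
next
  case (RAA p \<Gamma>)
  then show ?case by (meson insert_mono proves.RAA)
next
  case (AllI \<Gamma> p)
  then show ?case by (meson image_mono proves.AllI)
next
  case (AllE \<Gamma> p t)
  then show ?case by (meson proves.AllE)
next
  case (EqRefl \<Gamma> t)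
  show ?case by (rule proves.EqRefl)
next
  case (EqSubst \<Gamma> s t p)
  then show ?case by (meson proves.EqSubst)
qed

lemma proves_rename: "\<Gamma> \<turnstile> p \<Longrightarrow> rename f ` \<Gamma> \<turnstile> rename f p"
proof (induction arbitrary: f rule: proves.induct)
  case (Assm p \<Gamma>)
  then show ?case by (auto intro: proves.Assm)
next
  case (ImpI p \<Gamma> q)
  show ?case using ImpI.IH[of f] by (auto intro: proves.ImpI)
next
  case (ImpE \<Gamma> p q)
  show ?case using ImpE.IH[of f] by (auto intro: proves.ImpE)
next
  case (RAA p \<Gamma>)
  show ?case using RAA.IH[of f] by (auto intro: proves.RAA)
next
  case (AllI \<Gamma> p)
  have "rename (case_nat 0 (\<lambda>n. Suc (f n))) ` rename Suc ` \<Gamma> = rename Suc ` rename f ` \<Gamma>"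
    by (simp add: image_image rename_rename)
  then show ?case using AllI.IH[of "case_nat 0 (\<lambda>n. Suc (f n))"] by (auto intro: proves.AllI)
next
  case (AllE \<Gamma> p t)
  show ?case using AllE.IH[of f] by (auto simp: rename_inst intro: proves.AllE)
next
  case (EqRefl \<Gamma> t)
  show ?case by (auto intro: proves.EqRefl)
next
  case (EqSubst \<Gamma> s t p)
  show ?case using EqSubst.IH[of f] by (auto simp: rename_inst intro: proves.EqSubst)
qed

lemma soundness:
  "\<Gamma> \<turnstile> p \<Longrightarrow> range v \<subseteq> M \<Longrightarrow> \<forall>q\<in>\<Gamma>. sat M E v q \<Longrightarrow> sat M E v p"
proof (induction arbitrary: v rule: proves.induct)
  case (AllI \<Gamma> p)
  show ?case
    unfolding sat.simps
  proof
    fix a assume "a \<in> M"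
    then show "sat M E (case_nat a v) p"
      using AllI.prems by (intro AllI.IH) (auto simp: sat_rename)
  qed
next
  case (RAA p \<Gamma>)
  show ?case using RAA.IH[of v] RAA.prems by auto
next
  case (ImpI p \<Gamma> q)
  show ?case using ImpI.IH[of v] ImpI.prems by auto
next
  case (ImpE \<Gamma> p q)
  show ?case using ImpE.IH(1)[of v] ImpE.IH(2)[of v] ImpE.prems by simp
next
  case (AllE \<Gamma> p t)
  show ?case using AllE.IH[of v] AllE.prems by (auto simp: sat_inst)
next
  case (EqSubst \<Gamma> s t p)
  show ?case using EqSubst.IH(1)[of v] EqSubst.IH(2)[of v] EqSubst.prems by (simp add: sat_inst)
qed auto

lemma satisfiable_consistent:
  "range v \<subseteq> M \<Longrightarrow> \<forall>q\<in>\<Gamma>. sat M E v q \<Longrightarrow> consistent \<Gamma>"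
  unfolding consistent_def using soundness[of \<Gamma> Falsum v M E] by auto

lemma proves_cut: "insert p \<Gamma> \<turnstile> q \<Longrightarrow> \<Gamma> \<turnstile> p \<Longrightarrow> \<Gamma> \<turnstile> q"
  by (rule ImpE[OF ImpI])

lemma consistent_split: "consistent \<Gamma> \<Longrightarrow> consistent (insert p \<Gamma>) \<or> consistent (insert (Neg p) \<Gamma>)"
  unfolding consistent_def using RAA proves_cut by blast

lemma proves_Falsum: "\<Gamma> \<turnstile> Falsum \<Longrightarrow> \<Gamma> \<turnstile> p"
  by (rule RAA, rule proves_mono) auto

text \<open>The renaming that sends \<open>k\<close> to \<open>0\<close> and any other
  \<open>n\<close> to \<open>Suc n\<close> agrees with \<open>Suc\<close> on \<Gamma>, where
  \<open>k\<close> is not free, and undoes the instantiation in \<open>inst k p\<close>. It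
  therefore turns the given proof into a premise of \<open>AllI\<close>.\<close>

lemma generalize_fresh:
  assumes "\<Gamma> \<turnstile> inst k p" and "\<And>q. q \<in> \<Gamma> \<Longrightarrow> k \<notin> fv q" and "k \<notin> fv (Forall p)"
  shows "\<Gamma> \<turnstile> Forall p"
proof (rule AllI)
  define f where "f n = (if n = k then 0 else Suc n)" for n
  have "rename f ` \<Gamma> \<turnstile> rename f (inst k p)"
    by (rule proves_rename[OF assms(1)])
  moreover have "rename f ` \<Gamma> = rename Suc ` \<Gamma>"
    using assms(2) by (intro image_cong refl rename_cong_fv) (auto simp: f_def)
  moreover have "rename f (inst k p) = rename (\<lambda>n. n) p"
    unfolding inst_def rename_rename
    using assms(3) by (intro rename_cong_fv) (auto simp: f_def split: nat.split)
  ultimately show "rename Suc ` \<Gamma> \<turnstile> p" by simp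
qed

subsection \<open>Henkin sets and their models\<close>

text \<open>The properties of a maximal consistent set in which every false universal formula has a
  variable as a counterexample. The variables themselves serve as Henkin constants, so the language
  stays the same.\<close>

locale henkin_set =
  fixes G :: "fm set"
  assumes Falsum: "Falsum \<notin> G"
    and Implies: "Implies p q \<in> G \<longleftrightarrow> (p \<in> G \<longrightarrow> q \<in> G)"
    and Forall: "Forall p \<in> G \<longleftrightarrow> (\<forall>k. inst k p \<in> G)"
    and Equal_refl: "Equal k k \<in> G"
    and Equal_Mem: "Equal k l \<in> G \<Longrightarrow> Equal k' l' \<in> G \<Longrightarrow> Mem k k' \<in> G \<Longrightarrow> Mem l l' \<in> G"
    and Equal_Equal: "Equal k l \<in> G \<Longrightarrow> Equal k' l' \<in> G \<Longrightarrow> Equal k k' \<in> G \<Longrightarrow> Equal l l' \<in> G"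
begin

text \<open>A canonical element of the equality class, so that the quotient is again a set of
  natural numbers.\<close>

definition rep :: "nat \<Rightarrow> nat" where "rep k = (LEAST l. Equal k l \<in> G)"
definition dom :: "nat set" where "dom = range rep"
definition rel :: "nat rel" where "rel = {(rep k, rep l) | k l. Mem k l \<in> G}"

lemma Neg: "Neg p \<in> G \<longleftrightarrow> p \<notin> G"
  by (simp add: Neg_def Implies Falsum)

lemma Equal_sym: "Equal k l \<in> G \<Longrightarrow> Equal l k \<in> G"
  using Equal_Equal Equal_refl by blast

lemma Equal_trans: "Equal k l \<in> G \<Longrightarrow> Equal l j \<in> G \<Longrightarrow> Equal k j \<in> G"
  using Equal_Equal Equal_refl by blast

lemma Equal_rep: "Equal k (rep k) \<in> G"
  unfolding rep_def by (rule LeastI[of _ k], rule Equal_refl)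

lemma rep_eq_iff: "rep k = rep l \<longleftrightarrow> Equal k l \<in> G"
proof
  assume "rep k = rep l"
  then show "Equal k l \<in> G"
    using Equal_rep[of k] Equal_rep[of l] Equal_sym Equal_trans by metis
next
  assume "Equal k l \<in> G"
  then have "Equal k j \<in> G \<longleftrightarrow> Equal l j \<in> G" for j
    using Equal_sym Equal_trans by blast
  then show "rep k = rep l" by (simp add: rep_def)
qed

lemma rel_iff: "(rep k, rep l) \<in> rel \<longleftrightarrow> Mem k l \<in> G"
proof
  assume "(rep k, rep l) \<in> rel"
  then obtain k' l' where "Equal k' k \<in> G" "Equal l' l \<in> G" "Mem k' l' \<in> G"
    by (auto simp: rel_def rep_eq_iff intro: Equal_sym)
  then show "Mem k l \<in> G" by (rule Equal_Mem)
qed (auto simp: rel_def)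

lemma truth: "sat dom rel (\<lambda>n. rep (v n)) p \<longleftrightarrow> rename v p \<in> G"
proof (induction p arbitrary: v)
  case (Forall p)
  have "(\<lambda>n. rep (case_nat k v n)) = case_nat (rep k) (\<lambda>n. rep (v n))" for k
    by (rule ext) (auto split: nat.split)
  then have "sat dom rel (case_nat (rep k) (\<lambda>n. rep (v n))) p \<longleftrightarrow> rename (case_nat k v) p \<in> G" for k
    using Forall.IH[of "case_nat k v"] by simp
  then show ?case
    by (simp add: henkin_set.Forall[OF henkin_set_axioms] inst_rename dom_def)
qed (auto simp: rel_iff rep_eq_iff Falsum Implies)

lemma rel_subset: "rel \<subseteq> dom \<times> dom"
  by (auto simp: rel_def dom_def)

lemma closed_truth: "fv p = {} \<Longrightarrow> valid dom rel p \<longleftrightarrow> p \<in> G"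
proof -
  assume p: "fv p = {}"
  have "sat dom rel v p \<longleftrightarrow> p \<in> G" for v
    using truth[of "\<lambda>n. n" p] sat_cong_fv[of p v "\<lambda>n. rep n"] p by simp
  then show ?thesis by (auto simp: valid_def dom_def)
qed

end

section \<open>Generic Henkin sets and a countable model of ZFC\<close>

text \<open>The Rasiowa-Sikorski argument: enumerate the requirements and meet the
  \<open>n\<close>-th one at step \<open>n\<close>.\<close>

lemma generic_sequence:
  assumes S: "Con S" and T: "countable T"
    and dense: "\<And>t S. t \<in> T \<Longrightarrow> Con S \<Longrightarrow> \<exists>S'. S \<subseteq> S' \<and> Con S' \<and> t S'"
  shows "\<exists>F :: nat \<Rightarrow> 'b set. F 0 = S \<and> mono F \<and> (\<forall>n. Con (F n)) \<and> (\<forall>t\<in>T. \<exists>n. t (F n))"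
proof -
  \<comment> \<open>The trivial requirement leaves something to enumerate when \<open>T\<close> is
    empty.\<close>
  define t where "t = from_nat_into (insert (\<lambda>_. True) T)"
  have t: "t n \<in> insert (\<lambda>_. True) T" for n
    unfolding t_def by (rule from_nat_into) simp
  have "\<exists>F. \<forall>n. (Con (F n) \<and> (n = 0 \<longrightarrow> F n = S)) \<and> F n \<subseteq> F (Suc n) \<and> t n (F (Suc n))"
  proof (rule dependent_nat_choice)
    show "\<exists>x. Con x \<and> (0 = (0::nat) \<longrightarrow> x = S)" using S by blast
    show "\<exists>y. (Con y \<and> (Suc n = 0 \<longrightarrow> y = S)) \<and> x \<subseteq> y \<and> t n y" if "Con x \<and> (n = 0 \<longrightarrow> x = S)" for x n
    proof (cases "t n \<in> T")
      case True
      then show ?thesis using dense[of "t n" x] that by auto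
    next
      case False
      then have "t n = (\<lambda>_. True)" using t[of n] by simp
      then show ?thesis using that by (intro exI[of _ x]) auto
    qed
  qed
  then obtain F where F: "\<And>n. Con (F n)" "F 0 = S" "\<And>n. F n \<subseteq> F (Suc n)" "\<And>n. t n (F (Suc n))"
    by blast
  have "\<exists>n. s (F n)" if "s \<in> T" for s
  proof -
    have "\<exists>n. t n = s"
      using from_nat_into_surj[of "insert (\<lambda>_. True) T" s] T that by (auto simp: t_def)
    then show ?thesis using F(4) by blast
  qed
  moreover have "mono F" using F(3) by (simp add: mono_iff_le_Suc)
  ultimately show ?thesis using F by blast
qed

text \<open>Serves twice: with \<open>Con\<close> meaning consistency with ZFC it gives the first
  model, and with \<open>Con\<close> meaning largeness it gives the end extensions. Besides
  \<open>T\<close>, the sequence meets the requirements \<open>D\<close>, deciding every formula,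
  and \<open>H\<close>, naming a counterexample to every refuted universal formula.\<close>

lemma henkin_generic:
  assumes S: "Con S" and T: "countable T"
    and dense: "\<And>t S. t \<in> T \<Longrightarrow> Con S \<Longrightarrow> \<exists>S'. S \<subseteq> S' \<and> Con S' \<and> t S'"
    and cons: "\<And>S. Con S \<Longrightarrow> consistent S"
    and split: "\<And>S p. Con S \<Longrightarrow> Con (insert p S) \<or> Con (insert (Neg p) S)"
    and wit: "\<And>S p. Con S \<Longrightarrow> Neg (Forall p) \<in> S \<Longrightarrow> \<exists>k. Con (insert (Neg (inst k p)) S)"
  obtains G where "henkin_set G" "S \<subseteq> G" "\<And>F. finite F \<Longrightarrow> F \<subseteq> G \<Longrightarrow> \<exists>S'. F \<subseteq> S' \<and> Con S'"
    "\<And>t. t \<in> T \<Longrightarrow> \<exists>S'. S' \<subseteq> G \<and> Con S' \<and> t S'"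
proof -
  define D where "D p S \<longleftrightarrow> p \<in> S \<or> Neg p \<in> S" for p S
  define H where "H p S \<longleftrightarrow> Forall p \<in> S \<or> (\<exists>k. Neg (inst k p) \<in> S)" for p S
  have ex: "\<exists>F :: nat \<Rightarrow> fm set. F 0 = S \<and> mono F \<and> (\<forall>n. Con (F n)) \<and> (\<forall>t\<in>T \<union> range D \<union> range H. \<exists>n. t (F n))"
  proof (rule generic_sequence)
    fix t S' assume t: "t \<in> T \<union> range D \<union> range H" and S': "Con S'"
    from t consider "t \<in> T" | p where "t = D p" | p where "t = H p" by blast
    then show "\<exists>S''. S' \<subseteq> S'' \<and> Con S'' \<and> t S''"
    proof cases
      case 2
      then show ?thesis using split[OF S', of p] by (auto simp: D_def)
    next
      case (3 p)
      from split[OF S', of "Forall p"] show ?thesis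
      proof
        assume "Con (insert (Forall p) S')"
        then show ?thesis by (intro exI[of _ "insert (Forall p) S'"]) (auto simp: H_def 3)
      next
        assume "Con (insert (Neg (Forall p)) S')"
        then obtain k where "Con (insert (Neg (inst k p)) (insert (Neg (Forall p)) S'))"
          using wit by blast
        then show ?thesis
          by (intro exI[of _ "insert (Neg (inst k p)) (insert (Neg (Forall p)) S')"]) (auto simp: H_def 3)
      qed
    qed (use dense S' in auto)
  qed (use S T in auto)
  from ex obtain F :: "nat \<Rightarrow> fm set" where "F 0 = S \<and> mono F \<and> (\<forall>n. Con (F n)) \<and> (\<forall>t\<in>T \<union> range D \<union> range H. \<exists>n. t (F n))"
    by (rule exE)
  then have F: "F 0 = S" "mono F" "\<And>n. Con (F n)"
    and meets: "\<And>t. t \<in> T \<union> range D \<union> range H \<Longrightarrow> \<exists>n. t (F n)"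
    by simp_all
  define G where "G = (\<Union>n. F n)"
  have fin: "\<exists>n. A \<subseteq> F n" if "finite A" "A \<subseteq> G" for A
    using that
  proof (induction A rule: finite_induct)
    case (insert x A)
    then obtain n k where "A \<subseteq> F n" "x \<in> F k" by (auto simp: G_def)
    moreover have "F n \<subseteq> F (max n k)" "F k \<subseteq> F (max n k)" using F(2) by (auto simp: mono_def)
    ultimately show ?case by blast
  qed auto
  \<comment> \<open>\<open>G\<close> decides \<open>p\<close>; if it contained \<open>Neg p\<close>,
    a single \<open>F n\<close> would contain \<open>Neg p\<close> together with \<open>A\<close>
    and would be inconsistent.\<close>
  have deduct: "p \<in> G" if pr: "A \<turnstile> p" and A: "finite A" "A \<subseteq> G" for A p
  proof (rule ccontr)
    assume "p \<notin> G"
    then have "Neg p \<in> G" using meets[of "D p"] by (auto simp: D_def G_def)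
    then obtain n where n: "insert (Neg p) A \<subseteq> F n" using fin[of "insert (Neg p) A"] A by auto
    have "insert (Neg p) A \<turnstile> Implies p Falsum" "insert (Neg p) A \<turnstile> p"
      using proves_mono[OF pr, of "insert (Neg p) A"] by (auto simp: Neg_def intro: Assm)
    then have "insert (Neg p) A \<turnstile> Falsum" by (rule ImpE)
    then show False using cons[OF F(3)[of n]] n proves_mono by (auto simp: consistent_def)
  qed
  have neg: "Neg p \<in> G \<longleftrightarrow> p \<notin> G" for p
  proof
    assume "Neg p \<in> G"
    show "p \<notin> G"
    proof
      assume "p \<in> G"
      then obtain n where n: "{Neg p, p} \<subseteq> F n" using fin[of "{Neg p, p}"] \<open>Neg p \<in> G\<close> by auto
      have "{Neg p, p} \<turnstile> Falsum"
        unfolding Neg_def by (meson Assm ImpE insertCI)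
      then show False using cons[OF F(3)[of n]] n proves_mono by (auto simp: consistent_def)
    qed
  next
    assume "p \<notin> G"
    then show "Neg p \<in> G" using meets[of "D p"] by (auto simp: D_def G_def)
  qed
  have falsum: "Falsum \<notin> G"
  proof
    assume "Falsum \<in> G"
    then obtain n where "Falsum \<in> F n" by (auto simp: G_def)
    then show False using cons[OF F(3)[of n]] Assm by (auto simp: consistent_def)
  qed
  have "henkin_set G"
  proof
    show "Falsum \<notin> G" by (rule falsum)
    show "Implies p q \<in> G \<longleftrightarrow> (p \<in> G \<longrightarrow> q \<in> G)" for p q
    proof (intro iffI impI)
      assume "Implies p q \<in> G" "p \<in> G"
      moreover have "{Implies p q, p} \<turnstile> q" by (meson Assm ImpE insertCI)
      ultimately show "q \<in> G" using deduct by blast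
    next
      assume "p \<in> G \<longrightarrow> q \<in> G"
      then consider "q \<in> G" | "Neg p \<in> G" using neg by blast
      then show "Implies p q \<in> G"
      proof cases
        case 1
        have "{q} \<turnstile> Implies p q" by (meson Assm ImpI insertCI)
        then show ?thesis using deduct 1 by blast
      next
        case 2
        have "insert p {Neg p} \<turnstile> Falsum"
          unfolding Neg_def by (meson Assm ImpE insertCI)
        then have "{Neg p} \<turnstile> Implies p q" by (meson ImpI proves_Falsum)
        then show ?thesis using deduct 2 by blast
      qed
    qed
    show "Forall p \<in> G \<longleftrightarrow> (\<forall>k. inst k p \<in> G)" for p
    proof (intro iffI allI)
      fix k assume "Forall p \<in> G"
      moreover have "{Forall p} \<turnstile> inst k p" by (meson Assm AllE insertCI)
      ultimately show "inst k p \<in> G" using deduct by blast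
    next
      assume "\<forall>k. inst k p \<in> G"
      then show "Forall p \<in> G" using meets[of "H p"] neg by (auto simp: H_def G_def)
    qed
    show "Equal k k \<in> G" for k using deduct[OF EqRefl, of "{}" k] by simp
    have subst: "inst l p \<in> G" if "Equal k l \<in> G" "inst k p \<in> G" for k l p
    proof -
      have "{Equal k l, inst k p} \<turnstile> inst l p"
        by (rule EqSubst[of _ k]) (auto intro: Assm)
      then show ?thesis using deduct that by blast
    qed
    show "Mem l l' \<in> G" if "Equal k l \<in> G" "Equal k' l' \<in> G" "Mem k k' \<in> G" for k l k' l'
      using subst[OF that(1), of "Mem 0 (Suc k')"] subst[OF that(2), of "Mem (Suc l) 0"] that(3)
      by (simp add: inst_def)
    show "Equal l l' \<in> G" if "Equal k l \<in> G" "Equal k' l' \<in> G" "Equal k k' \<in> G" for k l k' l'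
      using subst[OF that(1), of "Equal 0 (Suc k')"] subst[OF that(2), of "Equal (Suc l) 0"] that(3)
      by (simp add: inst_def)
  qed
  moreover have "S \<subseteq> G" using F(1) by (auto simp: G_def)
  moreover have "\<exists>S'. A \<subseteq> S' \<and> Con S'" if "finite A" "A \<subseteq> G" for A
    using fin[OF that] F(3) by blast
  moreover have "\<exists>S'. S' \<subseteq> G \<and> Con S' \<and> t S'" if "t \<in> T" for t
    using meets[of t] that F(3) by (auto simp: G_def)
  ultimately show thesis by (rule that)
qed

text \<open>A condition is finite and the axioms are closed, so there is always a variable that is
  fresh for both and can witness a refuted universal formula. The requirements put the axioms into
  \<open>G\<close>.\<close>

lemma ZFC_model_exists:
  assumes "consistent ZFC"
  obtains M :: "nat set" and E where "models M E ZFC" "E \<subseteq> M \<times> M"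
proof -
  define Con where "Con S \<longleftrightarrow> finite S \<and> consistent (ZFC \<union> S)" for S
  obtain G where G: "henkin_set G" and ax: "\<And>p. p \<in> ZFC \<Longrightarrow> p \<in> G"
  proof (rule henkin_generic[of Con "{}" "(\<lambda>p S. p \<in> S) ` ZFC"])
    show "Con {}" using assms by (simp add: Con_def)
    show "countable ((\<lambda>p S. p \<in> S) ` ZFC)" by simp
    show "\<exists>S'. S \<subseteq> S' \<and> Con S' \<and> t S'" if "t \<in> (\<lambda>p S. p \<in> S) ` ZFC" "Con S" for t S
    proof -
      obtain p where p: "p \<in> ZFC" "t = (\<lambda>S. p \<in> S)" using \<open>t \<in> _\<close> by blast
      then have "ZFC \<union> insert p S = ZFC \<union> S" by auto
      then show ?thesis using p \<open>Con S\<close> by (intro exI[of _ "insert p S"]) (auto simp: Con_def)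
    qed
    show "consistent S" if "Con S" for S
      using that proves_mono[of S Falsum "ZFC \<union> S"] by (auto simp: Con_def consistent_def)
    show "Con (insert p S) \<or> Con (insert (Neg p) S)" if "Con S" for S p
      using that consistent_split[of "ZFC \<union> S" p] by (auto simp: Con_def)
    show "\<exists>k. Con (insert (Neg (inst k p)) S)" if S: "Con S" and n: "Neg (Forall p) \<in> S" for S p
    proof -
      have "finite (fv (Forall p) \<union> (\<Union>q\<in>S. fv q))" using S by (auto simp: Con_def simp del: fv.simps)
      then obtain k where k: "k \<notin> fv (Forall p) \<union> (\<Union>q\<in>S. fv q)" using ex_new_if_finite infinite_UNIV_nat by blast
      have "consistent (insert (Neg (inst k p)) (ZFC \<union> S))"
        unfolding consistent_def
      proof
        assume "insert (Neg (inst k p)) (ZFC \<union> S) \<turnstile> Falsum"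
        then have "ZFC \<union> S \<turnstile> inst k p" by (rule RAA)
        then have "ZFC \<union> S \<turnstile> Forall p"
          by (rule generalize_fresh) (use k ZFC_closed in auto)
        moreover have "ZFC \<union> S \<turnstile> Implies (Forall p) Falsum"
          using n by (auto intro: Assm simp: Neg_def)
        ultimately show False using S ImpE by (auto simp: Con_def consistent_def)
      qed
      then show ?thesis using S by (auto simp: Con_def)
    qed
  qed (use that in blast)+
  interpret henkin_set G by fact
  have "\<forall>p\<in>ZFC. valid dom rel p" using ax ZFC_closed closed_truth by auto
  then have "models dom rel ZFC" by (auto simp: models_def valid_def dom_def)
  then show ?thesis using that rel_subset by blast
qed

subsection \<open>Definability with parameters in a countable model\<close>

definition collects :: "'a set \<Rightarrow> 'a rel \<Rightarrow> bool" where
  "collects M E \<longleftrightarrow> (\<forall>p v. range v \<subseteq> M \<longrightarrow> (\<forall>a\<in>M.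
     (\<forall>x\<in>M. (x, a) \<in> E \<longrightarrow> (\<exists>y\<in>M. sat M E (case_nat y (case_nat x v)) p)) \<longrightarrow>
     (\<exists>b\<in>M. \<forall>x\<in>M. (x, a) \<in> E \<longrightarrow> (\<exists>y\<in>M. (y, b) \<in> E \<and> sat M E (case_nat y (case_nat x v)) p))))"

text \<open>Even variables carry arguments and odd variables carry parameters. If \<open>m\<close>
  enumerates the model, every element is available as a parameter under one fixed
  assignment.\<close>

definition mix :: "(nat \<Rightarrow> 'a) \<Rightarrow> (nat \<Rightarrow> 'a) \<Rightarrow> nat \<Rightarrow> 'a" where
  "mix e m n = (if even n then e (n div 2) else m (n div 2))"

lemma mix_simps [simp]: "mix e m (2 * n) = e n" "mix e m (Suc (2 * n)) = m n"
  by (auto simp: mix_def)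

lemma range_mix [simp]: "range (mix e m) \<subseteq> M \<longleftrightarrow> range e \<subseteq> M \<and> range m \<subseteq> M"
proof -
  have "e n \<in> M \<and> m n \<in> M" if "range (mix e m) \<subseteq> M" for n
    using that mix_simps(1)[of e m n] mix_simps(2)[of e m n] by (metis range_subsetD)
  moreover have "mix e m k \<in> range e \<union> range m" for k
    by (simp add: mix_def)
  ultimately show ?thesis by blast
qed

locale zfc_model =
  fixes M :: "'a set" and E :: "'a rel" and m :: "nat \<Rightarrow> 'a"
  assumes ZFC: "models M E ZFC" and range_m: "range m = M"
begin

abbreviation mem :: "'a \<Rightarrow> 'a \<Rightarrow> bool"  (infix \<open>\<epsilon>\<close> 50) where
  "x \<epsilon> y \<equiv> (x, y) \<in> E"

text \<open>Definability with parameters, as a property of predicates of the metalanguage. The rules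
  collected in \<open>dfp\<close> follow the shape of a predicate, so instances of the schemes are
  obtained without writing formulas.\<close>

definition Dfp :: "((nat \<Rightarrow> 'a) \<Rightarrow> bool) \<Rightarrow> bool" where
  "Dfp P \<longleftrightarrow> (\<exists>p. \<forall>e. range e \<subseteq> M \<longrightarrow> (P e \<longleftrightarrow> sat M E (mix e m) p))"

definition trm :: "((nat \<Rightarrow> 'a) \<Rightarrow> 'a) \<Rightarrow> bool" where
  "trm t \<longleftrightarrow> (\<exists>n. \<forall>e. t e = mix e m n)"

named_theorems dfp

lemma trm_var [dfp]: "trm (\<lambda>e. e n)"
  unfolding trm_def by (rule exI[of _ "2 * n"]) simp

lemma trm_const [dfp]: "a \<in> M \<Longrightarrow> trm (\<lambda>e. a)"
proof -
  assume "a \<in> M"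
  then obtain n where "a = m n" using range_m by blast
  then show ?thesis unfolding trm_def by (intro exI[of _ "Suc (2 * n)"]) simp
qed

lemma trm_cases: "trm t \<Longrightarrow> (\<exists>n. t = (\<lambda>e. e n)) \<or> (\<exists>a\<in>M. t = (\<lambda>e. a))"
proof -
  assume "trm t"
  then obtain n where t: "\<And>e. t e = mix e m n" by (auto simp: trm_def)
  show ?thesis
  proof (cases "even n")
    case True
    then have "t = (\<lambda>e. e (n div 2))" using t by (auto simp: mix_def)
    then show ?thesis by blast
  next
    case False
    then have "t = (\<lambda>e. m (n div 2))" using t by (auto simp: mix_def)
    then show ?thesis using range_m by blast
  qed
qed

lemma trm_shift: "trm t \<Longrightarrow> trm (\<lambda>e. t (\<lambda>n. e (Suc n)))"
  using trm_cases[of t] by (auto intro: dfp)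

lemma trm_in: "trm t \<Longrightarrow> range e \<subseteq> M \<Longrightarrow> t e \<in> M"
  using trm_cases[of t] by auto

lemma Dfp_rename:
  assumes "Dfp P" and t: "\<And>n. trm (t n)"
  shows "Dfp (\<lambda>e. P (\<lambda>n. t n e))"
proof -
  obtain p where p: "\<And>e. range e \<subseteq> M \<Longrightarrow> P e \<longleftrightarrow> sat M E (mix e m) p"
    using assms(1) by (auto simp: Dfp_def)
  obtain s where s: "\<And>n e. t n e = mix e m (s n)"
    using t unfolding trm_def by metis
  define f where "f n = (if even n then s (n div 2) else n)" for n
  have "mix (\<lambda>n. t n e) m = (\<lambda>n. mix e m (f n))" for e
    by (rule ext) (auto simp: mix_def f_def s)
  moreover have "range (\<lambda>n. t n e) \<subseteq> M" if "range e \<subseteq> M" for e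
    using trm_in[OF t that] by blast
  ultimately show ?thesis
    unfolding Dfp_def by (intro exI[of _ "rename f p"]) (simp add: p sat_rename)
qed

lemma Dfp_mem [dfp]: "trm s \<Longrightarrow> trm t \<Longrightarrow> Dfp (\<lambda>e. s e \<epsilon> t e)"
  unfolding trm_def Dfp_def by (metis sat.simps(1))

lemma Dfp_eq [dfp]: "trm s \<Longrightarrow> trm t \<Longrightarrow> Dfp (\<lambda>e. s e = t e)"
  unfolding trm_def Dfp_def by (metis sat.simps(2))

lemma Dfp_const [dfp]: "Dfp (\<lambda>e. c)"
  unfolding Dfp_def
  by (rule exI[of _ "if c then Implies Falsum Falsum else Falsum"]) simp

lemma Dfp_imp [dfp]: "Dfp P \<Longrightarrow> Dfp Q \<Longrightarrow> Dfp (\<lambda>e. P e \<longrightarrow> Q e)"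
  unfolding Dfp_def by (metis sat.simps(4))

lemma Dfp_not [dfp]: "Dfp P \<Longrightarrow> Dfp (\<lambda>e. \<not> P e)"
  unfolding Dfp_def by (metis sat_connectives(1))

lemma Dfp_conj [dfp]: "Dfp P \<Longrightarrow> Dfp Q \<Longrightarrow> Dfp (\<lambda>e. P e \<and> Q e)"
  unfolding Dfp_def by (metis sat_connectives(2))

lemma Dfp_disj [dfp]: "Dfp P \<Longrightarrow> Dfp Q \<Longrightarrow> Dfp (\<lambda>e. P e \<or> Q e)"
  unfolding Dfp_def by (metis sat_connectives(3))

lemma Dfp_iff [dfp]: "Dfp P \<Longrightarrow> Dfp Q \<Longrightarrow> Dfp (\<lambda>e. P e \<longleftrightarrow> Q e)"
  unfolding Dfp_def by (metis sat_connectives(4))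

lemma Dfp_ball [dfp]:
  assumes "Dfp (\<lambda>e. Q (e 0) (\<lambda>n. e (Suc n)))"
  shows "Dfp (\<lambda>e. \<forall>x\<in>M. Q x e)"
proof -
  obtain p where p: "\<And>e. range e \<subseteq> M \<Longrightarrow> Q (e 0) (\<lambda>n. e (Suc n)) \<longleftrightarrow> sat M E (mix e m) p"
    using assms by (auto simp: Dfp_def)
  \<comment> \<open>Removing the bound argument lowers an even index by 2, and the binder then
    raises every index by 1; parameters feel only the binder.\<close>
  define f where "f n = (if even n then (if n = 0 then 0 else Suc (n - 2)) else Suc n)" for n :: nat
  have "mix (case_nat x e) m = (\<lambda>n. case_nat x (mix e m) (f n))" for x e
    by (rule ext) (auto simp: mix_def f_def elim!: evenE oddE split: nat.split)
  then have "Q x e \<longleftrightarrow> sat M E (case_nat x (mix e m)) (rename f p)" if "range e \<subseteq> M" "x \<in> M" for x e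
    using p[of "case_nat x e"] that by (simp add: sat_rename)
  then show ?thesis
    unfolding Dfp_def by (intro exI[of _ "Forall (rename f p)"]) auto
qed

lemma Dfp_bex [dfp]:
  assumes "Dfp (\<lambda>e. Q (e 0) (\<lambda>n. e (Suc n)))"
  shows "Dfp (\<lambda>e. \<exists>x\<in>M. Q x e)"
  using Dfp_not[OF Dfp_ball[of "\<lambda>x e. \<not> Q x e", OF Dfp_not[OF assms]]] by simp

text \<open>This and its analogues for two and three places reduce definability of a notion at
  arbitrary terms to its definability at variables.\<close>

lemma Dfp1: "Dfp (\<lambda>e. P (e 0)) \<Longrightarrow> trm s \<Longrightarrow> Dfp (\<lambda>e. P (s e))"
  using Dfp_rename[of "\<lambda>e. P (e 0)" "\<lambda>_. s"] by simp

lemma Dfp2: "Dfp (\<lambda>e. P (e 0) (e 1)) \<Longrightarrow> trm s \<Longrightarrow> trm t \<Longrightarrow> Dfp (\<lambda>e. P (s e) (t e))"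
  using Dfp_rename[of "\<lambda>e. P (e 0) (e 1)" "\<lambda>n. if n = 0 then s else t"] by simp

lemma Dfp3: "Dfp (\<lambda>e. P (e 0) (e 1) (e 2)) \<Longrightarrow> trm s \<Longrightarrow> trm t \<Longrightarrow> trm u \<Longrightarrow>
    Dfp (\<lambda>e. P (s e) (t e) (u e))"
  using Dfp_rename[of "\<lambda>e. P (e 0) (e 1) (e 2)" "\<lambda>n. if n = 0 then s else if n = 1 then t else u"]
  by simp

subsection \<open>Basic set theory in the model\<close>

lemma range_m': "range m \<subseteq> M" by (simp add: range_m)

lemma valid_ZFC:
  "p \<in> {Extensionality, Foundation, Pairing, Union_ax, Power_set, Infinity, Choice} \<Longrightarrow> sat M E m p"
  "sat M E m (Separation q)" "sat M E m (Replacement q)"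
  using ZFC range_m' unfolding models_ZFC_iff valid_def by blast+

lemma ext: "x \<in> M \<Longrightarrow> y \<in> M \<Longrightarrow> (\<And>z. z \<in> M \<Longrightarrow> z \<epsilon> x \<longleftrightarrow> z \<epsilon> y) \<Longrightarrow> x = y"
  using valid_ZFC(1)[of Extensionality] unfolding sat_Extensionality by blast

lemma foundation: "x \<in> M \<Longrightarrow> y \<in> M \<Longrightarrow> y \<epsilon> x \<Longrightarrow>
    \<exists>y\<in>M. y \<epsilon> x \<and> \<not> (\<exists>z\<in>M. z \<epsilon> x \<and> z \<epsilon> y)"
  using valid_ZFC(1)[of Foundation] unfolding sat_Foundation by blast

lemma pairing: "x \<in> M \<Longrightarrow> y \<in> M \<Longrightarrow> \<exists>z\<in>M. \<forall>w\<in>M. w \<epsilon> z \<longleftrightarrow> w = x \<or> w = y"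
  using valid_ZFC(1)[of Pairing] unfolding sat_Pairing by blast

lemma union: "x \<in> M \<Longrightarrow> \<exists>u\<in>M. \<forall>z\<in>M. z \<epsilon> u \<longleftrightarrow> (\<exists>y\<in>M. z \<epsilon> y \<and> y \<epsilon> x)"
  using valid_ZFC(1)[of Union_ax] unfolding sat_Union_ax by blast

lemma power: "x \<in> M \<Longrightarrow> \<exists>y\<in>M. \<forall>z\<in>M. z \<epsilon> y \<longleftrightarrow> (\<forall>w\<in>M. w \<epsilon> z \<longrightarrow> w \<epsilon> x)"
  using valid_ZFC(1)[of Power_set] unfolding sat_Power_set by blast

lemma infinity: "\<exists>x\<in>M. (\<exists>e\<in>M. e \<epsilon> x \<and> (\<forall>w\<in>M. \<not> w \<epsilon> e)) \<and>
    (\<forall>y\<in>M. y \<epsilon> x \<longrightarrow> (\<exists>s\<in>M. s \<epsilon> x \<and> (\<forall>w\<in>M. w \<epsilon> s \<longleftrightarrow> w \<epsilon> y \<or> w = y)))"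
  using valid_ZFC(1)[of Infinity] unfolding sat_Infinity by blast

lemma choice:
  assumes "F \<in> M" "\<And>x. x \<in> M \<Longrightarrow> x \<epsilon> F \<Longrightarrow> \<exists>y\<in>M. y \<epsilon> x"
    and "\<And>x y z. x \<in> M \<Longrightarrow> y \<in> M \<Longrightarrow> x \<epsilon> F \<Longrightarrow> y \<epsilon> F \<Longrightarrow> z \<in> M \<Longrightarrow> z \<epsilon> x \<Longrightarrow> z \<epsilon> y \<Longrightarrow> x = y"
  shows "\<exists>C\<in>M. \<forall>x\<in>M. x \<epsilon> F \<longrightarrow> (\<exists>z\<in>M. \<forall>w\<in>M. w \<epsilon> x \<and> w \<epsilon> C \<longleftrightarrow> w = z)"
  using valid_ZFC(1)[of Choice] assms unfolding sat_Choice by blast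

lemma separation:
  assumes "Dfp (\<lambda>e. P (e 0))" "a \<in> M"
  shows "\<exists>y\<in>M. \<forall>x\<in>M. x \<epsilon> y \<longleftrightarrow> x \<epsilon> a \<and> P x"
proof -
  obtain p where p: "\<And>e. range e \<subseteq> M \<Longrightarrow> P (e 0) \<longleftrightarrow> sat M E (mix e m) p"
    using assms(1) by (auto simp: Dfp_def)
  \<comment> \<open>Only argument 0 matters, so every even variable may be read as the element; the
    parameters start at index 2, behind the element and the given set.\<close>
  define f where "f n = (if even n then 0 else n div 2 + 2)" for n :: nat
  have "mix (\<lambda>_. x) m = (\<lambda>n. case_nat x (case_nat a m) (f n))" for x
    by (rule HOL.ext) (auto simp: mix_def f_def)
  then have "P x \<longleftrightarrow> sat M E (case_nat x (case_nat a m)) (rename f p)" if "x \<in> M" for x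
    using p[of "\<lambda>_. x"] that by (simp add: sat_rename image_subset_iff)
  then show ?thesis
    using valid_ZFC(2)[of "rename f p"] assms(2) unfolding sat_Separation by simp
qed

lemma Dfp2_instance:
  assumes "Dfp (\<lambda>e. P (e 0) (e 1))"
  obtains p where "\<And>x y. x \<in> M \<Longrightarrow> y \<in> M \<Longrightarrow> P x y \<longleftrightarrow> sat M E (case_nat y (case_nat x m)) p"
proof -
  obtain p where p: "\<And>e. range e \<subseteq> M \<Longrightarrow> P (e 0) (e 1) \<longleftrightarrow> sat M E (mix e m) p"
    using assms(1) by (auto simp: Dfp_def)
  define f where "f n = (if even n then (if n = 0 then 1 else 0) else n div 2 + 2)" for n :: nat
  have "mix (\<lambda>n. if n = 0 then x else y) m = (\<lambda>n. case_nat y (case_nat x m) (f n))" for x y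
    by (rule HOL.ext) (auto simp: mix_def f_def)
  then have "P x y \<longleftrightarrow> sat M E (case_nat y (case_nat x m)) (rename f p)" if "x \<in> M" "y \<in> M" for x y
    using p[of "\<lambda>n. if n = 0 then x else y"] that by (simp add: sat_rename image_subset_iff)
  then show ?thesis using that by blast
qed

lemma replacement:
  assumes df: "Dfp (\<lambda>e. F (e 0) (e 1))" and a: "a \<in> M"
    and fn: "\<And>x y z. x \<in> M \<Longrightarrow> y \<in> M \<Longrightarrow> z \<in> M \<Longrightarrow> x \<epsilon> a \<Longrightarrow> F x y \<Longrightarrow> F x z \<Longrightarrow> y = z"
  shows "\<exists>b\<in>M. \<forall>y\<in>M. y \<epsilon> b \<longleftrightarrow> (\<exists>x\<in>M. x \<epsilon> a \<and> F x y)"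
proof -
  \<comment> \<open>Relativizing to \<open>a\<close> makes the relation functional everywhere, as
    the scheme demands, although \<open>F\<close> is functional only on \<open>a\<close>.\<close>
  have "Dfp (\<lambda>e. e 0 \<epsilon> a \<and> F (e 0) (e 1))"
    by (intro dfp df a)
  then obtain p where p: "\<And>x y. x \<in> M \<Longrightarrow> y \<in> M \<Longrightarrow>
      x \<epsilon> a \<and> F x y \<longleftrightarrow> sat M E (case_nat y (case_nat x m)) p"
    by (rule Dfp2_instance[of "\<lambda>x y. x \<epsilon> a \<and> F x y"]) blast
  have "\<forall>x\<in>M. \<forall>y\<in>M. \<forall>z\<in>M. sat M E (case_nat y (case_nat x m)) p \<and>
      sat M E (case_nat z (case_nat x m)) p \<longrightarrow> y = z"
  proof (intro ballI impI)
    fix x y z assume "x \<in> M" "y \<in> M" "z \<in> M"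
      "sat M E (case_nat y (case_nat x m)) p \<and> sat M E (case_nat z (case_nat x m)) p"
    then show "y = z" using p[of x y] p[of x z] fn[of x y z] by simp
  qed
  then obtain b where b: "b \<in> M"
    "\<And>y. y \<in> M \<Longrightarrow> y \<epsilon> b \<longleftrightarrow> (\<exists>x\<in>M. x \<epsilon> a \<and> sat M E (case_nat y (case_nat x m)) p)"
    using valid_ZFC(3)[of p] a unfolding sat_Replacement by blast
  have "y \<epsilon> b \<longleftrightarrow> (\<exists>x\<in>M. x \<epsilon> a \<and> F x y)" if "y \<in> M" for y
    unfolding b(2)[OF that] using p[OF _ that] by blast
  then show ?thesis using b(1) by blast
qed

definition sub :: "'a \<Rightarrow> 'a \<Rightarrow> bool" where "sub x y \<longleftrightarrow> (\<forall>z\<in>M. z \<epsilon> x \<longrightarrow> z \<epsilon> y)"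

lemma Dfp_sub [dfp]: "trm s \<Longrightarrow> trm t \<Longrightarrow> Dfp (\<lambda>e. sub (s e) (t e))"
  by (rule Dfp2[of sub]) (unfold sub_def, intro dfp)

lemma sub_refl [simp]: "sub x x" by (simp add: sub_def)
lemma sub_trans: "sub x y \<Longrightarrow> sub y z \<Longrightarrow> sub x z" by (simp add: sub_def)

lemma mem_irrefl: "x \<in> M \<Longrightarrow> \<not> x \<epsilon> x"
proof
  assume x: "x \<in> M" "x \<epsilon> x"
  obtain s where "s \<in> M" "\<forall>w\<in>M. w \<epsilon> s \<longleftrightarrow> w = x" using pairing[OF x(1) x(1)] by auto
  then show False using foundation[of s x] x by auto
qed

lemma power_sub: "x \<in> M \<Longrightarrow> \<exists>y\<in>M. \<forall>z\<in>M. z \<epsilon> y \<longleftrightarrow> sub z x"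
  using power by (simp add: sub_def)

lemma Un_ex: "x \<in> M \<Longrightarrow> y \<in> M \<Longrightarrow> \<exists>u\<in>M. \<forall>z\<in>M. z \<epsilon> u \<longleftrightarrow> z \<epsilon> x \<or> z \<epsilon> y"
proof -
  assume x: "x \<in> M" and y: "y \<in> M"
  obtain p where p: "p \<in> M" "\<forall>w\<in>M. w \<epsilon> p \<longleftrightarrow> w = x \<or> w = y" using pairing x y by blast
  show ?thesis using union[OF p(1)] p(2) x y by (metis (no_types, lifting))
qed

lemma insert_ex: "x \<in> M \<Longrightarrow> y \<in> M \<Longrightarrow> \<exists>u\<in>M. \<forall>z\<in>M. z \<epsilon> u \<longleftrightarrow> z = x \<or> z \<epsilon> y"
proof -
  assume x: "x \<in> M" and y: "y \<in> M"
  obtain s where s: "s \<in> M" "\<forall>w\<in>M. w \<epsilon> s \<longleftrightarrow> w = x" using pairing[OF x x] by auto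
  show ?thesis using Un_ex[OF s(1) y] s(2) by auto
qed

lemma fresh_ex: "x \<in> M \<Longrightarrow> \<exists>z\<in>M. \<not> z \<epsilon> x"
  using mem_irrefl by blast

lemma empty_ex: "\<exists>z\<in>M. \<forall>x\<in>M. \<not> x \<epsilon> z"
  using infinity by blast

end

subsection \<open>Levels\<close>

context zfc_model
begin

lemma comprehension:
  assumes "Dfp (\<lambda>e. P (e 0))" "a \<in> M" "\<And>x. x \<in> M \<Longrightarrow> P x \<Longrightarrow> x \<epsilon> a"
  shows "\<exists>y\<in>M. \<forall>x\<in>M. x \<epsilon> y \<longleftrightarrow> P x"
  using separation[OF assms(1,2)] assms(3) by blast

text \<open>Think of \<open>h\<close> as a set of stages of the cumulative hierarchy: each stage in
  \<open>h\<close> is the union of the power sets of those stages in \<open>h\<close> that belong to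
  it. No ordinals are mentioned.\<close>

definition hist :: "'a \<Rightarrow> bool" where
  "hist h \<longleftrightarrow> (\<forall>v\<in>M. v \<epsilon> h \<longrightarrow> (\<forall>x\<in>M. x \<epsilon> v \<longleftrightarrow> (\<exists>c\<in>M. c \<epsilon> v \<and> c \<epsilon> h \<and> sub x c)))"

definition accum :: "'a \<Rightarrow> 'a \<Rightarrow> bool" where
  "accum l h \<longleftrightarrow> (\<forall>x\<in>M. x \<epsilon> l \<longleftrightarrow> (\<exists>c\<in>M. c \<epsilon> h \<and> sub x c))"

definition level :: "'a \<Rightarrow> bool" where
  "level l \<longleftrightarrow> (\<exists>h\<in>M. hist h \<and> accum l h)"

definition trans :: "'a \<Rightarrow> bool" where
  "trans t \<longleftrightarrow> (\<forall>x\<in>M. x \<epsilon> t \<longrightarrow> sub x t)"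

lemma transD: "trans t \<Longrightarrow> x \<in> M \<Longrightarrow> x \<epsilon> t \<Longrightarrow> sub x t"
  by (simp add: trans_def)

lemma subD: "sub x y \<Longrightarrow> z \<in> M \<Longrightarrow> z \<epsilon> x \<Longrightarrow> z \<epsilon> y"
  by (simp add: sub_def)

lemma sub_antisym: "x \<in> M \<Longrightarrow> y \<in> M \<Longrightarrow> sub x y \<Longrightarrow> sub y x \<Longrightarrow> x = y"
  by (rule ext) (auto simp: sub_def)

lemma Dfp_hist [dfp]: "trm t \<Longrightarrow> Dfp (\<lambda>e. hist (t e))"
  by (rule Dfp1[of hist]) (unfold hist_def, intro dfp)

lemma Dfp_accum [dfp]: "trm s \<Longrightarrow> trm t \<Longrightarrow> Dfp (\<lambda>e. accum (s e) (t e))"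
  by (rule Dfp2[of accum]) (unfold accum_def, intro dfp)

lemma Dfp_level [dfp]: "trm t \<Longrightarrow> Dfp (\<lambda>e. level (t e))"
  by (rule Dfp1[of level]) (unfold level_def, intro dfp)

lemma Dfp_trans [dfp]: "trm t \<Longrightarrow> Dfp (\<lambda>e. trans (t e))"
  by (rule Dfp1[of trans]) (unfold trans_def, intro dfp)

text \<open>By foundation take a counterexample \<open>b\<close> such that the members of
  \<open>h\<close> inside it are transitive. A member of \<open>b\<close> is a subset of such a
  transitive \<open>d\<close>, so its own members are subsets of \<open>d\<close> too, hence members
  of \<open>b\<close>.\<close>

lemma hist_member_trans:
  assumes h: "hist h" "h \<in> M" and c: "c \<in> M" "c \<epsilon> h"
  shows "trans c"
proof (rule ccontr)
  assume nt: "\<not> trans c"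
  have "Dfp (\<lambda>e. \<not> trans (e 0))" by (intro dfp)
  then obtain s where s: "s \<in> M" "\<And>x. x \<in> M \<Longrightarrow> x \<epsilon> s \<longleftrightarrow> x \<epsilon> h \<and> \<not> trans x"
    using separation[of "\<lambda>x. \<not> trans x" h] h(2) by blast
  then obtain b where b: "b \<in> M" "b \<epsilon> h" "\<not> trans b" "\<And>z. z \<in> M \<Longrightarrow> z \<epsilon> h \<Longrightarrow> z \<epsilon> b \<Longrightarrow> trans z"
    using foundation[of s c] c nt by blast
  have mem_b: "x \<epsilon> b \<longleftrightarrow> (\<exists>d\<in>M. d \<epsilon> b \<and> d \<epsilon> h \<and> sub x d)" if "x \<in> M" for x
    using h(1) b that unfolding hist_def by blast
  have "trans b"
    unfolding trans_def sub_def
  proof (intro ballI impI)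
    fix v z assume v: "v \<in> M" "v \<epsilon> b" and z: "z \<in> M" "z \<epsilon> v"
    obtain d where d: "d \<in> M" "d \<epsilon> b" "d \<epsilon> h" "sub v d" using mem_b v by blast
    then have "sub z d" using b(4)[of d] z transD[of d z] subD[of v d z] by blast
    then show "z \<epsilon> b" using mem_b z d by blast
  qed
  then show False using b by blast
qed

text \<open>The history witnessing this is the part of \<open>h\<close> inside \<open>c\<close>:
  since \<open>c\<close> is transitive, a member of \<open>c\<close> sees the same members of
  \<open>h\<close> before and after the cut.\<close>

lemma hist_member_level:
  assumes h: "hist h" "h \<in> M" and c: "c \<in> M" "c \<epsilon> h"
  shows "level c"
proof -
  have "Dfp (\<lambda>e. e 0 \<epsilon> h)" using h by (intro dfp)
  then obtain k where k: "k \<in> M" "\<And>x. x \<in> M \<Longrightarrow> x \<epsilon> k \<longleftrightarrow> x \<epsilon> c \<and> x \<epsilon> h"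
    using separation[of "\<lambda>x. x \<epsilon> h" c] c by blast
  have tc: "trans c" using hist_member_trans assms by blast
  have "hist k"
    unfolding hist_def
  proof (intro ballI impI)
    fix v x assume v: "v \<in> M" "v \<epsilon> k" and x: "x \<in> M"
    have "d \<epsilon> v \<and> d \<epsilon> h \<longleftrightarrow> d \<epsilon> v \<and> d \<epsilon> k" if "d \<in> M" for d
      using transD[OF tc v(1)] v k that subD[of v c d] by blast
    moreover have "x \<epsilon> v \<longleftrightarrow> (\<exists>d\<in>M. d \<epsilon> v \<and> d \<epsilon> h \<and> sub x d)"
      using h(1) v k x unfolding hist_def by blast
    ultimately show "x \<epsilon> v \<longleftrightarrow> (\<exists>d\<in>M. d \<epsilon> v \<and> d \<epsilon> k \<and> sub x d)" by blast
  qed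
  moreover have "accum c k"
    using h(1) c k unfolding accum_def hist_def by blast
  ultimately show ?thesis using k by (auto simp: level_def)
qed

lemma level_down: "level l \<Longrightarrow> l \<in> M \<Longrightarrow> x \<in> M \<Longrightarrow> y \<in> M \<Longrightarrow> x \<epsilon> l \<Longrightarrow> sub y x \<Longrightarrow> y \<epsilon> l"
  unfolding level_def accum_def using sub_trans by blast

lemma level_trans:
  assumes l: "level l" "l \<in> M" shows "trans l"
proof -
  obtain h where h: "h \<in> M" "hist h" and lh: "\<And>x. x \<in> M \<Longrightarrow> x \<epsilon> l \<longleftrightarrow> (\<exists>c\<in>M. c \<epsilon> h \<and> sub x c)"
    using l by (auto simp: level_def accum_def)
  show ?thesis
    unfolding trans_def sub_def
  proof (intro ballI impI)
    fix x z assume x: "x \<in> M" "x \<epsilon> l" and z: "z \<in> M" "z \<epsilon> x"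
    obtain c where c: "c \<in> M" "c \<epsilon> h" "sub x c" using lh x by blast
    then have "sub z c" using transD[OF hist_member_trans[OF h(2,1) c(1,2)]] z subD[of x c z] by blast
    then show "z \<epsilon> l" using lh z c by blast
  qed
qed

lemma level_mem_iff:
  assumes l: "level l" "l \<in> M" and x: "x \<in> M"
  shows "x \<epsilon> l \<longleftrightarrow> (\<exists>k\<in>M. k \<epsilon> l \<and> level k \<and> sub x k)"
proof
  assume "x \<epsilon> l"
  obtain h where h: "h \<in> M" "hist h" and lh: "\<And>x. x \<in> M \<Longrightarrow> x \<epsilon> l \<longleftrightarrow> (\<exists>c\<in>M. c \<epsilon> h \<and> sub x c)"
    using l by (auto simp: level_def accum_def)
  obtain c where c: "c \<in> M" "c \<epsilon> h" "sub x c" using lh x \<open>x \<epsilon> l\<close> by blast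
  then have "c \<epsilon> l" using lh sub_refl by blast
  then show "\<exists>k\<in>M. k \<epsilon> l \<and> level k \<and> sub x k"
    using hist_member_level[OF h(2,1) c(1,2)] c by blast
qed (use level_down[OF l] x in blast)

text \<open>Foundation gives a minimal element among the levels in \<open>l\<close> with the
  property; as \<open>l\<close> is transitive, nothing below that element escapes the
  comparison.\<close>

lemma level_min:
  assumes df: "Dfp (\<lambda>e. P (e 0))" and l: "level l" "l \<in> M" "P l"
  shows "\<exists>k\<in>M. level k \<and> P k \<and> (\<forall>j\<in>M. j \<epsilon> k \<longrightarrow> level j \<longrightarrow> \<not> P j)"
proof (cases "\<exists>j\<in>M. j \<epsilon> l \<and> level j \<and> P j")
  case True
  have "Dfp (\<lambda>e. level (e 0) \<and> P (e 0))" by (intro dfp df)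
  then obtain s where s: "s \<in> M" "\<And>x. x \<in> M \<Longrightarrow> x \<epsilon> s \<longleftrightarrow> x \<epsilon> l \<and> level x \<and> P x"
    using separation[of "\<lambda>x. level x \<and> P x" l] l by blast
  then obtain k where k: "k \<in> M" "k \<epsilon> s" "\<not> (\<exists>z\<in>M. z \<epsilon> s \<and> z \<epsilon> k)"
    using foundation[of s] True by blast
  have "j \<epsilon> l" if "j \<in> M" "j \<epsilon> k" for j
    using transD[OF level_trans[OF l(1,2)] k(1)] k s that subD[of k l j] by blast
  then show ?thesis using k s by blast
next
  case False
  then show ?thesis using l by blast
qed

text \<open>Of two nested minimal counterexamples, \<open>a\<close> is minimal among the levels
  incomparable with some level, and \<open>b\<close> among those incomparable with \<open>a\<close>.
  The same levels belong to both, so they coincide by \<open>level_mem_iff\<close>.\<close>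

lemma level_comparable:
  assumes "level s" "s \<in> M" "level t" "t \<in> M"
  shows "s \<epsilon> t \<or> s = t \<or> t \<epsilon> s"
proof (rule ccontr)
  assume nc: "\<not> (s \<epsilon> t \<or> s = t \<or> t \<epsilon> s)"
  define P where "P s \<longleftrightarrow> (\<exists>t\<in>M. level t \<and> \<not> (s \<epsilon> t \<or> s = t \<or> t \<epsilon> s))" for s
  have "Dfp (\<lambda>e. P (e 0))" unfolding P_def by (intro dfp)
  then obtain a where a: "a \<in> M" "level a" "P a" "\<And>j. j \<in> M \<Longrightarrow> j \<epsilon> a \<Longrightarrow> level j \<Longrightarrow> \<not> P j"
    using level_min[of P s] assms nc P_def by blast
  define Q where "Q t \<longleftrightarrow> \<not> (a \<epsilon> t \<or> a = t \<or> t \<epsilon> a)" for t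
  have "Dfp (\<lambda>e. Q (e 0))" unfolding Q_def using a by (intro dfp)
  moreover obtain t' where "level t'" "t' \<in> M" "Q t'" using a(3) unfolding P_def Q_def by blast
  ultimately obtain b where b: "b \<in> M" "level b" "Q b" "\<And>j. j \<in> M \<Longrightarrow> j \<epsilon> b \<Longrightarrow> level j \<Longrightarrow> \<not> Q j"
    using level_min[of Q] by blast
  have sub: "r \<epsilon> b \<longleftrightarrow> r \<epsilon> a" if r: "r \<in> M" "level r" for r
  proof
    assume "r \<epsilon> a"
    then have "r \<epsilon> b \<or> r = b \<or> b \<epsilon> r" using a(4) r b unfolding P_def by blast
    then show "r \<epsilon> b"
      using b(3) \<open>r \<epsilon> a\<close> level_trans[OF a(2,1)] r(1) b(1) by (auto simp: Q_def trans_def sub_def)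
  next
    assume "r \<epsilon> b"
    then have "a \<epsilon> r \<or> a = r \<or> r \<epsilon> a" using b(4) r unfolding Q_def by blast
    then show "r \<epsilon> a"
      using b(3) \<open>r \<epsilon> b\<close> level_trans[OF b(2,1)] r(1) a(1) by (auto simp: Q_def trans_def sub_def)
  qed
  have "x \<epsilon> a \<longleftrightarrow> x \<epsilon> b" if "x \<in> M" for x
    using level_mem_iff[OF a(2,1) that] level_mem_iff[OF b(2,1) that] sub by blast
  then have "a = b" using ext a(1) b(1) by blast
  then show False using b(3) by (simp add: Q_def)
qed

lemma level_least:
  assumes df: "Dfp (\<lambda>e. P (e 0))" and l: "level l" "l \<in> M" "P l"
  shows "\<exists>k\<in>M. level k \<and> P k \<and> (\<forall>j\<in>M. level j \<and> P j \<longrightarrow> sub k j)"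
proof -
  obtain k where k: "k \<in> M" "level k" "P k" "\<And>j. j \<in> M \<Longrightarrow> j \<epsilon> k \<Longrightarrow> level j \<Longrightarrow> \<not> P j"
    using level_min[OF assms] by blast
  have "sub k j" if "j \<in> M" "level j" "P j" for j
    using level_comparable[OF k(2,1) that(2,1)] k(4)[of j] that level_trans[of j] k(1)
    by (auto simp: trans_def)
  then show ?thesis using k by blast
qed

definition wfd :: "'a \<Rightarrow> bool" where "wfd x \<longleftrightarrow> (\<exists>l\<in>M. level l \<and> sub x l)"

lemma Dfp_wfd [dfp]: "trm t \<Longrightarrow> Dfp (\<lambda>e. wfd (t e))"
  by (rule Dfp1[of wfd]) (unfold wfd_def, intro dfp)

text \<open>Scott's trick: the least suitable level is unique, so replacement applies to it.\<close>

lemma least_levels: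
  assumes df: "Dfp (\<lambda>e. P (e 0) (e 1))" and a: "a \<in> M"
    and ex: "\<And>x. x \<in> M \<Longrightarrow> x \<epsilon> a \<Longrightarrow> \<exists>l\<in>M. level l \<and> P x l"
  shows "\<exists>H\<in>M. (\<forall>l\<in>M. l \<epsilon> H \<longrightarrow> level l) \<and> (\<forall>x\<in>M. x \<epsilon> a \<longrightarrow> (\<exists>l\<in>M. l \<epsilon> H \<and> P x l))"
proof -
  define F where "F x l \<longleftrightarrow> level l \<and> P x l \<and> (\<forall>j\<in>M. level j \<and> P x j \<longrightarrow> sub l j)" for x l
  have P: "Dfp (\<lambda>e. P (s e) (t e))" if "trm s" "trm t" for s t by (rule Dfp2[OF df that])
  have "Dfp (\<lambda>e. F (e 0) (e 1))" unfolding F_def by (intro dfp P)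
  moreover have "l = k" if "l \<in> M" "k \<in> M" "F x l" "F x k" for x l k
    using that sub_antisym[of l k] unfolding F_def by blast
  ultimately obtain H where H: "H \<in> M" "\<And>l. l \<in> M \<Longrightarrow> l \<epsilon> H \<longleftrightarrow> (\<exists>x\<in>M. x \<epsilon> a \<and> F x l)"
    using replacement[of F a] a by blast
  have "\<exists>l\<in>M. F x l" if x: "x \<in> M" "x \<epsilon> a" for x
  proof -
    obtain l where l: "l \<in> M" "level l" "P x l" using ex x by blast
    have "Dfp (\<lambda>e. P x (e 0))" using x by (intro P dfp)
    then show ?thesis using level_least[of "P x" l] l unfolding F_def by blast
  qed
  note ex = this
  have "level l" if "l \<in> M" "l \<epsilon> H" for l
    using that H(2) unfolding F_def by blast
  moreover have "\<exists>l\<in>M. l \<epsilon> H \<and> P x l" if x: "x \<in> M" "x \<epsilon> a" for x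
  proof -
    obtain l where "l \<in> M" "F x l" using ex x by blast
    then show ?thesis using H(2) x unfolding F_def by blast
  qed
  ultimately show ?thesis using H(1) by blast
qed

lemma wfd_mem:
  assumes "wfd x" "x \<in> M" "y \<in> M" "y \<epsilon> x"
  shows "wfd y"
proof -
  obtain l where l: "l \<in> M" "level l" "sub x l" using assms by (auto simp: wfd_def)
  then have "sub y l" using transD[OF level_trans[OF l(2,1)]] assms subD[of x l y] by blast
  then show ?thesis using l by (auto simp: wfd_def)
qed

lemma wfd_sub: "wfd x \<Longrightarrow> sub y x \<Longrightarrow> wfd y"
  unfolding wfd_def using sub_trans by blast

text \<open>The levels \<open>H\<close> covering the members of \<open>x\<close> need not form a
  history, but they do after all levels belonging to them are added. The result \<open>K\<close>
  accumulates to a level that includes \<open>x\<close>.\<close>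

lemma wfdI:
  assumes x: "x \<in> M" and elems: "\<And>y. y \<in> M \<Longrightarrow> y \<epsilon> x \<Longrightarrow> wfd y"
  shows "wfd x"
proof -
  have "Dfp (\<lambda>e. sub (e 0) (e 1))" by (intro dfp)
  then obtain H where H: "H \<in> M" "\<And>l. l \<in> M \<Longrightarrow> l \<epsilon> H \<Longrightarrow> level l"
    "\<And>y. y \<in> M \<Longrightarrow> y \<epsilon> x \<Longrightarrow> \<exists>l\<in>M. l \<epsilon> H \<and> sub y l"
    using least_levels[of sub x] x elems unfolding wfd_def by blast
  obtain U where U: "U \<in> M" "\<And>z. z \<in> M \<Longrightarrow> z \<epsilon> U \<longleftrightarrow> (\<exists>l\<in>M. z \<epsilon> l \<and> l \<epsilon> H)"
    using union[OF H(1)] by blast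
  have "Dfp (\<lambda>e. level (e 0))" by (intro dfp)
  then obtain L where L: "L \<in> M" "\<And>z. z \<in> M \<Longrightarrow> z \<epsilon> L \<longleftrightarrow> z \<epsilon> U \<and> level z"
    using separation[of level U] U(1) by blast
  obtain K where K: "K \<in> M" "\<And>z. z \<in> M \<Longrightarrow> z \<epsilon> K \<longleftrightarrow> z \<epsilon> H \<or> z \<epsilon> L"
    using Un_ex[OF H(1) L(1)] by blast
  obtain V where V: "V \<in> M" "\<And>z. z \<in> M \<Longrightarrow> z \<epsilon> V \<longleftrightarrow> (\<exists>k\<in>M. z \<epsilon> k \<and> k \<epsilon> K)"
    using union[OF K(1)] by blast
  obtain P where P: "P \<in> M" "\<And>z. z \<in> M \<Longrightarrow> z \<epsilon> P \<longleftrightarrow> sub z V"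
    using power_sub[OF V(1)] by blast
  have "Dfp (\<lambda>e. \<exists>c\<in>M. c \<epsilon> K \<and> sub (e 0) c)" using K(1) by (intro dfp)
  moreover have "z \<epsilon> P" if "z \<in> M" "\<exists>c\<in>M. c \<epsilon> K \<and> sub z c" for z
    using that P(2) V(2) by (auto simp: sub_def)
  ultimately obtain l where l: "l \<in> M" "\<And>z. z \<in> M \<Longrightarrow> z \<epsilon> l \<longleftrightarrow> (\<exists>c\<in>M. c \<epsilon> K \<and> sub z c)"
    using comprehension[of "\<lambda>z. \<exists>c\<in>M. c \<epsilon> K \<and> sub z c" P] P(1) by blast
  have lev: "level v" if "v \<in> M" "v \<epsilon> K" for v using that K H L by blast
  have down: "k \<epsilon> K" if k: "k \<in> M" "level k" "k \<epsilon> v" and v: "v \<in> M" "v \<epsilon> K" for k v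
  proof -
    have "k \<epsilon> U"
    proof (cases "v \<epsilon> H")
      case True
      then show ?thesis using U k v by blast
    next
      case False
      then obtain w where w: "w \<in> M" "v \<epsilon> w" "w \<epsilon> H" using v K(2) L(2) U(2) by blast
      then have "k \<epsilon> w"
        using transD[OF level_trans[OF H(2)[OF w(1,3)] w(1)] v(1)] k v subD[of v w k] by blast
      then show ?thesis using U(2) k w by blast
    qed
    then show ?thesis using K(2) L(2) k by blast
  qed
  have "hist K"
    unfolding hist_def
  proof (intro ballI impI)
    fix v z assume v: "v \<in> M" "v \<epsilon> K" and z: "z \<in> M"
    show "z \<epsilon> v \<longleftrightarrow> (\<exists>c\<in>M. c \<epsilon> v \<and> c \<epsilon> K \<and> sub z c)"
      using level_mem_iff[OF lev[OF v] v(1) z] down[OF _ _ _ v] lev by blast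
  qed
  then have "level l" using l K(1) by (auto simp: level_def accum_def)
  moreover have "sub x l"
    unfolding sub_def
  proof (intro ballI impI)
    fix y assume y: "y \<in> M" "y \<epsilon> x"
    then show "y \<epsilon> l" using H(3)[OF y] l(2)[OF y(1)] K(2) by blast
  qed
  ultimately show ?thesis using l(1) by (auto simp: wfd_def)
qed

text \<open>For each \<open>x\<close> some witness is a subset of a level in \<open>H\<close>. All
  of these are subsets of the union of \<open>H\<close>, so the well-founded part of its power set
  contains them.\<close>

lemma wfd_collection:
  assumes df: "Dfp (\<lambda>e. R (e 0) (e 1))" and a: "a \<in> M"
    and ex: "\<And>x. x \<in> M \<Longrightarrow> x \<epsilon> a \<Longrightarrow> \<exists>y\<in>M. wfd y \<and> R x y"
  shows "\<exists>b\<in>M. wfd b \<and> (\<forall>x\<in>M. x \<epsilon> a \<longrightarrow> (\<exists>y\<in>M. y \<epsilon> b \<and> R x y))"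
proof -
  have R: "Dfp (\<lambda>e. R (s e) (t e))" if "trm s" "trm t" for s t by (rule Dfp2[OF df that])
  define P where "P x l \<longleftrightarrow> (\<exists>y\<in>M. wfd y \<and> sub y l \<and> R x y)" for x l
  have "Dfp (\<lambda>e. P (e 0) (e 1))" unfolding P_def by (intro dfp R)
  moreover have "\<exists>l\<in>M. level l \<and> P x l" if "x \<in> M" "x \<epsilon> a" for x
    using ex[OF that] unfolding P_def wfd_def by blast
  ultimately obtain H where H: "H \<in> M" "\<And>x. x \<in> M \<Longrightarrow> x \<epsilon> a \<Longrightarrow> \<exists>l\<in>M. l \<epsilon> H \<and> P x l"
    using least_levels[of P a] a by blast
  obtain U where U: "U \<in> M" "\<And>z. z \<in> M \<Longrightarrow> z \<epsilon> U \<longleftrightarrow> (\<exists>l\<in>M. z \<epsilon> l \<and> l \<epsilon> H)"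
    using union[OF H(1)] by blast
  obtain Q where Q: "Q \<in> M" "\<And>z. z \<in> M \<Longrightarrow> z \<epsilon> Q \<longleftrightarrow> sub z U"
    using power_sub[OF U(1)] by blast
  have "Dfp (\<lambda>e. wfd (e 0))" by (intro dfp)
  then obtain b where b: "b \<in> M" "\<And>z. z \<in> M \<Longrightarrow> z \<epsilon> b \<longleftrightarrow> z \<epsilon> Q \<and> wfd z"
    using separation[of wfd Q] Q(1) by blast
  have "\<exists>y\<in>M. y \<epsilon> b \<and> R x y" if x: "x \<in> M" "x \<epsilon> a" for x
  proof -
    obtain l y where l: "l \<in> M" "l \<epsilon> H" and y: "y \<in> M" "wfd y" "sub y l" "R x y"
      using H(2)[OF x] unfolding P_def by blast
    have "sub y U" using l y U(2) by (auto simp: sub_def)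
    then show ?thesis using y b(2) Q(2) by blast
  qed
  moreover have "wfd b" using wfdI b by blast
  ultimately show ?thesis using b(1) by blast
qed

subsection \<open>The class of all members of levels is a model\<close>

definition W :: "'a set" where "W = {x \<in> M. wfd x}"

lemma W_M: "x \<in> W \<Longrightarrow> x \<in> M" by (simp add: W_def)

lemma W_mem: "x \<in> W \<Longrightarrow> y \<in> M \<Longrightarrow> y \<epsilon> x \<Longrightarrow> y \<in> W"
  using wfd_mem by (auto simp: W_def)

lemma W_comprehension:
  assumes "Dfp (\<lambda>e. P (e 0))" "a \<in> M" "\<And>x. x \<in> M \<Longrightarrow> P x \<Longrightarrow> x \<in> W \<and> x \<epsilon> a"
  shows "\<exists>y\<in>W. \<forall>x\<in>M. x \<epsilon> y \<longleftrightarrow> P x"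
proof -
  obtain y where y: "y \<in> M" "\<And>x. x \<in> M \<Longrightarrow> x \<epsilon> y \<longleftrightarrow> P x"
    using comprehension[OF assms(1,2)] assms(3) by blast
  then have "y \<in> W" using assms(3) wfdI[of y] by (auto simp: W_def)
  then show ?thesis using y by blast
qed

lemma Dfp_W [dfp]: "trm t \<Longrightarrow> Dfp (\<lambda>e. t e \<in> W)"
proof -
  assume t: "trm t"
  then have "Dfp (\<lambda>e. wfd (t e))" by (intro dfp)
  then show ?thesis unfolding Dfp_def W_def using trm_in[OF t] by auto
qed

text \<open>Relativization of \<open>p\<close> to \<open>W\<close>. It allows the schemes of
  \<open>M\<close> to be applied to truth in \<open>W\<close>.\<close>

lemma Dfp_sat_W: "(\<And>n. trm (s n)) \<Longrightarrow> Dfp (\<lambda>e. sat W E (\<lambda>n. s n e) p)"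
proof (induction p arbitrary: s)
  case (Forall p)
  define s' where "s' = case_nat (\<lambda>e. e 0) (\<lambda>n e. s n (\<lambda>k. e (Suc k)))"
  have "trm (s' n)" for n
    using Forall.prems by (cases n) (auto simp: s'_def intro: trm_shift dfp)
  then have "Dfp (\<lambda>e. sat W E (\<lambda>n. s' n e) p)" by (rule Forall.IH)
  moreover have "(\<lambda>n. s' n e) = case_nat (e 0) (\<lambda>n. s n (\<lambda>k. e (Suc k)))" for e
    by (rule HOL.ext) (simp add: s'_def split: nat.split)
  ultimately have "Dfp (\<lambda>e. \<forall>x\<in>M. x \<in> W \<longrightarrow> sat W E (case_nat x (\<lambda>n. s n e)) p)"
    by (intro dfp) simp
  moreover have "(\<forall>x\<in>M. x \<in> W \<longrightarrow> sat W E (case_nat x v) p) \<longleftrightarrow> (\<forall>x\<in>W. sat W E (case_nat x v) p)" for v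
    using W_M by blast
  ultimately show ?case by simp
qed (auto intro: dfp)

lemma Dfp_sat_W2:
  assumes "range v \<subseteq> W" "trm s" "trm t"
  shows "Dfp (\<lambda>e. sat W E (case_nat (s e) (case_nat (t e) v)) p)"
proof -
  have v: "trm (\<lambda>e. v n)" for n using assms(1) W_M by (intro dfp) blast
  have "(\<lambda>n. (case n of 0 \<Rightarrow> s | Suc n \<Rightarrow> (case n of 0 \<Rightarrow> t | Suc k \<Rightarrow> (\<lambda>e. v k))) e)
      = case_nat (s e) (case_nat (t e) v)" for e
    by (rule HOL.ext) (simp split: nat.split)
  then show ?thesis
    using Dfp_sat_W[of "\<lambda>n. case n of 0 \<Rightarrow> s | Suc n \<Rightarrow> (case n of 0 \<Rightarrow> t | Suc k \<Rightarrow> (\<lambda>e. v k))" p]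
      assms(2,3) v by (simp split: nat.split)
qed

lemma W_nonempty: "\<exists>z\<in>W. \<forall>x\<in>M. \<not> x \<epsilon> z"
  using empty_ex wfdI unfolding W_def by blast

text \<open>\<open>W\<close> is closed under members and under subsets, and by \<open>wfdI\<close>
  it contains each set of its elements. So every axiom is witnessed by the set that \<open>M\<close>
  provides, or by the part of that set in \<open>W\<close>.\<close>

lemma W_models: "models W E ZFC"
proof -
  have "valid W E Extensionality"
    unfolding valid_def sat_Extensionality using ext W_M W_mem by blast
  moreover have "valid W E Foundation"
    unfolding valid_def sat_Foundation
  proof (intro allI impI ballI)
    fix x assume x: "x \<in> W" "\<exists>y\<in>W. y \<epsilon> x"
    then obtain y where y: "y \<in> M" "y \<epsilon> x" "\<not> (\<exists>z\<in>M. z \<epsilon> x \<and> z \<epsilon> y)"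
      using foundation[of x] W_M by blast
    then show "\<exists>y\<in>W. y \<epsilon> x \<and> \<not> (\<exists>z\<in>W. z \<epsilon> x \<and> z \<epsilon> y)"
      using W_mem[OF x(1) y(1,2)] W_M by blast
  qed
  moreover have "valid W E Pairing"
    unfolding valid_def sat_Pairing
  proof (intro allI impI ballI)
    fix x y assume x: "x \<in> W" and y: "y \<in> W"
    obtain z where z: "z \<in> M" "\<And>w. w \<in> M \<Longrightarrow> w \<epsilon> z \<longleftrightarrow> w = x \<or> w = y"
      using pairing[OF W_M[OF x] W_M[OF y]] by blast
    then have "z \<in> W" using wfdI[of z] x y by (auto simp: W_def)
    then show "\<exists>z\<in>W. \<forall>w\<in>W. w \<epsilon> z \<longleftrightarrow> w = x \<or> w = y" using z W_M by blast
  qed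
  moreover have "valid W E Union_ax"
    unfolding valid_def sat_Union_ax
  proof (intro allI impI ballI)
    fix x assume x: "x \<in> W"
    obtain u where u: "u \<in> M" "\<And>z. z \<in> M \<Longrightarrow> z \<epsilon> u \<longleftrightarrow> (\<exists>y\<in>M. z \<epsilon> y \<and> y \<epsilon> x)"
      using union[OF W_M[OF x]] by blast
    have "z \<in> W" if "z \<in> M" "z \<epsilon> u" for z using u(2) that x W_mem by blast
    then have "u \<in> W" using wfdI[of u] u(1) by (auto simp: W_def)
    then show "\<exists>u\<in>W. \<forall>z\<in>W. z \<epsilon> u \<longleftrightarrow> (\<exists>y\<in>W. z \<epsilon> y \<and> y \<epsilon> x)"
      using u(2) W_M W_mem x by (intro bexI[of _ u]) blast+
  qed
  moreover have "valid W E Power_set"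
    unfolding valid_def sat_Power_set
  proof (intro allI impI ballI)
    fix x assume x: "x \<in> W"
    obtain p where p: "p \<in> M" "\<And>z. z \<in> M \<Longrightarrow> z \<epsilon> p \<longleftrightarrow> sub z x"
      using power_sub[OF W_M[OF x]] by blast
    have "p \<in> W" using wfdI[of p] p wfd_sub x by (auto simp: W_def)
    moreover have "z \<epsilon> p \<longleftrightarrow> (\<forall>w\<in>W. w \<epsilon> z \<longrightarrow> w \<epsilon> x)" if "z \<in> W" for z
      using p(2) that W_M W_mem unfolding sub_def by blast
    ultimately show "\<exists>y\<in>W. \<forall>z\<in>W. z \<epsilon> y \<longleftrightarrow> (\<forall>w\<in>W. w \<epsilon> z \<longrightarrow> w \<epsilon> x)" by blast
  qed
  moreover have "valid W E Infinity"
    unfolding valid_def sat_Infinity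
  proof (intro allI impI)
    obtain x where x: "x \<in> M" "\<exists>e\<in>M. e \<epsilon> x \<and> (\<forall>w\<in>M. \<not> w \<epsilon> e)"
      "\<forall>y\<in>M. y \<epsilon> x \<longrightarrow> (\<exists>s\<in>M. s \<epsilon> x \<and> (\<forall>w\<in>M. w \<epsilon> s \<longleftrightarrow> w \<epsilon> y \<or> w = y))"
      using infinity by blast
    have "Dfp (\<lambda>e. e 0 \<epsilon> x \<and> e 0 \<in> W)" using x(1) by (intro dfp)
    then obtain y where y: "y \<in> W" "\<And>z. z \<in> M \<Longrightarrow> z \<epsilon> y \<longleftrightarrow> z \<epsilon> x \<and> z \<in> W"
      using W_comprehension[of "\<lambda>z. z \<epsilon> x \<and> z \<in> W" x] x(1) by blast
    obtain e where e: "e \<in> M" "e \<epsilon> x" "\<forall>w\<in>M. \<not> w \<epsilon> e" using x(2) by blast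
    then have "e \<in> W" using wfdI by (auto simp: W_def)
    moreover have "\<exists>s\<in>W. s \<epsilon> y \<and> (\<forall>w\<in>W. w \<epsilon> s \<longleftrightarrow> w \<epsilon> z \<or> w = z)" if z: "z \<in> W" "z \<epsilon> y" for z
    proof -
      obtain s where s: "s \<in> M" "s \<epsilon> x" "\<And>w. w \<in> M \<Longrightarrow> w \<epsilon> s \<longleftrightarrow> w \<epsilon> z \<or> w = z"
        using x(3)[rule_format, of z] z y(2)[of z] W_M[OF z(1)] by blast
      have "v \<in> W" if "v \<in> M" "v \<epsilon> s" for v using s(3) that z(1) W_mem by blast
      then have "s \<in> W" using wfdI[of s] s(1) by (auto simp: W_def)
      then show ?thesis using s y(2) W_M by blast
    qed
    ultimately show "\<exists>x\<in>W. (\<exists>e\<in>W. e \<epsilon> x \<and> (\<forall>w\<in>W. \<not> w \<epsilon> e)) \<and>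
        (\<forall>y\<in>W. y \<epsilon> x \<longrightarrow> (\<exists>s\<in>W. s \<epsilon> x \<and> (\<forall>w\<in>W. w \<epsilon> s \<longleftrightarrow> w \<epsilon> y \<or> w = y)))"
      using y e W_M by (intro bexI[of _ y]) blast+
  qed
  moreover have "valid W E Choice"
    unfolding valid_def sat_Choice
  proof (intro allI impI ballI, elim conjE)
    fix F assume F: "F \<in> W" and ne: "\<forall>x\<in>W. x \<epsilon> F \<longrightarrow> (\<exists>y\<in>W. y \<epsilon> x)"
      and disj: "\<forall>x\<in>W. \<forall>y\<in>W. x \<epsilon> F \<and> y \<epsilon> F \<and> x \<noteq> y \<longrightarrow> \<not> (\<exists>z\<in>W. z \<epsilon> x \<and> z \<epsilon> y)"
    have "\<exists>C\<in>M. \<forall>x\<in>M. x \<epsilon> F \<longrightarrow> (\<exists>z\<in>M. \<forall>w\<in>M. w \<epsilon> x \<and> w \<epsilon> C \<longleftrightarrow> w = z)"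
    proof (rule choice[OF W_M[OF F]])
      show "\<exists>y\<in>M. y \<epsilon> x" if "x \<in> M" "x \<epsilon> F" for x using ne that W_mem[OF F] W_M by blast
      show "x = y" if "x \<in> M" "y \<in> M" "x \<epsilon> F" "y \<epsilon> F" "z \<in> M" "z \<epsilon> x" "z \<epsilon> y" for x y z
        using disj that W_mem[OF F] W_mem by blast
    qed
    then obtain C where C: "C \<in> M"
      "\<And>x. x \<in> M \<Longrightarrow> x \<epsilon> F \<Longrightarrow> \<exists>z\<in>M. \<forall>w\<in>M. w \<epsilon> x \<and> w \<epsilon> C \<longleftrightarrow> w = z" by blast
    have "Dfp (\<lambda>e. e 0 \<epsilon> C \<and> e 0 \<in> W)" using C(1) by (intro dfp)
    then obtain D where D: "D \<in> W" "\<And>z. z \<in> M \<Longrightarrow> z \<epsilon> D \<longleftrightarrow> z \<epsilon> C \<and> z \<in> W"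
      using W_comprehension[of "\<lambda>z. z \<epsilon> C \<and> z \<in> W" C] C(1) by blast
    have "\<exists>z\<in>W. \<forall>w\<in>W. w \<epsilon> x \<and> w \<epsilon> D \<longleftrightarrow> w = z" if x: "x \<in> W" "x \<epsilon> F" for x
    proof -
      obtain z where z: "z \<in> M" "\<And>w. w \<in> M \<Longrightarrow> w \<epsilon> x \<and> w \<epsilon> C \<longleftrightarrow> w = z"
        using C(2)[OF W_M[OF x(1)] x(2)] by blast
      then have "z \<in> W" using W_mem x(1) by blast
      then show ?thesis using z D(2) W_M by blast
    qed
    then show "\<exists>C\<in>W. \<forall>x\<in>W. x \<epsilon> F \<longrightarrow> (\<exists>z\<in>W. \<forall>w\<in>W. w \<epsilon> x \<and> w \<epsilon> C \<longleftrightarrow> w = z)"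
      using D(1) by blast
  qed
  moreover have "valid W E (Separation p)" for p
    unfolding valid_def sat_Separation
  proof (intro allI impI ballI)
    fix v :: "nat \<Rightarrow> 'a" and a assume v: "range v \<subseteq> W" and a: "a \<in> W"
    have "Dfp (\<lambda>e. (e 0 \<in> W \<and> e 0 \<epsilon> a) \<and> sat W E (case_nat (e 0) (case_nat a v)) p)"
      using W_M[OF a] v by (intro dfp Dfp_sat_W2)
    then have "\<exists>y\<in>W. \<forall>x\<in>M. x \<epsilon> y \<longleftrightarrow> (x \<in> W \<and> x \<epsilon> a) \<and> sat W E (case_nat x (case_nat a v)) p"
      using W_comprehension[of "\<lambda>x. (x \<in> W \<and> x \<epsilon> a) \<and> sat W E (case_nat x (case_nat a v)) p" a] W_M[OF a]
      by blast
    then show "\<exists>y\<in>W. \<forall>x\<in>W. x \<epsilon> y \<longleftrightarrow> x \<epsilon> a \<and> sat W E (case_nat x (case_nat a v)) p"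
      using W_M by blast
  qed
  moreover have "valid W E (Replacement p)" for p
    unfolding valid_def sat_Replacement
  proof (intro allI impI ballI)
    fix v :: "nat \<Rightarrow> 'a" and a assume v: "range v \<subseteq> W" and a: "a \<in> W"
    assume fn: "\<forall>x\<in>W. \<forall>y\<in>W. \<forall>z\<in>W. sat W E (case_nat y (case_nat x v)) p \<and>
        sat W E (case_nat z (case_nat x v)) p \<longrightarrow> y = z"
    define R where "R x y \<longleftrightarrow> x \<in> W \<and> y \<in> W \<and> sat W E (case_nat y (case_nat x v)) p" for x y
    have "Dfp (\<lambda>e. R (e 0) (e 1))" unfolding R_def using v by (intro dfp Dfp_sat_W2)
    then obtain b where b: "b \<in> M" "\<And>y. y \<in> M \<Longrightarrow> y \<epsilon> b \<longleftrightarrow> (\<exists>x\<in>M. x \<epsilon> a \<and> R x y)"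
      using replacement[of R a] W_M[OF a] fn unfolding R_def by blast
    have "b \<in> W" using b wfdI[of b] by (auto simp: R_def W_def)
    moreover have "y \<epsilon> b \<longleftrightarrow> (\<exists>x\<in>W. x \<epsilon> a \<and> sat W E (case_nat y (case_nat x v)) p)" if "y \<in> W" for y
      using b(2) that W_M unfolding R_def by blast
    ultimately show "\<exists>b\<in>W. \<forall>y\<in>W. y \<epsilon> b \<longleftrightarrow> (\<exists>x\<in>W. x \<epsilon> a \<and> sat W E (case_nat y (case_nat x v)) p)"
      by blast
  qed
  ultimately show ?thesis using W_nonempty unfolding models_ZFC_iff by auto
qed

lemma W_collects: "collects W E"
  unfolding collects_def
proof (intro allI impI ballI)
  fix v :: "nat \<Rightarrow> 'a" and a p assume v: "range v \<subseteq> W" and a: "a \<in> W"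
  assume ex: "\<forall>x\<in>W. x \<epsilon> a \<longrightarrow> (\<exists>y\<in>W. sat W E (case_nat y (case_nat x v)) p)"
  define R where "R x y \<longleftrightarrow> sat W E (case_nat y (case_nat x v)) p" for x y
  have "Dfp (\<lambda>e. R (e 0) (e 1))" unfolding R_def using v by (intro dfp Dfp_sat_W2)
  moreover have "\<exists>y\<in>M. wfd y \<and> R x y" if "x \<in> M" "x \<epsilon> a" for x
    using ex W_mem[OF a that] that unfolding R_def W_def by blast
  ultimately obtain b where b: "b \<in> W" "\<And>x. x \<in> M \<Longrightarrow> x \<epsilon> a \<Longrightarrow> \<exists>y\<in>M. y \<epsilon> b \<and> R x y"
    using wfd_collection[of R a] W_M[OF a] unfolding W_def by blast
  then show "\<exists>b\<in>W. \<forall>x\<in>W. x \<epsilon> a \<longrightarrow> (\<exists>y\<in>W. y \<epsilon> b \<and> sat W E (case_nat y (case_nat x v)) p)"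
    using W_M W_mem unfolding R_def by blast
qed

end

lemma sat_restrict: "range v \<subseteq> M \<Longrightarrow> sat M (E \<inter> M \<times> M) v p \<longleftrightarrow> sat M E v p"
proof (induction p arbitrary: v)
  case (Forall p)
  have "sat M (E \<inter> M \<times> M) (case_nat a v) p \<longleftrightarrow> sat M E (case_nat a v) p" if "a \<in> M" for a
    using Forall.prems that by (intro Forall.IH) simp
  then show ?case by simp
qed auto

lemma ZFC_collects_model_exists:
  assumes "consistent ZFC"
  obtains M :: "nat set" and E where "models M E ZFC" "collects M E" "E \<subseteq> M \<times> M"
proof -
  obtain N :: "nat set" and E where N: "models N E ZFC" using ZFC_model_exists[OF assms] .
  then have "range (from_nat_into N) = N"
    by (intro range_from_nat_into) (auto simp: models_def)
  then interpret zfc_model N E "from_nat_into N" using N by unfold_locales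
  have "models W (E \<inter> W \<times> W) ZFC"
    using W_models by (simp add: models_def sat_restrict)
  moreover have "collects W (E \<inter> W \<times> W)"
    using W_collects unfolding collects_def by (simp add: sat_restrict W_M)
  ultimately show thesis using that by blast
qed

subsection \<open>Large classes of pairs\<close>

locale zfc_coll_model = zfc_model +
  assumes coll: "collects M E"
begin

lemma collection:
  assumes "Dfp (\<lambda>e. R (e 0) (e 1))" and a: "a \<in> M"
    and ex: "\<And>x. x \<in> M \<Longrightarrow> x \<epsilon> a \<Longrightarrow> \<exists>y\<in>M. R x y"
  shows "\<exists>b\<in>M. \<forall>x\<in>M. x \<epsilon> a \<longrightarrow> (\<exists>y\<in>M. y \<epsilon> b \<and> R x y)"
proof -
  obtain p where p: "\<And>x y. x \<in> M \<Longrightarrow> y \<in> M \<Longrightarrow> R x y \<longleftrightarrow> sat M E (case_nat y (case_nat x m)) p"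
    using Dfp2_instance[OF assms(1)] by blast
  have "\<forall>x\<in>M. x \<epsilon> a \<longrightarrow> (\<exists>y\<in>M. sat M E (case_nat y (case_nat x m)) p)"
    using ex p by blast
  then obtain b where "b \<in> M" "\<forall>x\<in>M. x \<epsilon> a \<longrightarrow> (\<exists>y\<in>M. y \<epsilon> b \<and> sat M E (case_nat y (case_nat x m)) p)"
    using coll a range_m' unfolding collects_def by blast
  then show ?thesis using p by blast
qed

text \<open>In the extension, \<open>d\<close> becomes the element with a new trace and \<open>c\<close> the element that has all old
  sets as members; \<open>col A B\<close> is the column on which \<open>d\<close> realizes arbitrary patterns.\<close>

definition col :: "'a \<Rightarrow> 'a \<Rightarrow> 'a \<Rightarrow> bool" where
  "col A B x \<longleftrightarrow> (\<forall>z\<in>M. z \<epsilon> A \<longleftrightarrow> z \<epsilon> x \<and> z \<epsilon> B)"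

text \<open>\<open>r\<close> is an arbitrary pattern. The column is a proper class, so the pattern
  is prescribed only on its part inside an arbitrary set \<open>w\<close>; the same \<open>w\<close>
  pushes \<open>c\<close> upward.\<close>

definition full :: "'a \<Rightarrow> 'a \<Rightarrow> ('a \<Rightarrow> 'a \<Rightarrow> bool) \<Rightarrow> bool" where
  "full A B D \<longleftrightarrow> (\<forall>w\<in>M. \<forall>r\<in>M. \<exists>d\<in>M. \<exists>c\<in>M. D d c \<and> sub w c \<and>
     (\<forall>x\<in>M. x \<epsilon> w \<and> col A B x \<longrightarrow> (x \<epsilon> d \<longleftrightarrow> x \<epsilon> r)))"

definition large :: "('a \<Rightarrow> 'a \<Rightarrow> bool) \<Rightarrow> bool" where
  "large D \<longleftrightarrow> (\<exists>A\<in>M. \<exists>B\<in>M. sub A B \<and> full A B D)"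

lemma Dfp_col [dfp]: "trm s \<Longrightarrow> trm t \<Longrightarrow> trm u \<Longrightarrow> Dfp (\<lambda>e. col (s e) (t e) (u e))"
  by (rule Dfp3[of col]) (unfold col_def, intro dfp)

lemma fullD:
  assumes full: "full A B D" and w: "w \<in> M" and r: "r \<in> M"
  obtains d c where "d \<in> M" "c \<in> M" "D d c" "sub w c"
    "\<And>x. x \<in> M \<Longrightarrow> x \<epsilon> w \<Longrightarrow> col A B x \<Longrightarrow> x \<epsilon> d \<longleftrightarrow> x \<epsilon> r"
  using full[unfolded full_def, rule_format, OF w r] by blast

lemma large_nonempty: "large D \<Longrightarrow> \<exists>d\<in>M. \<exists>c\<in>M. D d c"
  unfolding large_def full_def by blast

lemma large_mono:
  assumes D: "large D" and D': "\<And>d c. d \<in> M \<Longrightarrow> c \<in> M \<Longrightarrow> D d c \<Longrightarrow> D' d c"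
  shows "large D'"
proof -
  have "full A B D'" if "full A B D" for A B
    unfolding full_def
  proof (intro ballI)
    fix w r assume "w \<in> M" "r \<in> M"
    then obtain d c where "d \<in> M" "c \<in> M" "D d c" "sub w c"
      "\<And>x. x \<in> M \<Longrightarrow> x \<epsilon> w \<Longrightarrow> col A B x \<Longrightarrow> x \<epsilon> d \<longleftrightarrow> x \<epsilon> r"
      using fullD[OF \<open>full A B D\<close>] by blast
    then show "\<exists>d\<in>M. \<exists>c\<in>M. D' d c \<and> sub w c \<and>
        (\<forall>x\<in>M. x \<epsilon> w \<and> col A B x \<longrightarrow> (x \<epsilon> d \<longleftrightarrow> x \<epsilon> r))"
      using D' by blast
  qed
  then show ?thesis using D unfolding large_def by blast
qed

lemma large_True: "large (\<lambda>d c. True)"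
proof -
  obtain z where "z \<in> M" using empty_ex by blast
  moreover have "full z z (\<lambda>d c. True)"
    unfolding full_def
  proof (intro ballI)
    fix w r assume "w \<in> M" "r \<in> M"
    then show "\<exists>d\<in>M. \<exists>c\<in>M. True \<and> sub w c \<and>
        (\<forall>x\<in>M. x \<epsilon> w \<and> col z z x \<longrightarrow> (x \<epsilon> d \<longleftrightarrow> x \<epsilon> r))"
      by (intro bexI[of _ r] bexI[of _ w]) auto
  qed
  ultimately show ?thesis unfolding large_def using sub_refl by blast
qed

lemma large_mem:
  assumes D: "large D" and x: "x \<in> M"
  shows "large (\<lambda>d c. D d c \<and> x \<epsilon> c)"
proof -
  obtain A B where AB: "A \<in> M" "B \<in> M" "sub A B" "full A B D" using D by (auto simp: large_def)
  have "full A B (\<lambda>d c. D d c \<and> x \<epsilon> c)"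
    unfolding full_def
  proof (intro ballI)
    fix w r assume w: "w \<in> M" and r: "r \<in> M"
    obtain w' where w': "w' \<in> M" "\<And>z. z \<in> M \<Longrightarrow> z \<epsilon> w' \<longleftrightarrow> z = x \<or> z \<epsilon> w"
      using insert_ex[OF x w] by blast
    obtain d c where "d \<in> M" "c \<in> M" "D d c" "sub w' c"
      "\<And>x. x \<in> M \<Longrightarrow> x \<epsilon> w' \<Longrightarrow> col A B x \<Longrightarrow> x \<epsilon> d \<longleftrightarrow> x \<epsilon> r"
      using fullD[OF AB(4) w'(1) r] by blast
    moreover from this have "sub w c" "x \<epsilon> c" using w' x by (simp_all add: sub_def)
    ultimately show "\<exists>d\<in>M. \<exists>c\<in>M. (D d c \<and> x \<epsilon> c) \<and> sub w c \<and>
        (\<forall>x\<in>M. x \<epsilon> w \<and> col A B x \<longrightarrow> (x \<epsilon> d \<longleftrightarrow> x \<epsilon> r))"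
      using w'(2) by blast
  qed
  then show ?thesis using AB by (auto simp: large_def)
qed

text \<open>The splitting set is \<open>A\<close>, which lies on its own column. Adding a fresh
  \<open>t\<close> to both \<open>A\<close> and \<open>B\<close> gives a subcolumn that misses
  \<open>A\<close>, so membership of \<open>A\<close> in \<open>d\<close> can be fixed either way
  without restricting the patterns there.\<close>

lemma large_split:
  assumes D: "large D"
  shows "\<exists>x\<in>M. large (\<lambda>d c. D d c \<and> x \<epsilon> d) \<and> large (\<lambda>d c. D d c \<and> \<not> x \<epsilon> d)"
proof -
  obtain A B where AB: "A \<in> M" "B \<in> M" "sub A B" "full A B D" using D by (auto simp: large_def)
  obtain t where t: "t \<in> M" "\<not> t \<epsilon> B" using fresh_ex AB(2) by blast
  obtain A' where A': "A' \<in> M" "\<And>z. z \<in> M \<Longrightarrow> z \<epsilon> A' \<longleftrightarrow> z = t \<or> z \<epsilon> A" using insert_ex[OF t(1) AB(1)] by blast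
  obtain B' where B': "B' \<in> M" "\<And>z. z \<in> M \<Longrightarrow> z \<epsilon> B' \<longleftrightarrow> z = t \<or> z \<epsilon> B" using insert_ex[OF t(1) AB(2)] by blast
  have colA: "col A B A" using AB(3) by (auto simp: col_def sub_def)
  have col_down: "col A B x" if "x \<in> M" "col A' B' x" for x
    unfolding col_def
  proof
    fix z assume z: "z \<in> M"
    show "z \<epsilon> A \<longleftrightarrow> z \<epsilon> x \<and> z \<epsilon> B"
      using that(2) A'(2)[OF z] B'(2)[OF z] z t(2) AB(3) unfolding col_def sub_def by blast
  qed
  have neq: "\<not> col A' B' A"
    using A'(2)[OF t(1)] B'(2)[OF t(1)] t AB(3) unfolding col_def sub_def by blast
  have sub': "sub A' B'" using A'(2) B'(2) AB(3) by (simp add: sub_def)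
  have "full A' B' (\<lambda>d c. D d c \<and> (A \<epsilon> d \<longleftrightarrow> b))" for b
    unfolding full_def
  proof (intro ballI)
    fix w r assume w: "w \<in> M" and r: "r \<in> M"
    obtain w' where w': "w' \<in> M" "\<And>z. z \<in> M \<Longrightarrow> z \<epsilon> w' \<longleftrightarrow> z = A \<or> z \<epsilon> w"
      using insert_ex[OF AB(1) w] by blast
    \<comment> \<open>The pattern \<open>r'\<close> obtained from \<open>r1\<close> is
      \<open>r\<close> with membership of \<open>A\<close> set to \<open>b\<close>.\<close>
    obtain r1 where r1: "r1 \<in> M" "\<And>z. z \<in> M \<Longrightarrow> z \<epsilon> r1 \<longleftrightarrow> z = A \<or> z \<epsilon> r"
      using insert_ex[OF AB(1) r] by blast
    have "Dfp (\<lambda>e. e 0 = A \<longrightarrow> b)" using AB by (intro dfp)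
    then obtain r' where r': "r' \<in> M" "\<And>z. z \<in> M \<Longrightarrow> z \<epsilon> r' \<longleftrightarrow> z \<epsilon> r1 \<and> (z = A \<longrightarrow> b)"
      using separation[of "\<lambda>z. z = A \<longrightarrow> b" r1] r1(1) by blast
    obtain d c where dc: "d \<in> M" "c \<in> M" "D d c" "sub w' c"
      "\<And>x. x \<in> M \<Longrightarrow> x \<epsilon> w' \<Longrightarrow> col A B x \<Longrightarrow> x \<epsilon> d \<longleftrightarrow> x \<epsilon> r'"
      using fullD[OF AB(4) w'(1) r'(1)] by blast
    have "sub w c" using dc(4) w'(2) by (simp add: sub_def)
    moreover have "A \<epsilon> d \<longleftrightarrow> b" using dc(5)[OF AB(1)] w'(2) r'(2) r1(2) AB(1) colA by simp
    moreover have "x \<epsilon> d \<longleftrightarrow> x \<epsilon> r" if "x \<in> M" "x \<epsilon> w" "col A' B' x" for x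
      using dc(5)[OF that(1)] w'(2) r'(2) r1(2) that col_down neq by blast
    ultimately show "\<exists>d\<in>M. \<exists>c\<in>M. (D d c \<and> (A \<epsilon> d \<longleftrightarrow> b)) \<and> sub w c \<and>
        (\<forall>x\<in>M. x \<epsilon> w \<and> col A' B' x \<longrightarrow> (x \<epsilon> d \<longleftrightarrow> x \<epsilon> r))"
      using dc(1-3) by blast
  qed
  from this[of True] this[of False] show ?thesis
    using A'(1) B'(1) sub' AB(1) unfolding large_def by auto
qed

text \<open>If no \<open>D i\<close> is large, then patterns omitted by the \<open>D i\<close> on the disjoint subcolumns
  given by the tags \<open>{i, z}\<close> are glued to a pattern omitted by the union of the \<open>D i\<close>.\<close>

lemma large_pigeonhole:
  assumes df: "Dfp (\<lambda>e. D (e 0) (e 1) (e 2))" and a: "a \<in> M"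
    and lg: "large (\<lambda>d c. \<exists>i\<in>M. i \<epsilon> a \<and> D i d c)"
  shows "\<exists>i\<in>M. i \<epsilon> a \<and> large (D i)"
proof (rule ccontr)
  assume none: "\<not> (\<exists>i\<in>M. i \<epsilon> a \<and> large (D i))"
  have D [dfp]: "Dfp (\<lambda>e. D (s e) (t e) (u e))" if "trm s" "trm t" "trm u" for s t u
    by (rule Dfp3[OF df that])
  obtain A B where AB: "A \<in> M" "B \<in> M" "sub A B"
    and fullAB: "full A B (\<lambda>d c. \<exists>i\<in>M. i \<epsilon> a \<and> D i d c)"
    using lg by (auto simp: large_def)
  obtain UB where UB: "UB \<in> M" "\<And>z. z \<in> M \<Longrightarrow> z \<epsilon> UB \<longleftrightarrow> (\<exists>y\<in>M. z \<epsilon> y \<and> y \<epsilon> B)"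
    using union[OF AB(2)] by blast
  obtain u where u: "u \<in> M" "\<And>z. z \<in> M \<Longrightarrow> z \<epsilon> u \<longleftrightarrow> z \<epsilon> UB \<or> z \<epsilon> a" using Un_ex[OF UB(1) a] by blast
  obtain z where z: "z \<in> M" "\<not> z \<epsilon> u" using fresh_ex[OF u(1)] by blast
  \<comment> \<open>As \<open>z\<close> belongs neither to \<open>a\<close> nor to any member of
    \<open>B\<close>, the pair \<open>{i, z}\<close> is outside \<open>B\<close> and determines its
    \<open>i\<close> in \<open>a\<close>.\<close>
  define tag where "tag i t \<longleftrightarrow> (\<forall>y\<in>M. y \<epsilon> t \<longleftrightarrow> y = i \<or> y = z)" for i t
  have Dfp_tag: "Dfp (\<lambda>e. tag (s e) (t e))" if "trm s" "trm t" for s t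
    by (rule Dfp2[OF _ that]) (unfold tag_def, intro dfp z(1))
  have tag_ex: "\<exists>t\<in>M. tag i t" if "i \<in> M" for i
    using pairing[OF that z(1)] by (simp add: tag_def)
  have tag_unique: "t = t'" if "tag i t" "tag i t'" "t \<in> M" "t' \<in> M" for i t t'
    using ext[OF that(3,4)] that(1,2) unfolding tag_def by blast
  have tag_inj: "i = j" if "tag i t" "tag j t" "i \<in> M" "i \<epsilon> a" for i j t
    using that z u(2) unfolding tag_def by blast
  have tag_B: "\<not> t \<epsilon> B" if "tag i t" "t \<in> M" for i t
    using that z u(2) UB(2) unfolding tag_def by blast
  have "\<exists>b\<in>M. \<forall>y\<in>M. y \<epsilon> b \<longleftrightarrow> (\<exists>x\<in>M. x \<epsilon> a \<and> tag x y)"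
    by (rule replacement[OF Dfp_tag a]) (use tag_unique in \<open>auto intro: dfp\<close>)
  then obtain T where T: "T \<in> M" "\<And>t. t \<in> M \<Longrightarrow> t \<epsilon> T \<longleftrightarrow> (\<exists>i\<in>M. i \<epsilon> a \<and> tag i t)" by blast
  obtain B' where B': "B' \<in> M" "\<And>y. y \<in> M \<Longrightarrow> y \<epsilon> B' \<longleftrightarrow> y \<epsilon> B \<or> y \<epsilon> T" using Un_ex[OF AB(2) T(1)] by blast
  have TB: "\<not> t \<epsilon> B" if "t \<in> M" "t \<epsilon> T" for t using that T(2) tag_B by blast
  \<comment> \<open>The subcolumn of \<open>i\<close>: among all tags, exactly that of
    \<open>i\<close> belongs to \<open>x\<close>.\<close>
  define colT where "colT i x \<longleftrightarrow> col A B x \<and> (\<forall>t\<in>M. t \<epsilon> T \<longrightarrow> (t \<epsilon> x \<longleftrightarrow> tag i t))" for i x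
  have Dfp_colT: "Dfp (\<lambda>e. colT (s e) (t e))" if "trm s" "trm t" for s t
    by (rule Dfp2[OF _ that]) (unfold colT_def, intro dfp AB T Dfp_tag)
  have colT_inj: "i = j" if col: "colT i x" "colT j x" and i: "i \<in> M" "i \<epsilon> a" for i j x
  proof -
    obtain t where t: "t \<in> M" "tag i t" using tag_ex i(1) by blast
    then have "t \<epsilon> T" using T(2) i by blast
    then have "tag j t" using col t unfolding colT_def by blast
    then show ?thesis using tag_inj t i by blast
  qed
  have subcol: "\<exists>A'\<in>M. sub A' B' \<and> (\<forall>x\<in>M. col A' B' x \<longleftrightarrow> colT i x)" if i: "i \<in> M" "i \<epsilon> a" for i
  proof -
    obtain t where t: "t \<in> M" "tag i t" using tag_ex i by blast
    then have tT: "t \<epsilon> T" using T(2) i by blast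
    obtain A' where A': "A' \<in> M" "\<And>y. y \<in> M \<Longrightarrow> y \<epsilon> A' \<longleftrightarrow> y = t \<or> y \<epsilon> A" using insert_ex[OF t(1) AB(1)] by blast
    have "sub A' B'" using A'(2) B'(2) AB(3) tT by (auto simp: sub_def)
    moreover have "col A' B' x \<longleftrightarrow> colT i x" if x: "x \<in> M" for x
    proof
      assume L: "col A' B' x"
      have "y \<epsilon> A \<longleftrightarrow> y \<epsilon> x \<and> y \<epsilon> B" if "y \<in> M" for y
        using L A'(2)[OF that] B'(2)[OF that] that TB[OF t(1) tT] subD[OF AB(3) that] unfolding col_def by blast
      moreover have "s \<epsilon> x \<longleftrightarrow> tag i s" if s: "s \<in> M" "s \<epsilon> T" for s
        using L A'(2)[OF s(1)] B'(2)[OF s(1)] s TB[OF s] subD[OF AB(3) s(1)] t tag_unique[OF t(2) _ t(1) s(1)]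
        unfolding col_def by blast
      ultimately show "colT i x" unfolding colT_def col_def by blast
    next
      assume R: "colT i x"
      have "y \<epsilon> A' \<longleftrightarrow> y \<epsilon> x \<and> y \<epsilon> B'" if y: "y \<in> M" for y
        using R A'(2)[OF y] B'(2)[OF y] y tT TB[OF t(1) tT] subD[OF AB(3) y] t tag_unique[OF t(2) _ t(1) y]
        unfolding colT_def col_def by blast
      then show "col A' B' x" unfolding col_def by blast
    qed
    ultimately show ?thesis using A'(1) by blast
  qed
  define bad where "bad i w s \<longleftrightarrow> (\<forall>d\<in>M. \<forall>c\<in>M. \<not> (D i d c \<and> sub w c \<and>
      (\<forall>x\<in>M. x \<epsilon> w \<and> colT i x \<longrightarrow> (x \<epsilon> d \<longleftrightarrow> x \<epsilon> s))))" for i w s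
  have Dfp_bad: "Dfp (\<lambda>e. bad (s e) (t e) (v e))" if "trm s" "trm t" "trm v" for s t v
    by (rule Dfp3[OF _ that]) (unfold bad_def, intro dfp Dfp_colT D)
  \<comment> \<open>Nonempty patterns living on different subcolumns are different. This makes the
    family to which \<open>choice\<close> is applied disjoint.\<close>
  define piece where "piece i s \<longleftrightarrow> (\<exists>x\<in>M. x \<epsilon> s) \<and> (\<forall>x\<in>M. x \<epsilon> s \<longrightarrow> colT i x)" for i s
  have Dfp_piece: "Dfp (\<lambda>e. piece (s e) (t e))" if "trm s" "trm t" for s t
    by (rule Dfp2[OF _ that]) (unfold piece_def, intro dfp Dfp_colT)
  have bad_mono: "bad i w' s" if b: "bad i w s" and w: "sub w w'" for i w w' s
    unfolding bad_def
  proof (intro ballI notI, elim conjE)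
    fix d c assume dc: "d \<in> M" "c \<in> M" "D i d c" "sub w' c"
      and x: "\<forall>x\<in>M. x \<epsilon> w' \<and> colT i x \<longrightarrow> (x \<epsilon> d \<longleftrightarrow> x \<epsilon> s)"
    have "sub w c" using sub_trans[OF w dc(4)] .
    moreover have "\<forall>x\<in>M. x \<epsilon> w \<and> colT i x \<longrightarrow> (x \<epsilon> d \<longleftrightarrow> x \<epsilon> s)" using x subD[OF w] by blast
    ultimately show False using b dc(1-3) unfolding bad_def by blast
  qed
  have bad_ex: "\<exists>w\<in>M. \<exists>s\<in>M. bad i w s \<and> piece i s" if i: "i \<in> M" "i \<epsilon> a" for i
  proof -
    obtain A' where A': "A' \<in> M" "sub A' B'" "\<And>x. x \<in> M \<Longrightarrow> col A' B' x \<longleftrightarrow> colT i x"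
      using subcol[OF i] by blast
    have "\<not> full A' B' (D i)" using none i A' B'(1) unfolding large_def by blast
    then obtain w r where w: "w \<in> M" and r: "r \<in> M" and nf: "bad i w r"
      unfolding full_def bad_def using A'(3) by auto
    obtain Uw where Uw: "Uw \<in> M" "\<And>y. y \<in> M \<Longrightarrow> y \<epsilon> Uw \<longleftrightarrow> (\<exists>x\<in>M. y \<epsilon> x \<and> x \<epsilon> w)" using union[OF w] by blast
    obtain q where q: "q \<in> M" "\<And>y. y \<in> M \<Longrightarrow> y \<epsilon> q \<longleftrightarrow> y \<epsilon> B' \<or> y \<epsilon> Uw" using Un_ex[OF B'(1) Uw(1)] by blast
    obtain v where v: "v \<in> M" "\<not> v \<epsilon> q" using fresh_ex[OF q(1)] by blast
    \<comment> \<open>A point of the subcolumn outside \<open>w\<close>: adding it makes the pattern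
      nonempty without changing it on \<open>w\<close>, so the pattern stays bad.\<close>
    obtain y where y: "y \<in> M" "\<And>x. x \<in> M \<Longrightarrow> x \<epsilon> y \<longleftrightarrow> x = v \<or> x \<epsilon> A'" using insert_ex[OF v(1) A'(1)] by blast
    have "col A' B' y" using y(2) v q(2) A'(2) unfolding col_def sub_def by blast
    then have cy: "colT i y" using A'(3) y(1) by blast
    have yw: "\<not> y \<epsilon> w" using y v q(2) Uw(2) by blast
    obtain w1 where w1: "w1 \<in> M" "\<And>x. x \<in> M \<Longrightarrow> x \<epsilon> w1 \<longleftrightarrow> x = y \<or> x \<epsilon> w" using insert_ex[OF y(1) w] by blast
    have "Dfp (\<lambda>e. e 0 = y \<or> (e 0 \<epsilon> r \<and> colT i (e 0)))" by (intro dfp Dfp_colT r y(1) i(1))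
    then obtain s where s: "s \<in> M" "\<And>x. x \<in> M \<Longrightarrow> x \<epsilon> s \<longleftrightarrow> x \<epsilon> w1 \<and> (x = y \<or> (x \<epsilon> r \<and> colT i x))"
      using separation[of "\<lambda>x. x = y \<or> (x \<epsilon> r \<and> colT i x)" w1] w1(1) by blast
    have "piece i s" unfolding piece_def using s(2) w1(2) y(1) cy by blast
    moreover have "x \<epsilon> s \<longleftrightarrow> x \<epsilon> r" if "x \<in> M" "x \<epsilon> w" "colT i x" for x
      using s(2) w1(2) yw that by blast
    then have "bad i w s" using nf unfolding bad_def by blast
    ultimately show ?thesis using w s(1) by blast
  qed
  \<comment> \<open>Collection is used twice: for one \<open>w\<close> that serves all
    \<open>i\<close>, since badness persists when \<open>w\<close> grows, and then for a set
    \<open>L\<close> containing a bad piece over this \<open>w\<close> for every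
    \<open>i\<close>.\<close>
  have "Dfp (\<lambda>e. \<exists>s\<in>M. bad (e 0) (e 1) s \<and> piece (e 0) s)"
    by (intro dfp Dfp_bad Dfp_piece)
  then have "\<exists>b\<in>M. \<forall>x\<in>M. x \<epsilon> a \<longrightarrow> (\<exists>w\<in>M. w \<epsilon> b \<and> (\<exists>s\<in>M. bad x w s \<and> piece x s))"
    using bad_ex by (intro collection a) auto
  then obtain K where K: "K \<in> M"
    "\<And>x. x \<in> M \<Longrightarrow> x \<epsilon> a \<Longrightarrow> \<exists>w\<in>M. w \<epsilon> K \<and> (\<exists>s\<in>M. bad x w s \<and> piece x s)" by blast
  obtain w where w: "w \<in> M" "\<And>y. y \<in> M \<Longrightarrow> y \<epsilon> w \<longleftrightarrow> (\<exists>x\<in>M. y \<epsilon> x \<and> x \<epsilon> K)" using union[OF K(1)] by blast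
  have bad_w: "\<exists>s\<in>M. bad i w s \<and> piece i s" if i: "i \<in> M" "i \<epsilon> a" for i
  proof -
    obtain w' s where ws: "w' \<in> M" "w' \<epsilon> K" "s \<in> M" "bad i w' s" "piece i s" using K(2)[OF i] by blast
    have "sub w' w" using ws w(2) by (auto simp: sub_def)
    then show ?thesis using bad_mono ws by blast
  qed
  have "Dfp (\<lambda>e. bad (e 0) w (e 1) \<and> piece (e 0) (e 1))"
    by (intro dfp Dfp_bad Dfp_piece w)
  then have "\<exists>b\<in>M. \<forall>x\<in>M. x \<epsilon> a \<longrightarrow> (\<exists>s\<in>M. s \<epsilon> b \<and> (bad x w s \<and> piece x s))"
    using bad_w by (intro collection a) auto
  then obtain L where L: "L \<in> M"
    "\<And>x. x \<in> M \<Longrightarrow> x \<epsilon> a \<Longrightarrow> \<exists>s\<in>M. s \<epsilon> L \<and> bad x w s \<and> piece x s" by blast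
  define Fi where "Fi i f \<longleftrightarrow> (\<forall>s\<in>M. s \<epsilon> f \<longleftrightarrow> s \<epsilon> L \<and> bad i w s \<and> piece i s)" for i f
  have Dfp_Fi: "Dfp (\<lambda>e. Fi (s e) (t e))" if "trm s" "trm t" for s t
    by (rule Dfp2[OF _ that]) (unfold Fi_def, intro dfp Dfp_bad Dfp_piece w L)
  have Fi_unique: "f = g" if "Fi i f" "Fi i g" "f \<in> M" "g \<in> M" for i f g
    using ext[OF that(3,4)] that(1,2) unfolding Fi_def by blast
  have Fi_ex: "\<exists>f\<in>M. Fi i f" if "i \<in> M" for i
  proof -
    have "Dfp (\<lambda>e. bad i w (e 0) \<and> piece i (e 0))" by (intro dfp Dfp_bad Dfp_piece w that)
    then show ?thesis using separation[of "\<lambda>s. bad i w s \<and> piece i s" L] L(1) unfolding Fi_def by blast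
  qed
  have "\<exists>b\<in>M. \<forall>y\<in>M. y \<epsilon> b \<longleftrightarrow> (\<exists>x\<in>M. x \<epsilon> a \<and> Fi x y)"
    by (rule replacement[OF Dfp_Fi a]) (use Fi_unique in \<open>auto intro: dfp\<close>)
  then obtain F where F: "F \<in> M" "\<And>f. f \<in> M \<Longrightarrow> f \<epsilon> F \<longleftrightarrow> (\<exists>i\<in>M. i \<epsilon> a \<and> Fi i f)" by blast
  have "\<exists>C\<in>M. \<forall>f\<in>M. f \<epsilon> F \<longrightarrow> (\<exists>s\<in>M. \<forall>v\<in>M. v \<epsilon> f \<and> v \<epsilon> C \<longleftrightarrow> v = s)"
  proof (rule choice[OF F(1)])
    show "\<exists>s\<in>M. s \<epsilon> f" if "f \<in> M" "f \<epsilon> F" for f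
      using that F(2) L(2) unfolding Fi_def by blast
    fix f g s assume f: "f \<in> M" "f \<epsilon> F" and g: "g \<in> M" "g \<epsilon> F" and s: "s \<in> M" "s \<epsilon> f" "s \<epsilon> g"
    obtain i j where i: "i \<in> M" "i \<epsilon> a" "Fi i f" and j: "j \<in> M" "j \<epsilon> a" "Fi j g" using F(2) f g by blast
    have "piece i s" "piece j s" using i j s unfolding Fi_def by blast+
    then have "i = j" using colT_inj i unfolding piece_def by blast
    then show "f = g" using Fi_unique i j f g by blast
  qed
  then obtain C where C: "C \<in> M" "\<And>f. f \<in> M \<Longrightarrow> f \<epsilon> F \<Longrightarrow> \<exists>s\<in>M. \<forall>v\<in>M. v \<epsilon> f \<and> v \<epsilon> C \<longleftrightarrow> v = s" by blast
  \<comment> \<open>The glued pattern, the union of the chosen pieces. On the subcolumn of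
    \<open>i\<close> it agrees with the piece chosen for \<open>i\<close>.\<close>
  define R where "R x \<longleftrightarrow> (\<exists>i\<in>M. i \<epsilon> a \<and> (\<exists>f\<in>M. Fi i f \<and> (\<exists>s\<in>M. s \<epsilon> f \<and> s \<epsilon> C \<and> x \<epsilon> s)))" for x
  obtain UL where UL: "UL \<in> M" "\<And>y. y \<in> M \<Longrightarrow> y \<epsilon> UL \<longleftrightarrow> (\<exists>x\<in>M. y \<epsilon> x \<and> x \<epsilon> L)" using union[OF L(1)] by blast
  have "Dfp (\<lambda>e. R (e 0))" unfolding R_def by (intro dfp Dfp_Fi a C)
  moreover have "x \<epsilon> UL" if "x \<in> M" "R x" for x
    using that UL(2) unfolding R_def Fi_def by blast
  ultimately obtain r where r: "r \<in> M" "\<And>x. x \<in> M \<Longrightarrow> x \<epsilon> r \<longleftrightarrow> R x"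
    using comprehension[of R UL] UL(1) by blast
  obtain d c where dc: "d \<in> M" "c \<in> M" "\<exists>i\<in>M. i \<epsilon> a \<and> D i d c" "sub w c"
    "\<And>x. x \<in> M \<Longrightarrow> x \<epsilon> w \<Longrightarrow> col A B x \<Longrightarrow> x \<epsilon> d \<longleftrightarrow> x \<epsilon> r"
    using fullD[OF fullAB w(1) r(1)] by blast
  then obtain i where i: "i \<in> M" "i \<epsilon> a" "D i d c" by blast
  obtain f where f: "f \<in> M" "Fi i f" using Fi_ex i by blast
  then have fF: "f \<epsilon> F" using F(2) i by blast
  obtain s where s: "s \<in> M" "\<And>v. v \<in> M \<Longrightarrow> v \<epsilon> f \<and> v \<epsilon> C \<longleftrightarrow> v = s" using C(2)[OF f(1) fF] by blast
  then have s': "s \<epsilon> f" "s \<epsilon> C" by blast+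
  have "x \<epsilon> d \<longleftrightarrow> x \<epsilon> s" if x: "x \<in> M" "x \<epsilon> w" "colT i x" for x
  proof -
    have "R x \<longleftrightarrow> x \<epsilon> s"
    proof
      assume "R x"
      then obtain j g v where j: "j \<in> M" "j \<epsilon> a" "g \<in> M" "Fi j g" "v \<in> M" "v \<epsilon> g" "v \<epsilon> C" "x \<epsilon> v"
        unfolding R_def by blast
      have "colT j x" using j x unfolding Fi_def piece_def by blast
      then have "i = j" using colT_inj x i by blast
      then have "v = s" using Fi_unique[of i f g] f j s(2) by blast
      then show "x \<epsilon> s" using j by blast
    next
      assume "x \<epsilon> s"
      then show "R x" unfolding R_def using i f s s' by blast
    qed
    moreover have "col A B x" using x unfolding colT_def by blast
    ultimately show ?thesis using dc(5)[OF x(1,2)] r(2)[OF x(1)] by blast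
  qed
  moreover have "bad i w s" using f s s' unfolding Fi_def by blast
  ultimately show False using dc(1,2,4) i unfolding bad_def by blast
qed

end

section \<open>Pigeonhole for classes of pairs given by formulas with auxiliary variables\<close>

context zfc_coll_model
begin

lemma Dfp_ex_update:
  assumes "Dfp P"
  shows "Dfp (\<lambda>g. \<exists>x\<in>M. P (g(k := x)))"
proof -
  have "Dfp (\<lambda>e. P (\<lambda>n. (if n = k then (\<lambda>e. e 0) else (\<lambda>e. e (Suc n))) e))"
    by (rule Dfp_rename[OF assms]) (auto intro: dfp)
  moreover have "(\<lambda>n. (if n = k then (\<lambda>e. e 0) else (\<lambda>e. e (Suc n))) e) = (\<lambda>n. e (Suc n))(k := e 0)"
    for e :: "nat \<Rightarrow> 'a" by auto
  ultimately show ?thesis by (intro dfp) simp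
qed

text \<open>The quantifier ranges over infinite sequences, but a formula has finitely many free
  variables; \<open>Q n\<close> quantifies over \<open>n\<close> entries, one at a time.\<close>

lemma Dfp_ex_env:
  assumes P: "Dfp P"
  shows "Dfp (\<lambda>g. \<exists>e. range e \<subseteq> M \<and> (\<forall>k<j. e k = g k) \<and> P e)"
proof -
  define Q where "Q n g \<longleftrightarrow> (\<exists>e. range e \<subseteq> M \<and> (\<forall>k. k < j \<or> j + n \<le> k \<longrightarrow> e k = g k) \<and> P e)" for n g
  have Q: "Dfp (Q n)" for n
  proof (induction n)
    case 0
    obtain p where p: "\<And>e. range e \<subseteq> M \<Longrightarrow> P e \<longleftrightarrow> sat M E (mix e m) p"
      using P by (auto simp: Dfp_def)
    have "Q 0 g \<longleftrightarrow> P g" if g: "range g \<subseteq> M" for g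
    proof
      assume "Q 0 g"
      then obtain e where "\<forall>k. k < j \<or> j + 0 \<le> k \<longrightarrow> e k = g k" "P e" by (auto simp: Q_def)
      then have "e = g" by (intro HOL.ext) (metis add_0_right not_le)
      then show "P g" using \<open>P e\<close> by simp
    qed (use g in \<open>auto simp: Q_def\<close>)
    then show ?case unfolding Dfp_def using p by blast
  next
    case (Suc n)
    have "Q (Suc n) g \<longleftrightarrow> (\<exists>x\<in>M. Q n (g(j + n := x)))" for g
    proof
      assume "Q (Suc n) g"
      then obtain e where e: "range e \<subseteq> M" "\<forall>k. k < j \<or> j + Suc n \<le> k \<longrightarrow> e k = g k" "P e"
        by (auto simp: Q_def)
      then have "Q n (g(j + n := e (j + n)))"
        unfolding Q_def by (intro exI[of _ e]) auto
      then show "\<exists>x\<in>M. Q n (g(j + n := x))" using e(1) by blast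
    next
      assume "\<exists>x\<in>M. Q n (g(j + n := x))"
      then obtain x e where e: "range e \<subseteq> M"
        "\<forall>k. k < j \<or> j + n \<le> k \<longrightarrow> e k = (g(j + n := x)) k" "P e"
        by (auto simp: Q_def)
      have "\<forall>k. k < j \<or> j + Suc n \<le> k \<longrightarrow> e k = g k"
        using e(2) by auto
      then show "Q (Suc n) g" using e unfolding Q_def by blast
    qed
    then have "Q (Suc n) = (\<lambda>g. \<exists>x\<in>M. Q n (g(j + n := x)))" by (intro HOL.ext)
    then show ?case using Dfp_ex_update[OF Suc] by (simp only:)
  qed
  obtain p where p: "\<And>e. range e \<subseteq> M \<Longrightarrow> P e \<longleftrightarrow> sat M E (mix e m) p"
    using P by (auto simp: Dfp_def)
  obtain N where N: "fv p \<subseteq> {..<N}" using finite_nat_iff_bounded[of "fv p"] by auto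
  have "(\<exists>e. range e \<subseteq> M \<and> (\<forall>k<j. e k = g k) \<and> P e) \<longleftrightarrow> Q N g" if g: "range g \<subseteq> M" for g
  proof
    assume "\<exists>e. range e \<subseteq> M \<and> (\<forall>k<j. e k = g k) \<and> P e"
    then obtain e where e: "range e \<subseteq> M" "\<forall>k<j. e k = g k" "P e" by blast
    define e' where "e' k = (if k < j + N then e k else g k)" for k
    have e': "range e' \<subseteq> M" using e(1) g by (auto simp: e'_def)
    have "sat M E (mix e' m) p \<longleftrightarrow> sat M E (mix e m) p"
      using N by (intro sat_cong_fv) (auto simp: mix_def e'_def)
    then have "P e'" using p[OF e'] p[OF e(1)] e(3) by simp
    then show "Q N g" unfolding Q_def using e' e(2) by (intro exI[of _ e']) (auto simp: e'_def)
  qed (auto simp: Q_def)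
  then show ?thesis using Q[of N] unfolding Dfp_def by simp
qed

text \<open>The remaining entries of \<open>e\<close> are Henkin witnesses. They are quantified
  existentially because their values may depend on the pair.\<close>

definition pairs :: "((nat \<Rightarrow> 'a) \<Rightarrow> bool) \<Rightarrow> 'a \<Rightarrow> 'a \<Rightarrow> bool" where
  "pairs P d c \<longleftrightarrow> (\<exists>e. range e \<subseteq> M \<and> e 0 = d \<and> e 1 = c \<and> P e)"

lemma large_pairs_pigeonhole:
  assumes H: "Dfp (\<lambda>g. H (g 0) (\<lambda>k. g (Suc k)))" and a: "a \<in> M" and P: "large (pairs P)"
    and PH: "\<And>e. range e \<subseteq> M \<Longrightarrow> P e \<Longrightarrow> \<exists>i\<in>M. i \<epsilon> a \<and> H i e"
  shows "\<exists>i\<in>M. i \<epsilon> a \<and> large (pairs (H i))"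
proof (rule large_pigeonhole[OF _ a])
  \<comment> \<open>The entries move up by one to make room for the index: 0, 1 and 2 are now
    \<open>i\<close>, \<open>d\<close> and \<open>c\<close>.\<close>
  have "Dfp (\<lambda>g. \<exists>e. range e \<subseteq> M \<and> (\<forall>k<3. e k = g k) \<and> H (e 0) (\<lambda>k. e (Suc k)))"
    by (rule Dfp_ex_env[OF H])
  moreover have "(\<exists>e. range e \<subseteq> M \<and> (\<forall>k<3. e k = g k) \<and> H (e 0) (\<lambda>k. e (Suc k)))
      \<longleftrightarrow> pairs (H (g 0)) (g 1) (g 2)" if g: "range g \<subseteq> M" for g
  proof
    assume "\<exists>e. range e \<subseteq> M \<and> (\<forall>k<3. e k = g k) \<and> H (e 0) (\<lambda>k. e (Suc k))"
    then obtain e where "range e \<subseteq> M" "\<forall>k<3. e k = g k" "H (e 0) (\<lambda>k. e (Suc k))" by blast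
    then show "pairs (H (g 0)) (g 1) (g 2)"
      unfolding pairs_def by (intro exI[of _ "\<lambda>k. e (Suc k)"]) (auto simp: numeral_2_eq_2 image_subset_iff)
  next
    assume "pairs (H (g 0)) (g 1) (g 2)"
    then obtain e where "range e \<subseteq> M" "e 0 = g 1" "e 1 = g 2" "H (g 0) e" by (auto simp: pairs_def)
    then show "\<exists>e. range e \<subseteq> M \<and> (\<forall>k<3. e k = g k) \<and> H (e 0) (\<lambda>k. e (Suc k))"
      using g by (intro exI[of _ "case_nat (g 0) e"])
        (auto simp: numeral_3_eq_3 less_Suc_eq numeral_2_eq_2)
  qed
  ultimately show "Dfp (\<lambda>e. pairs (H (e 0)) (e 1) (e 2))" unfolding Dfp_def by auto
  show "large (\<lambda>d c. \<exists>i\<in>M. i \<epsilon> a \<and> pairs (H i) d c)"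
    by (rule large_mono[OF P]) (use PH in \<open>auto simp: pairs_def, blast\<close>)
qed

subsection \<open>Elementary end extensions\<close>

text \<open>Formulas describe the extension as follows: the variables \<open>0\<close> and \<open>2\<close> stand for \<open>d\<close> and \<open>c\<close>, the
  variable \<open>2 * j + 1\<close> stands for \<open>m j\<close>, and the other ones are available as witnesses.\<close>

definition holds :: "fm set \<Rightarrow> (nat \<Rightarrow> 'a) \<Rightarrow> bool" where
  "holds S e \<longleftrightarrow> (\<forall>p\<in>S. sat M E (mix e m) p)"

text \<open>Largeness implies satisfiability in \<open>M\<close>, hence consistency; moreover it
  leaves enough freedom for \<open>Con_above\<close> and \<open>Con_trace\<close>.\<close>

definition Con :: "fm set \<Rightarrow> bool" where
  "Con S \<longleftrightarrow> finite S \<and> large (pairs (holds S))"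

lemma holds_insert [simp]: "holds (insert p S) e \<longleftrightarrow> sat M E (mix e m) p \<and> holds S e"
  by (auto simp: holds_def)

lemma Dfp_holds: "finite S \<Longrightarrow> Dfp (holds S)"
proof (induction S rule: finite_induct)
  case empty
  have "holds {} = (\<lambda>e. True)" by (auto simp: holds_def)
  then show ?case using Dfp_const by simp
next
  case (insert p S)
  have "Dfp (\<lambda>e. sat M E (mix e m) p)" unfolding Dfp_def by blast
  then have "Dfp (\<lambda>e. sat M E (mix e m) p \<and> holds S e)" using insert by (intro dfp)
  moreover have "holds (insert p S) = (\<lambda>e. sat M E (mix e m) p \<and> holds S e)" by auto
  ultimately show ?case by simp
qed

lemma Dfp_Suc: "Dfp P \<Longrightarrow> Dfp (\<lambda>g. P (\<lambda>k. g (Suc k)))"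
  using Dfp_rename[of P "\<lambda>k e. e (Suc k)"] by (auto intro: dfp)

lemma Con_satisfiable: "Con S \<Longrightarrow> \<exists>e. range e \<subseteq> M \<and> holds S e"
  using large_nonempty unfolding Con_def pairs_def by blast

lemma Con_mono: "Con S \<Longrightarrow> finite S' \<Longrightarrow>
    (\<And>e. range e \<subseteq> M \<Longrightarrow> holds S e \<Longrightarrow> \<exists>e'. range e' \<subseteq> M \<and> e' 0 = e 0 \<and> e' 1 = e 1 \<and> holds S' e') \<Longrightarrow> Con S'"
proof -
  assume S: "Con S" "finite S'" and ex: "\<And>e. range e \<subseteq> M \<Longrightarrow> holds S e \<Longrightarrow>
    \<exists>e'. range e' \<subseteq> M \<and> e' 0 = e 0 \<and> e' 1 = e 1 \<and> holds S' e'"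
  have "pairs (holds S') d c" if "pairs (holds S) d c" for d c
    using that ex unfolding pairs_def by blast
  then show ?thesis using S large_mono unfolding Con_def by blast
qed

lemma Con_empty: "Con {}"
proof -
  have "pairs (holds {}) d c" if "d \<in> M" "c \<in> M" for d c
    unfolding pairs_def holds_def
    using that by (intro exI[of _ "\<lambda>n. if n = 0 then d else c"]) auto
  then show ?thesis unfolding Con_def using large_mono[OF large_True] by blast
qed

text \<open>The pigeonhole principle over a set with two elements, the index telling whether
  \<open>p\<close> holds.\<close>

lemma Con_split:
  assumes "Con S"
  shows "Con (insert p S) \<or> Con (insert (Neg p) S)"
proof -
  obtain a where a: "a \<in> M" "\<And>x. x \<in> M \<Longrightarrow> \<not> x \<epsilon> a" using empty_ex by blast
  obtain b where b: "b \<in> M" "\<And>x. x \<in> M \<Longrightarrow> x \<epsilon> b \<longleftrightarrow> x = a" using pairing[OF a(1) a(1)] by auto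
  obtain ab where ab: "ab \<in> M" "\<And>x. x \<in> M \<Longrightarrow> x \<epsilon> ab \<longleftrightarrow> x = a \<or> x = b" using pairing[OF a(1) b(1)] by blast
  have neq: "b \<noteq> a" using a b by blast
  define H where "H i e \<longleftrightarrow> holds S e \<and> (i = a \<longleftrightarrow> sat M E (mix e m) p)" for i e
  have "Dfp (\<lambda>e. sat M E (mix e m) p)" unfolding Dfp_def by blast
  then have "Dfp (\<lambda>g. H (g 0) (\<lambda>k. g (Suc k)))"
    unfolding H_def using a(1) assms by (intro dfp Dfp_Suc[of "\<lambda>e. sat M E (mix e m) p"] Dfp_Suc Dfp_holds) (simp add: Con_def)
  moreover have "\<exists>i\<in>M. i \<epsilon> ab \<and> H i e" if "holds S e" for e
    using that a(1) b(1) ab(2) neq unfolding H_def by metis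
  ultimately obtain i where i: "i \<in> M" "large (pairs (H i))"
    using large_pairs_pigeonhole[of H ab "holds S"] ab(1) assms unfolding Con_def by blast
  show ?thesis
  proof (cases "i = a")
    case True
    have "H i = holds (insert p S)" by (rule HOL.ext) (auto simp: H_def True)
    then show ?thesis using i assms by (auto simp: Con_def)
  next
    case False
    have "H i = holds (insert (Neg p) S)" by (rule HOL.ext) (auto simp: H_def False)
    then show ?thesis using i assms by (auto simp: Con_def)
  qed
qed

text \<open>The class of pairs does not shrink: a variable not free in \<open>S\<close> can be
  assigned a counterexample that exists in \<open>M\<close>, separately for each pair.\<close>

lemma Con_witness:
  assumes S: "Con S" and p: "Neg (Forall p) \<in> S"
  shows "\<exists>k. Con (insert (Neg (inst k p)) S)"
proof -
  have "finite (\<Union>q\<in>S. fv q)" using S by (auto simp: Con_def)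
  then obtain K where K: "(\<Union>q\<in>S. fv q) \<subseteq> {..<K}" using finite_nat_iff_bounded by blast
  \<comment> \<open>Variable \<open>2 * k\<close> is then fresh for \<open>S\<close>, and entry
    \<open>k\<close> is neither 0 nor 1, so \<open>d\<close> and \<open>c\<close> keep their
    values.\<close>
  define k where "k = Suc (Suc K)"
  have "Con (insert (Neg (inst (2 * k) p)) S)"
  proof (rule Con_mono[OF S])
    show "finite (insert (Neg (inst (2 * k) p)) S)" using S by (simp add: Con_def)
    fix e assume e: "range e \<subseteq> M" "holds S e"
    have "\<not> sat M E (mix e m) (Forall p)" using e(2) p unfolding holds_def by fastforce
    then obtain x where x: "x \<in> M" "\<not> sat M E (case_nat x (mix e m)) p" by auto
    let ?e = "e(k := x)"
    have same: "mix ?e m n = mix e m n" if "n < K" for n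
      using that by (auto simp: mix_def k_def)
    have "sat M E (mix ?e m) q" if q: "q \<in> S" for q
    proof -
      have "sat M E (mix ?e m) q \<longleftrightarrow> sat M E (mix e m) q"
        using K q by (intro sat_cong_fv same) auto
      then show ?thesis using e(2) q by (simp add: holds_def)
    qed
    moreover have "\<not> sat M E (mix ?e m) (inst (2 * k) p)"
    proof -
      have "fv (Neg (Forall p)) \<subseteq> {..<K}" using K p by blast
      then have "fv (Forall p) \<subseteq> {..<K}" by (simp add: Neg_def)
      then have "sat M E (case_nat x (mix ?e m)) p \<longleftrightarrow> sat M E (case_nat x (mix e m)) p"
        by (intro sat_cong_fv) (auto split: nat.split intro!: same)
      then show ?thesis using x by (simp add: sat_inst)
    qed
    ultimately show "\<exists>e'. range e' \<subseteq> M \<and> e' 0 = e 0 \<and> e' 1 = e 1 \<and> holds (insert (Neg (inst (2 * k) p)) S) e'"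
      using e(1) x(1) by (intro exI[of _ ?e]) (auto simp: holds_def k_def)
  qed
  then show ?thesis by blast
qed

text \<open>If variable \<open>k\<close> is a member of the old set \<open>m j\<close> throughout a
  large class, the pigeonhole principle over \<open>m j\<close> fixes its value on a large subclass.
  This keeps new members out of old sets.\<close>

lemma Con_omit:
  assumes S: "Con S"
  shows "Con (insert (Neg (Mem k (Suc (2 * j)))) S) \<or> (\<exists>i. Con (insert (Equal k (Suc (2 * i))) S))"
proof (rule disjCI)
  assume "\<nexists>i. Con (insert (Equal k (Suc (2 * i))) S)"
  note no = this
  show "Con (insert (Neg (Mem k (Suc (2 * j)))) S)"
  proof (rule ccontr)
    assume "\<not> Con (insert (Neg (Mem k (Suc (2 * j)))) S)"
    then have S': "Con (insert (Mem k (Suc (2 * j))) S)" using Con_split[OF S] by blast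
    define H where "H i e \<longleftrightarrow> holds S e \<and> mix e m k = i" for i e
    have "Dfp (\<lambda>g. H (g 0) (\<lambda>k. g (Suc k)))"
    proof -
      have "trm (\<lambda>e. mix e m k)" unfolding trm_def by blast
      from trm_shift[OF this] show ?thesis
        unfolding H_def using S by (intro dfp Dfp_Suc Dfp_holds) (simp_all add: Con_def)
    qed
    moreover have mj: "m j \<in> M" using range_m by blast
    moreover have "\<exists>i\<in>M. i \<epsilon> m j \<and> H i e" if "range e \<subseteq> M" "holds (insert (Mem k (Suc (2 * j))) S) e" for e
    proof -
      have "mix e m k \<in> M" using that(1) range_m' range_mix[of e m M] by blast
      then show ?thesis using that(2) by (intro bexI[of _ "mix e m k"]) (auto simp: H_def)
    qed
    ultimately obtain i where i: "i \<in> M" "large (pairs (H i))"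
      using large_pairs_pigeonhole[of H "m j" "holds (insert (Mem k (Suc (2 * j))) S)"] S'
      unfolding Con_def by blast
    obtain n where n: "i = m n" using i range_m by blast
    have "H i = holds (insert (Equal k (Suc (2 * n))) S)"
      by (rule HOL.ext) (auto simp: H_def n)
    then show False using i S no by (auto simp: Con_def)
  qed
qed

lemma Con_above:
  assumes S: "Con S"
  shows "Con (insert (Mem (Suc (2 * j)) 2) S)"
proof -
  have "m j \<in> M" using range_m by blast
  then have "large (\<lambda>d c. pairs (holds S) d c \<and> m j \<epsilon> c)"
    using S large_mem unfolding Con_def by blast
  moreover have "mix e m 2 = e 1" for e using mix_simps(1)[of e m 1] by simp
  ultimately have "large (pairs (holds (insert (Mem (Suc (2 * j)) 2) S)))"
    by (elim large_mono) (auto simp: pairs_def)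
  then show ?thesis using S by (simp add: Con_def)
qed

text \<open>At some old element a condition leaves both possibilities open, so it can be extended to
  contradict any one given trace.\<close>

lemma Con_trace:
  assumes S: "Con S"
  shows "\<exists>j. Con (insert (Mem (Suc (2 * j)) 0) S) \<and> Con (insert (Neg (Mem (Suc (2 * j)) 0)) S)"
proof -
  obtain x where x: "x \<in> M" "large (\<lambda>d c. pairs (holds S) d c \<and> x \<epsilon> d)"
    "large (\<lambda>d c. pairs (holds S) d c \<and> \<not> x \<epsilon> d)"
    using S large_split unfolding Con_def by blast
  obtain j where j: "x = m j" using x range_m by blast
  have mix0: "mix e m 0 = e 0" for e by (simp add: mix_def)
  have "large (pairs (holds (insert (Mem (Suc (2 * j)) 0) S)))"
    by (rule large_mono[OF x(2)]) (auto simp: pairs_def j mix0)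
  moreover have "large (pairs (holds (insert (Neg (Mem (Suc (2 * j)) 0)) S)))"
    by (rule large_mono[OF x(3)]) (auto simp: pairs_def j mix0)
  ultimately show ?thesis using S by (auto simp: Con_def)
qed

lemma end_extension_exists:
  assumes Y: "countable Y"
  obtains N :: "nat set" and E' :: "nat rel" and h c d where
    "E' \<subseteq> N \<times> N" "h ` M \<subseteq> N"
    "\<And>p v. range v \<subseteq> M \<Longrightarrow> sat M E v p \<longleftrightarrow> sat N E' (\<lambda>n. h (v n)) p"
    "\<And>a b. a \<in> M \<Longrightarrow> (b, h a) \<in> E' \<Longrightarrow> b \<in> h ` M"
    "c \<in> N" "\<And>x. x \<in> M \<Longrightarrow> (h x, c) \<in> E'"
    "d \<in> N" "{x \<in> M. (h x, d) \<in> E'} \<notin> Y"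
proof -
  \<comment> \<open>\<open>T1\<close> makes members of old elements old, \<open>T2\<close> puts
    every old element into the value of variable 2, and \<open>T3\<close> separates the trace of
    variable 0 from \<open>y\<close>.\<close>
  define T1 where "T1 k j S \<longleftrightarrow> Neg (Mem k (Suc (2 * j))) \<in> S \<or> (\<exists>i. Equal k (Suc (2 * i)) \<in> S)" for k j S
  define T2 where "T2 j S \<longleftrightarrow> Mem (Suc (2 * j)) 2 \<in> S" for j S
  define T3 where "T3 y S \<longleftrightarrow> (\<exists>j. Mem (Suc (2 * j)) 0 \<in> S \<and> m j \<notin> y) \<or>
     (\<exists>j. Neg (Mem (Suc (2 * j)) 0) \<in> S \<and> m j \<in> y)" for y S
  define T where "T = range (case_prod T1) \<union> range T2 \<union> T3 ` Y"
  have cT: "countable T" unfolding T_def using Y by simp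
  have dense: "\<exists>S'. S \<subseteq> S' \<and> Con S' \<and> t S'" if t: "t \<in> T" and S: "Con S" for t S
  proof -
    from t consider k j where "t = T1 k j" | j where "t = T2 j" | y where "t = T3 y" by (auto simp: T_def)
    then show ?thesis
    proof cases
      case 1
      then show ?thesis using Con_omit[OF S, of k j] unfolding T1_def by blast
    next
      case 2
      then show ?thesis using Con_above[OF S, of j] unfolding T2_def by blast
    next
      case (3 y)
      obtain j where j: "Con (insert (Mem (Suc (2 * j)) 0) S)" "Con (insert (Neg (Mem (Suc (2 * j)) 0)) S)"
        using Con_trace[OF S] by blast
      then show ?thesis unfolding 3 T3_def by (cases "m j \<in> y") blast+
    qed
  qed
  have cons: "consistent S" if "Con S" for S
    using Con_satisfiable[OF that] satisfiable_consistent[of "mix _ m" M S E] range_m'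
    unfolding holds_def range_mix by blast
  obtain G where G: "henkin_set G" and fin: "\<And>F. finite F \<Longrightarrow> F \<subseteq> G \<Longrightarrow> \<exists>S'. F \<subseteq> S' \<and> Con S'"
    and meets: "\<And>t. t \<in> T \<Longrightarrow> \<exists>S'. S' \<subseteq> G \<and> Con S' \<and> t S'"
  proof (rule henkin_generic[of Con "{}" T])
    show "\<exists>S'. S \<subseteq> S' \<and> Con S' \<and> t S'" if "t \<in> T" "Con S" for t S by (rule dense[OF that])
    show "\<exists>k. Con (insert (Neg (inst k p)) S)" if "Con S" "Neg (Forall p) \<in> S" for S p
      by (rule Con_witness[OF that])
  qed (simp_all add: Con_empty cT cons Con_split)
  interpret henkin_set G by (rule G)
  define idx where "idx x = Suc (2 * (SOME n. m n = x))" for x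
  have m_idx: "mix e m (idx x) = x" if "x \<in> M" for x e
  proof -
    have "\<exists>n. m n = x" using that range_m by blast
    then have "m (SOME n. m n = x) = x" by (rule someI_ex)
    then show ?thesis by (simp add: idx_def)
  qed
  \<comment> \<open>The renamed formula speaks of parameters only, so every environment satisfying a
    condition that contains it gives it its truth value in \<open>M\<close>. Applied to
    \<open>p\<close> and \<open>Neg p\<close>, this gives elementarity.\<close>
  have sat_G: "sat M E v p \<longleftrightarrow> rename (\<lambda>n. idx (v n)) p \<in> G" if v: "range v \<subseteq> M" for v p
  proof -
    have eq: "sat M E (mix e m) (rename (\<lambda>n. idx (v n)) p) \<longleftrightarrow> sat M E v p" for e p
      using v by (simp add: sat_rename m_idx image_subset_iff)
    have "sat M E v q" if q: "rename (\<lambda>n. idx (v n)) q \<in> G" for q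
    proof -
      obtain S where S: "rename (\<lambda>n. idx (v n)) q \<in> S" "Con S"
        using fin[of "{rename (\<lambda>n. idx (v n)) q}"] q by auto
      then obtain e where "holds S e" using Con_satisfiable by blast
      then show ?thesis using S eq unfolding holds_def by blast
    qed
    from this[of p] this[of "Neg p"] show ?thesis using Neg by auto
  qed
  define h where "h x = rep (idx x)" for x
  have rep_odd: "rep (Suc (2 * j)) = h (m j)" for j
  proof -
    have mj: "m j \<in> M" using range_m by blast
    have "Neg (Equal (Suc (2 * j)) (idx (m j))) \<notin> G"
    proof
      assume "Neg (Equal (Suc (2 * j)) (idx (m j))) \<in> G"
      then obtain S where S: "Neg (Equal (Suc (2 * j)) (idx (m j))) \<in> S" "Con S"
        using fin[of "{Neg (Equal (Suc (2 * j)) (idx (m j)))}"] by auto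
      then obtain e where "holds S e" using Con_satisfiable by blast
      then have "\<not> sat M E (mix e m) (Equal (Suc (2 * j)) (idx (m j)))"
        using S(1) unfolding holds_def by fastforce
      then show False using m_idx[OF mj, of e] by simp
    qed
    then show ?thesis using Neg by (simp add: h_def rep_eq_iff)
  qed
  have h_cases: "\<exists>j. x = m j" if "x \<in> M" for x using that range_m by blast
  show thesis
  proof (rule that[of rel dom h "rep 2" "rep 0"])
    show "rel \<subseteq> dom \<times> dom" by (rule rel_subset)
    show "h ` M \<subseteq> dom" by (auto simp: h_def dom_def)
    show "sat M E v p \<longleftrightarrow> sat dom rel (\<lambda>n. h (v n)) p" if "range v \<subseteq> M" for v p
      using sat_G[OF that, of p] truth[of "\<lambda>n. idx (v n)" p] by (simp add: h_def)
    show "b \<in> h ` M" if a: "a \<in> M" and b: "(b, h a) \<in> rel" for a b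
    proof -
      obtain k where k: "b = rep k" using b rel_subset by (auto simp: dom_def)
      obtain j where j: "a = m j" using h_cases a by blast
      have memG: "Mem k (Suc (2 * j)) \<in> G" using b rel_iff[of k "Suc (2 * j)"] by (simp add: k j rep_odd)
      have "T1 k j \<in> T" unfolding T_def by (auto intro!: image_eqI[of _ _ "(k, j)"])
      then obtain S where "S \<subseteq> G" "T1 k j S" using meets by blast
      then obtain i where "Equal k (Suc (2 * i)) \<in> G" using memG Neg unfolding T1_def by blast
      then have "b = h (m i)" using k rep_eq_iff rep_odd by metis
      then show ?thesis using range_m by blast
    qed
    show "rep 2 \<in> dom" "rep 0 \<in> dom" by (auto simp: dom_def)
    show "(h x, rep 2) \<in> rel" if x: "x \<in> M" for x
    proof -
      obtain j where j: "x = m j" using h_cases[OF x] by blast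
      have "T2 j \<in> T" by (auto simp: T_def)
      then have "Mem (Suc (2 * j)) 2 \<in> G" using meets unfolding T2_def by blast
      then show ?thesis using rel_iff[of "Suc (2 * j)" 2] by (simp add: rep_odd j)
    qed
    show "{x \<in> M. (h x, rep 0) \<in> rel} \<notin> Y"
    proof
      assume "{x \<in> M. (h x, rep 0) \<in> rel} \<in> Y" (is "?y \<in> Y")
      then have "T3 ?y \<in> T" by (simp add: T_def)
      then obtain S where S: "S \<subseteq> G" "T3 ?y S" using meets by blast
      have iff: "m j \<in> ?y \<longleftrightarrow> Mem (Suc (2 * j)) 0 \<in> G" for j
        using rel_iff[of "Suc (2 * j)" 0] range_m by (auto simp: rep_odd)
      show False using S Neg unfolding T3_def iff by blast
    qed
  qed
qed

end

section \<open>Elementary end extensions of structures on a common type\<close>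

type_synonym 'a struct = "'a set \<times> 'a rel"

text \<open>\<open>collects\<close> as a scheme of formulas, so that it passes to elementary
  extensions.\<close>

definition Collection :: "fm \<Rightarrow> fm" where
  "Collection p =
     Forall (Implies
       (Forall (Implies (Mem 0 1) (Exists (rename (case_nat 0 (case_nat 1 (\<lambda>n. n + 3))) p))))
       (Exists (Forall (Implies (Mem 0 2)
          (Exists (Conj (Mem 0 2) (rename (case_nat 0 (case_nat 1 (\<lambda>n. n + 4))) p)))))))"

lemma sat_Collection:
  "sat M E v (Collection p) \<longleftrightarrow> (\<forall>a\<in>M.
     (\<forall>x\<in>M. (x, a) \<in> E \<longrightarrow> (\<exists>y\<in>M. sat M E (case_nat y (case_nat x v)) p)) \<longrightarrow>
     (\<exists>b\<in>M. \<forall>x\<in>M. (x, a) \<in> E \<longrightarrow> (\<exists>y\<in>M. (y, b) \<in> E \<and> sat M E (case_nat y (case_nat x v)) p)))"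
proof -
  have "(\<lambda>n. case_nat y (case_nat x (case_nat a v)) (case_nat 0 (case_nat 1 (\<lambda>n. n + 3)) n))
      = case_nat y (case_nat x v)" for x y a
    by (auto split: nat.split simp: numeral_eq_Suc)
  moreover have "(\<lambda>n. case_nat y (case_nat x (case_nat b (case_nat a v)))
      (case_nat 0 (case_nat 1 (\<lambda>n. n + 4)) n)) = case_nat y (case_nat x v)" for x y a b
    by (auto split: nat.split simp: numeral_eq_Suc)
  ultimately show ?thesis
    by (simp only: Collection_def sat_rename sat_connectives sat.simps nat.case One_nat_def
        numeral_2_eq_2)
qed

lemma collects_iff: "collects M E \<longleftrightarrow> (\<forall>p. valid M E (Collection p))"
  unfolding collects_def valid_def sat_Collection by blast

definition end_ext :: "'a struct \<Rightarrow> 'a struct \<Rightarrow> bool" where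
  "end_ext s t \<longleftrightarrow> fst s \<subseteq> fst t \<and>
     (\<forall>p v. range v \<subseteq> fst s \<longrightarrow> (sat (fst s) (snd s) v p \<longleftrightarrow> sat (fst t) (snd t) v p)) \<and>
     (\<forall>a\<in>fst s. \<forall>b. (b, a) \<in> snd t \<longrightarrow> b \<in> fst s)"

definition good :: "'a struct \<Rightarrow> bool" where
  "good s \<longleftrightarrow> snd s \<subseteq> fst s \<times> fst s \<and> models (fst s) (snd s) ZFC \<and> collects (fst s) (snd s)"

lemma end_ext_subset: "end_ext s t \<Longrightarrow> fst s \<subseteq> fst t"
  by (simp add: end_ext_def)

lemma end_ext_sat: "end_ext s t \<Longrightarrow> range v \<subseteq> fst s \<Longrightarrow>
    sat (fst s) (snd s) v p \<longleftrightarrow> sat (fst t) (snd t) v p"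
  by (simp add: end_ext_def)

lemma end_ext_mem: "end_ext s t \<Longrightarrow> a \<in> fst s \<Longrightarrow> b \<in> fst s \<Longrightarrow> (a, b) \<in> snd s \<longleftrightarrow> (a, b) \<in> snd t"
  using end_ext_sat[of s t "case_nat a (\<lambda>_. b)" "Mem 0 1"] by auto

lemma end_ext_end: "end_ext s t \<Longrightarrow> a \<in> fst s \<Longrightarrow> (b, a) \<in> snd t \<Longrightarrow> b \<in> fst s"
  by (auto simp: end_ext_def)

lemma end_ext_refl: "snd s \<subseteq> fst s \<times> fst s \<Longrightarrow> end_ext s s"
  by (auto simp: end_ext_def)

lemma end_ext_trans:
  assumes st: "end_ext s t" and tu: "end_ext t u" shows "end_ext s u"
proof -
  have sub: "fst s \<subseteq> fst t" "fst t \<subseteq> fst u" using assms by (auto simp: end_ext_def)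
  have "sat (fst s) (snd s) v p \<longleftrightarrow> sat (fst u) (snd u) v p" if v: "range v \<subseteq> fst s" for v p
    using end_ext_sat[OF st v] end_ext_sat[OF tu, of v] v sub by blast
  moreover have "b \<in> fst s" if a: "a \<in> fst s" and b: "(b, a) \<in> snd u" for a b
  proof -
    have a': "a \<in> fst t" using a sub by blast
    have b': "b \<in> fst t" using end_ext_end[OF tu a' b] .
    show ?thesis using end_ext_end[OF st a] end_ext_mem[OF tu b' a'] b by blast
  qed
  ultimately show ?thesis using sub by (simp add: end_ext_def)
qed

lemma valid_end_ext:
  assumes st: "end_ext s t" and ne: "fst s \<noteq> {}" and p: "valid (fst s) (snd s) p"
  shows "valid (fst t) (snd t) p"
proof -
  obtain n where n: "fv ((Forall ^^ n) p) = {}" using ex_closure by blast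
  obtain a where a: "a \<in> fst s" using ne by blast
  have "sat (fst s) (snd s) (\<lambda>_. a) ((Forall ^^ n) p)"
    using p valid_Forall_pow[of "fst s" "snd s" n p] a by (auto simp: valid_def)
  then have "sat (fst t) (snd t) (\<lambda>_. a) ((Forall ^^ n) p)"
    using end_ext_sat[OF st, of "\<lambda>_. a"] a by blast
  then have "sat (fst t) (snd t) v ((Forall ^^ n) p)" for v
    using sat_cong_fv[of "(Forall ^^ n) p" v "\<lambda>_. a"] n by simp
  then show ?thesis
    using valid_Forall_pow[of "fst t" "snd t" n p] by (simp add: valid_def)
qed

lemma good_end_ext:
  assumes st: "end_ext s t" and s: "good s" and t: "snd t \<subseteq> fst t \<times> fst t"
  shows "good t"
proof -
  have ne: "fst s \<noteq> {}" using s by (auto simp: good_def models_def)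
  then have "fst t \<noteq> {}" using end_ext_subset[OF st] by blast
  moreover have "valid (fst t) (snd t) p" if "valid (fst s) (snd s) p" for p
    using valid_end_ext[OF st ne that] .
  ultimately show ?thesis
    using s t unfolding good_def collects_iff models_ZFC_iff by blast
qed

lemma sat_iso:
  assumes g: "inj_on g N" and E: "E \<subseteq> N \<times> N"
  shows "range v \<subseteq> N \<Longrightarrow> sat (g ` N) (map_prod g g ` E) (\<lambda>n. g (v n)) p \<longleftrightarrow> sat N E v p"
proof (induction p arbitrary: v)
  case (Mem i j)
  have "v i \<in> N" "v j \<in> N" using Mem by auto
  moreover have "inj_on (map_prod g g) (N \<times> N)" using g by (simp add: map_prod_inj_on)
  ultimately have "map_prod g g (v i, v j) \<in> map_prod g g ` E \<longleftrightarrow> (v i, v j) \<in> E"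
    using E by (intro inj_on_image_mem_iff) auto
  then show ?case by simp
next
  case (Equal i j)
  have "v i \<in> N" "v j \<in> N" using Equal by auto
  then show ?case using inj_onD[OF g] by auto
next
  case (Forall p)
  have "(\<lambda>n. g (case_nat a v n)) = case_nat (g a) (\<lambda>n. g (v n))" for a
    by (auto split: nat.split)
  then have "sat (g ` N) (map_prod g g ` E) (case_nat (g a) (\<lambda>n. g (v n))) p \<longleftrightarrow> sat N E (case_nat a v) p"
    if "a \<in> N" for a
    using Forall.IH[of "case_nat a v"] Forall.prems that by simp
  then show ?case by simp
qed auto

text \<open>The generic model consists of variables. Its copy has to contain the old carrier
  literally, so that the stages of the tree can be united; the new elements are sent into the
  complement.\<close>

lemma relocate:
  fixes N0 :: "nat set" and M :: "'a set"
  assumes h: "inj_on h M" "h ` M \<subseteq> N0" and M: "infinite (- M)" and E0: "E0 \<subseteq> N0 \<times> N0"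
  obtains g :: "nat \<Rightarrow> 'a" where "inj_on g N0" "\<And>x. x \<in> M \<Longrightarrow> g (h x) = x"
proof -
  obtain k :: "nat \<Rightarrow> 'a" where k: "inj k" "range k \<subseteq> - M"
    using infinite_countable_subset[OF M] by blast
  define g where "g y = (if y \<in> h ` M then inv_into M h y else k y)" for y
  have gh: "g (h x) = x" if "x \<in> M" for x using that h(1) by (simp add: g_def)
  have "inj_on g N0"
  proof (rule inj_onI)
    fix y z assume eq: "g y = g z"
    have in_M: "g u \<in> M \<longleftrightarrow> u \<in> h ` M" for u
      using k(2) gh by (auto simp: g_def)
    show "y = z"
    proof (cases "y \<in> h ` M")
      case True
      then show ?thesis using in_M[of y] in_M[of z] eq gh by auto
    next
      case False
      then have "z \<notin> h ` M" using in_M[of y] in_M[of z] eq by simp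
      then show ?thesis using False eq injD[OF k(1)] by (simp add: g_def)
    qed
  qed
  then show ?thesis using gh that by blast
qed

lemma countable_good_zfc_model:
  assumes "good s" "countable (fst s)"
  shows "zfc_coll_model (fst s) (snd s) (from_nat_into (fst s))"
proof
  show "models (fst s) (snd s) ZFC" "collects (fst s) (snd s)" using assms by (auto simp: good_def)
  then show "range (from_nat_into (fst s)) = fst s"
    using assms by (intro range_from_nat_into) (auto simp: models_def)
qed

definition extends :: "'a struct \<Rightarrow> 'a set set \<Rightarrow> 'a struct \<Rightarrow> bool" where
  "extends s Y t \<longleftrightarrow> good t \<and> countable (fst t) \<and> end_ext s t \<and>
     (\<exists>c\<in>fst t. \<forall>x\<in>fst s. (x, c) \<in> snd t) \<and>
     (\<exists>d\<in>fst t. {x \<in> fst s. (x, d) \<in> snd t} \<notin> Y)"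

lemma extends_exists:
  fixes s :: "'a struct"
  assumes s: "good s" "countable (fst s)" and Y: "countable Y" and inf: "infinite (- fst s)"
  shows "\<exists>t. extends s Y t"
proof -
  interpret zfc_coll_model "fst s" "snd s" "from_nat_into (fst s)"
    using s by (rule countable_good_zfc_model)
  obtain N :: "nat set" and E' h c d where N: "E' \<subseteq> N \<times> N" "h ` fst s \<subseteq> N"
    and elem: "\<And>p v. range v \<subseteq> fst s \<Longrightarrow> sat (fst s) (snd s) v p \<longleftrightarrow> sat N E' (\<lambda>n. h (v n)) p"
    and ends: "\<And>a b. a \<in> fst s \<Longrightarrow> (b, h a) \<in> E' \<Longrightarrow> b \<in> h ` fst s"
    and c: "c \<in> N" "\<And>x. x \<in> fst s \<Longrightarrow> (h x, c) \<in> E'"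
    and d: "d \<in> N" "{x \<in> fst s. (h x, d) \<in> E'} \<notin> Y"
    by (rule end_extension_exists[OF Y]) (rule that; assumption)
  have "inj_on h (fst s)"
  proof (rule inj_onI)
    fix x y assume xy: "x \<in> fst s" "y \<in> fst s" "h x = h y"
    then show "x = y" using elem[of "case_nat x (\<lambda>_. y)" "Equal 0 1"] by auto
  qed
  then obtain g :: "nat \<Rightarrow> 'a" where g: "inj_on g N" "\<And>x. x \<in> fst s \<Longrightarrow> g (h x) = x"
    using relocate[OF _ N(2) inf N(1)] by blast
  define t where "t = (g ` N, map_prod g g ` E')"
  have hN: "h x \<in> N" if "x \<in> fst s" for x using that N(2) by blast
  have mem: "(x, g y) \<in> snd t \<longleftrightarrow> (h x, y) \<in> E'" if "x \<in> fst s" "y \<in> N" for x y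
  proof -
    have "(g (h x), g y) \<in> map_prod g g ` E' \<longleftrightarrow> (h x, y) \<in> E'"
      using sat_iso[OF g(1) N(1), of "case_nat (h x) (\<lambda>_. y)" "Mem 0 1"] hN that by auto
    then show ?thesis using g(2) that by (simp add: t_def)
  qed
  have sub: "fst s \<subseteq> fst t"
  proof
    fix x assume "x \<in> fst s"
    then show "x \<in> fst t" using g(2)[of x] hN[of x] unfolding t_def by (metis fst_conv imageI)
  qed
  have "sat (fst s) (snd s) v p \<longleftrightarrow> sat (fst t) (snd t) v p" if v: "range v \<subseteq> fst s" for v p
  proof -
    have "(\<lambda>n. g (h (v n))) = v" using v g(2) by (auto simp: image_subset_iff)
    moreover have "range (\<lambda>n. h (v n)) \<subseteq> N" using v N(2) by blast
    ultimately show ?thesis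
      using elem[OF v, of p] sat_iso[OF g(1) N(1), of "\<lambda>n. h (v n)" p] by (simp add: t_def)
  qed
  moreover have "b \<in> fst s" if a: "a \<in> fst s" and b: "(b, a) \<in> snd t" for a b
  proof -
    obtain y z where yz: "(y, z) \<in> E'" "b = g y" "a = g z" using b by (auto simp: t_def)
    then have "g z = g (h a)" using g(2) a by simp
    then have "z = h a" using inj_onD[OF g(1)] yz N(1) hN a by blast
    then obtain x where "x \<in> fst s" "y = h x" using ends a yz by blast
    then show ?thesis using g(2) yz by simp
  qed
  ultimately have ext: "end_ext s t" using sub by (simp add: end_ext_def)
  moreover have "snd t \<subseteq> fst t \<times> fst t" using N(1) by (auto simp: t_def)
  ultimately have "good t" using good_end_ext s by blast
  moreover have "g c \<in> fst t" "\<forall>x\<in>fst s. (x, g c) \<in> snd t" using c mem by (auto simp: t_def)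
  moreover have "g d \<in> fst t" using d by (simp add: t_def)
  moreover have "{x \<in> fst s. (x, g d) \<in> snd t} \<notin> Y"
  proof -
    have "{x \<in> fst s. (x, g d) \<in> snd t} = {x \<in> fst s. (h x, d) \<in> E'}" using mem d(1) by blast
    then show ?thesis using d(2) by simp
  qed
  moreover have "countable (fst t)" by (simp add: t_def)
  ultimately show ?thesis using ext unfolding extends_def by blast
qed

section \<open>Unions of chains, and inclusion and traces in end extensions\<close>

definition Union_struct :: "'a struct set \<Rightarrow> 'a struct" where
  "Union_struct F = (\<Union>(fst ` F), \<Union>(snd ` F))"

text \<open>Tarski's elementary chain theorem. The induction on formulas treats all members of the
  chain together, since the value of a bound variable may first occur in a larger member.\<close>

lemma end_ext_Union:
  assumes lin: "\<And>s t. s \<in> F \<Longrightarrow> t \<in> F \<Longrightarrow> end_ext s t \<or> end_ext t s"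
    and sub: "\<And>s. s \<in> F \<Longrightarrow> snd s \<subseteq> fst s \<times> fst s" and s: "s \<in> F"
  shows "end_ext s (Union_struct F)"
proof -
  let ?U = "Union_struct F"
  have mem: "(a, b) \<in> snd t \<longleftrightarrow> (a, b) \<in> snd ?U" if t: "t \<in> F" "a \<in> fst t" "b \<in> fst t" for t a b
  proof
    assume "(a, b) \<in> snd ?U"
    then obtain u where u: "u \<in> F" "(a, b) \<in> snd u" by (auto simp: Union_struct_def)
    have "a \<in> fst u" "b \<in> fst u" using sub u by blast+
    then have "(a, b) \<in> snd t \<longleftrightarrow> (a, b) \<in> snd u"
      using lin[OF t(1) u(1)] end_ext_mem[of t u a b] end_ext_mem[of u t a b] t by auto
    then show "(a, b) \<in> snd t" using u(2) by simp
  qed (use t in \<open>auto simp: Union_struct_def\<close>)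
  have elem: "s \<in> F \<Longrightarrow> range v \<subseteq> fst s \<Longrightarrow>
      sat (fst s) (snd s) v p \<longleftrightarrow> sat (fst ?U) (snd ?U) v p" for s v p
  proof (induction p arbitrary: s v)
    case (Mem i j)
    then show ?case using mem[of s "v i" "v j"] by (simp add: image_subset_iff)
  next
    case (Implies p q)
    show ?case using Implies.IH(1)[of s v] Implies.IH(2)[of s v] Implies.prems by simp
  next
    case (Forall p)
    show ?case
    proof
      assume L: "sat (fst s) (snd s) v (Forall p)"
      show "sat (fst ?U) (snd ?U) v (Forall p)"
        unfolding sat.simps
      proof
        fix a assume "a \<in> fst ?U"
        then obtain t where t: "t \<in> F" "a \<in> fst t" by (auto simp: Union_struct_def)
        consider "end_ext s t" | "end_ext t s" using lin[OF Forall.prems(1) t(1)] by blast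
        then show "sat (fst ?U) (snd ?U) (case_nat a v) p"
        proof cases
          case 1
          then have v: "range v \<subseteq> fst t" using Forall.prems(2) end_ext_subset by blast
          have "sat (fst t) (snd t) v (Forall p)" using end_ext_sat[OF 1 Forall.prems(2)] L by blast
          then have "sat (fst t) (snd t) (case_nat a v) p" using t by simp
          then show ?thesis using Forall.IH[OF t(1), of "case_nat a v"] v t by simp
        next
          case 2
          then have a: "a \<in> fst s" using t end_ext_subset by blast
          then have "sat (fst s) (snd s) (case_nat a v) p" using L by simp
          then show ?thesis using Forall.IH[OF Forall.prems(1), of "case_nat a v"] a Forall.prems(2) by simp
        qed
      qed
    next
      assume R: "sat (fst ?U) (snd ?U) v (Forall p)"
      have "fst s \<subseteq> fst ?U" using Forall.prems(1) by (auto simp: Union_struct_def)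
      then have "sat (fst s) (snd s) (case_nat a v) p" if "a \<in> fst s" for a
        using Forall.IH[OF Forall.prems(1), of "case_nat a v"] that Forall.prems(2) R by auto
      then show "sat (fst s) (snd s) v (Forall p)" by simp
    qed
  qed auto
  have "b \<in> fst s" if a: "a \<in> fst s" and b: "(b, a) \<in> snd ?U" for a b
  proof -
    obtain u where u: "u \<in> F" "(b, a) \<in> snd u" using b by (auto simp: Union_struct_def)
    have "b \<in> fst u" using sub u by blast
    then show ?thesis using lin[OF s u(1)] end_ext_subset[of u s] end_ext_end[of s u a b] a u(2) by blast
  qed
  moreover have "fst s \<subseteq> fst ?U" using s by (auto simp: Union_struct_def)
  ultimately show ?thesis using elem[OF s] by (simp add: end_ext_def)
qed

lemma Union_struct_subset:
  "(\<And>s. s \<in> F \<Longrightarrow> snd s \<subseteq> fst s \<times> fst s) \<Longrightarrow> snd (Union_struct F) \<subseteq> fst (Union_struct F) \<times> fst (Union_struct F)"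
proof
  assume sub: "\<And>s. s \<in> F \<Longrightarrow> snd s \<subseteq> fst s \<times> fst s"
  fix x assume "x \<in> snd (Union_struct F)"
  then obtain s where s: "s \<in> F" "x \<in> snd s" by (auto simp: Union_struct_def)
  then have "x \<in> fst s \<times> fst s" using sub by blast
  then show "x \<in> fst (Union_struct F) \<times> fst (Union_struct F)"
    using s(1) by (auto simp: Union_struct_def)
qed

lemma inclusion_end_ext:
  assumes "end_ext s t" "a \<in> fst s" "b \<in> fst s"
  shows "(a, b) \<in> inclusion (fst s) (snd s) \<longleftrightarrow> (a, b) \<in> inclusion (fst t) (snd t)"
proof -
  have "c \<in> fst s" if "(c, a) \<in> snd t" for c using end_ext_end[OF assms(1,2) that] .
  moreover have "(c, a) \<in> snd s \<longleftrightarrow> (c, a) \<in> snd t" "(c, b) \<in> snd s \<longleftrightarrow> (c, b) \<in> snd t" if "c \<in> fst s" for c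
    using end_ext_mem[OF assms(1) that] assms(2,3) by blast+
  ultimately show ?thesis
    using assms(2,3) end_ext_subset[OF assms(1)] unfolding inclusion_def by blast
qed

text \<open>Subsets of an old set \<open>c\<close> are old, because the power set of \<open>c\<close> is.\<close>

lemma end_ext_trace:
  assumes st: "end_ext s t" and s: "good s" "countable (fst s)" and t: "good t" "countable (fst t)"
    and c: "c \<in> fst s" and e: "e \<in> fst t"
  shows "\<exists>e'\<in>fst s. \<forall>z\<in>fst t. (z, e') \<in> snd t \<longleftrightarrow> (z, e) \<in> snd t \<and> (z, c) \<in> snd t"
proof -
  interpret S: zfc_coll_model "fst s" "snd s" "from_nat_into (fst s)" using s by (rule countable_good_zfc_model)
  interpret T: zfc_coll_model "fst t" "snd t" "from_nat_into (fst t)" using t by (rule countable_good_zfc_model)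
  have ct: "c \<in> fst t" using c end_ext_subset[OF st] by blast
  have "T.Dfp (\<lambda>v. (v 0, c) \<in> snd t)" using ct by (intro T.dfp)
  then obtain e' where e': "e' \<in> fst t" "\<And>z. z \<in> fst t \<Longrightarrow> (z, e') \<in> snd t \<longleftrightarrow> (z, e) \<in> snd t \<and> (z, c) \<in> snd t"
    using T.separation[of "\<lambda>z. (z, c) \<in> snd t" e] e by blast
  obtain p where p: "p \<in> fst s"
    "\<forall>z\<in>fst s. (z, p) \<in> snd s \<longleftrightarrow> (\<forall>w\<in>fst s. (w, z) \<in> snd s \<longrightarrow> (w, c) \<in> snd s)"
    using S.power[OF c] by blast
  \<comment> \<open>The matrix of \<open>Power_set\<close>: elementarity carries over to
    \<open>t\<close> that \<open>p\<close> is the power set of \<open>c\<close>, and then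
    \<open>e'\<close> is a member of the old element \<open>p\<close>.\<close>
  define q where "q = Forall (Iff (Mem 0 1) (Forall (Implies (Mem 0 1) (Mem 0 3))))"
  have q: "sat M E (case_nat p (\<lambda>_. c)) q \<longleftrightarrow>
      (\<forall>z\<in>M. (z, p) \<in> E \<longleftrightarrow> (\<forall>w\<in>M. (w, z) \<in> E \<longrightarrow> (w, c) \<in> E))" for M E
    by (simp only: q_def sat_connectives sat.simps nat.case One_nat_def numeral_3_eq_3)
  have "sat (fst s) (snd s) (case_nat p (\<lambda>_. c)) q" unfolding q using p(2) .
  then have "sat (fst t) (snd t) (case_nat p (\<lambda>_. c)) q"
    using end_ext_sat[OF st, of "case_nat p (\<lambda>_. c)"] p(1) c by (auto simp del: sat.simps)
  then have "(e', p) \<in> snd t" unfolding q using e' by blast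
  then have "e' \<in> fst s" using end_ext_end[OF st p(1)] by blast
  then show ?thesis using e'(2) by blast
qed

subsection \<open>Closure points in \<open>\<omega>\<^sub>1\<close>\<close>

lemma countable_atMost_omega1: "countable {..\<alpha> :: omega1}"
proof -
  have "{..\<alpha>} = insert \<alpha> {..<\<alpha>}" by auto
  then show ?thesis using countable_lessThan_omega1 by simp
qed

lemma countable_bounded_omega1:
  assumes "countable (S :: omega1 set)"
  shows "\<exists>\<sigma>. \<forall>s\<in>S. s < \<sigma>"
proof (rule ccontr)
  assume "\<not> ?thesis"
  then have "UNIV = (\<Union>s\<in>S. {..s})" by (auto simp: not_less)
  moreover have "countable (\<Union>s\<in>S. {..s})" using assms countable_atMost_omega1 by blast
  ultimately show False using uncountable_omega1 by simp
qed

text \<open>The values at arguments up to \<xi> are countably many, hence bounded by some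
  \<open>h \<xi>\<close>. The supremum of the iterates of \<open>h\<close> is a closure
  point.\<close>

lemma club_closure_points:
  fixes g :: "nat \<Rightarrow> omega1 \<Rightarrow> omega1 \<Rightarrow> omega1"
  shows "club {\<alpha>. \<delta> < \<alpha> \<and> (\<forall>\<beta><\<alpha>. \<forall>\<gamma><\<alpha>. \<forall>k. g k \<beta> \<gamma> < \<alpha>)}" (is "club ?C")
proof -
  have "\<exists>\<sigma>. \<forall>s\<in>(\<lambda>(k, \<beta>, \<gamma>). g k \<beta> \<gamma>) ` (UNIV \<times> {..\<xi>} \<times> {..\<xi>}) \<union> {\<xi>}. s < \<sigma>" for \<xi>
    by (intro countable_bounded_omega1) (auto intro!: countable_SIGMA countable_atMost_omega1)
  then obtain h where h: "\<And>\<xi> s. s \<in> (\<lambda>(k, \<beta>, \<gamma>). g k \<beta> \<gamma>) ` (UNIV \<times> {..\<xi>} \<times> {..\<xi>}) \<union> {\<xi>} \<Longrightarrow> s < h \<xi>"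
    by metis
  have hg: "g k \<beta> \<gamma> < h \<xi>" if "\<beta> \<le> \<xi>" "\<gamma> \<le> \<xi>" for k \<beta> \<gamma> \<xi>
    using that by (intro h) force
  have hx: "\<xi> < h \<xi>" for \<xi> by (rule h) simp
  have unbounded: "\<exists>\<beta>\<in>?C. \<alpha> < \<beta>" for \<alpha>
  proof -
    define a where "a n = (h ^^ n) (max \<alpha> \<delta>)" for n :: nat
    have step: "a n < a (Suc n)" for n by (simp add: a_def hx)
    define \<beta> where "\<beta> = (LEAST \<sigma>. \<forall>n. a n < \<sigma>)"
    have "\<exists>\<sigma>. \<forall>n. a n < \<sigma>" using countable_bounded_omega1[of "range a"] by auto
    then have a_less: "a n < \<beta>" for n unfolding \<beta>_def by (rule LeastI2_ex) blast
    have cofinal: "\<exists>n. \<xi> \<le> a n" if "\<xi> < \<beta>" for \<xi>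
      using not_less_Least[of \<xi> "\<lambda>\<sigma>. \<forall>n. a n < \<sigma>"] that unfolding \<beta>_def by (auto simp: not_less)
    have "g k \<xi> \<eta> < \<beta>" if lt: "\<xi> < \<beta>" "\<eta> < \<beta>" for k \<xi> \<eta>
    proof -
      have "max \<xi> \<eta> < \<beta>" using lt by simp
      then obtain n where "max \<xi> \<eta> \<le> a n" using cofinal by blast
      then have "g k \<xi> \<eta> < h (a n)" by (intro hg) auto
      also have "h (a n) = a (Suc n)" by (simp add: a_def)
      also have "\<dots> < \<beta>" by (rule a_less)
      finally show ?thesis .
    qed
    moreover have "max \<alpha> \<delta> < \<beta>" using a_less[of 0] by (simp add: a_def)
    ultimately show ?thesis by (intro bexI[of _ \<beta>]) auto
  qed
  have closed: "\<alpha> \<in> ?C" if ex: "\<exists>\<gamma>. \<gamma> < \<alpha>" and lim: "\<forall>\<gamma><\<alpha>. \<exists>\<beta>\<in>?C. \<gamma> < \<beta> \<and> \<beta> < \<alpha>" for \<alpha>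
  proof -
    have "g k \<xi> \<eta> < \<alpha>" if lt: "\<xi> < \<alpha>" "\<eta> < \<alpha>" for k \<xi> \<eta>
    proof -
      have "max \<xi> \<eta> < \<alpha>" using lt by simp
      then obtain \<beta> where b: "\<beta> \<in> ?C" "max \<xi> \<eta> < \<beta>" "\<beta> < \<alpha>" using lim by blast
      then have "g k \<xi> \<eta> < \<beta>" by simp
      then show ?thesis using b(3) by (rule less_trans)
    qed
    moreover have "\<delta> < \<alpha>" using ex lim by (blast intro: less_trans)
    ultimately show ?thesis by simp
  qed
  show ?thesis
    unfolding club_def
  proof (intro conjI allI impI, goal_cases)
    case (1 \<alpha>)
    show ?case by (rule unbounded)
  next
    case (2 \<alpha>)
    then show ?case using closed[of \<alpha>] by (elim conjE)
  qed
qed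

subsection \<open>The tree of models\<close>

locale model_tree =
  fixes B :: "omega1 struct"
    and A :: "omega1 \<Rightarrow> omega1 set"
    and code :: "nat \<times> omega1 \<times> omega1 \<Rightarrow> omega1"
  assumes good_B: "good B" and countable_B: "countable (fst B)"
    and A: "\<And>X. stationary {\<alpha>. X \<inter> {..<\<alpha>} = A \<alpha>}"
    and inj_code: "inj code"
begin

text \<open>The guessed set is decoded by tags: \<open>0\<close> and \<open>1\<close> mark the two
  branches, \<open>2\<close> the graph of the map between their models.\<close>

definition guess0 :: "omega1 \<Rightarrow> omega1 set" where
  "guess0 \<alpha> = {\<beta>. \<beta> < \<alpha> \<and> code (0, \<beta>, \<beta>) \<in> A \<alpha>}"

definition guess1 :: "omega1 \<Rightarrow> omega1 set" where
  "guess1 \<alpha> = {\<beta>. \<beta> < \<alpha> \<and> code (1, \<beta>, \<beta>) \<in> A \<alpha>}"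

definition guess2 :: "omega1 \<Rightarrow> omega1 rel" where
  "guess2 \<alpha> = {(\<beta>, \<gamma>). \<beta> < \<alpha> \<and> \<gamma> < \<alpha> \<and> code (2, \<beta>, \<gamma>) \<in> A \<alpha>}"

definition ext :: "omega1 struct \<Rightarrow> omega1 set set \<Rightarrow> omega1 struct" where
  "ext s Y = (SOME t. extends s Y t)"

text \<open>\<open>B\<close> is inserted so that the union is the base model when there are no
  earlier stages.\<close>

definition below :: "(omega1 \<Rightarrow> omega1 set \<Rightarrow> omega1 struct) \<Rightarrow> omega1 \<Rightarrow> omega1 set \<Rightarrow> omega1 struct" where
  "below S \<alpha> x = Union_struct (insert B ((\<lambda>\<beta>. S \<beta> x) ` {..<\<alpha>}))"

text \<open>Such a \<open>v\<close> is included in \<open>d\<close> iff \<open>u\<close> is a member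
  of \<open>d\<close>; through it membership is expressed by inclusion.\<close>

definition sing :: "omega1 struct \<Rightarrow> omega1 \<Rightarrow> omega1 \<Rightarrow> bool" where
  "sing s u v \<longleftrightarrow> v \<in> fst s \<and> (\<forall>z\<in>fst s. (z, v) \<in> snd s \<longleftrightarrow> z = u)"

text \<open>The traces on \<open>s\<close> that the guessed map \<open>p\<close> turns into traces of elements of \<open>t\<close>.\<close>

definition traces :: "omega1 struct \<Rightarrow> omega1 rel \<Rightarrow> omega1 struct \<Rightarrow> omega1 set set" where
  "traces s p t = (\<lambda>e. {u \<in> fst s. \<exists>v b. sing s u v \<and> (v, b) \<in> p \<and> (b, e) \<in> inclusion (fst t) (snd t)}) ` fst t"

text \<open>On the branch \<open>guess1 \<alpha>\<close> itself the condition fails, so the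
  extension named here is exactly the stage of that branch at \<alpha>. Naming it through
  \<open>below\<close> keeps the recursion to stages before \<alpha>.\<close>

definition avoid :: "(omega1 \<Rightarrow> omega1 set \<Rightarrow> omega1 struct) \<Rightarrow> omega1 \<Rightarrow> omega1 set \<Rightarrow> omega1 set set" where
  "avoid S \<alpha> x = (if x \<inter> {..<\<alpha>} = guess0 \<alpha> \<and> guess1 \<alpha> \<noteq> guess0 \<alpha>
     then traces (below S \<alpha> x) (guess2 \<alpha>) (ext (below S \<alpha> (guess1 \<alpha>)) {}) else {})"

definition stage :: "omega1 \<Rightarrow> omega1 set \<Rightarrow> omega1 struct" where
  "stage = wfrec {(\<beta>, \<alpha>). \<beta> < \<alpha>} (\<lambda>S \<alpha> x. ext (below S \<alpha> x) (avoid S \<alpha> x))"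

lemma stage_unfold: "stage \<alpha> x = ext (below stage \<alpha> x) (avoid stage \<alpha> x)"
proof -
  let ?S = "cut stage {(\<beta>, \<alpha>). \<beta> < \<alpha>} \<alpha>"
  have "below ?S \<alpha> y = below stage \<alpha> y" for y
    unfolding below_def by (intro arg_cong[of _ _ Union_struct] arg_cong2[of _ _ _ _ insert] image_cong) (auto simp: cut_apply)
  moreover from this have "avoid ?S \<alpha> x = avoid stage \<alpha> x" by (simp add: avoid_def)
  ultimately show ?thesis
    using def_wfrec[OF stage_def[THEN eq_reflection] wf, of \<alpha>] by simp
qed

lemma infinite_Compl: "countable (S :: omega1 set) \<Longrightarrow> infinite (- S)"
proof
  assume "countable S" "finite (- S)"
  then have "countable (S \<union> - S)" by (intro countable_Un uncountable_infinite) (auto intro: countable_finite)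
  then show False using uncountable_omega1 by simp
qed

lemma ext_extends: "good s \<Longrightarrow> countable (fst s) \<Longrightarrow> countable Y \<Longrightarrow> extends s Y (ext s Y)"
proof -
  assume "good s" "countable (fst s)" "countable Y"
  then have "\<exists>t. extends s Y t" by (intro extends_exists infinite_Compl)
  then show "extends s Y (ext s Y)" unfolding ext_def by (rule someI_ex)
qed

definition nice :: "omega1 struct \<Rightarrow> bool" where
  "nice s \<longleftrightarrow> good s \<and> countable (fst s)"

lemma nice_subset: "nice s \<Longrightarrow> snd s \<subseteq> fst s \<times> fst s"
  by (auto simp: nice_def good_def)

text \<open>One induction proves all clauses for all branches together: the union needs the earlier
  stages to be end extensions of each other, and \<open>avoid\<close> is countable because the model
  on the other branch is.\<close>

lemma chain:
  "nice (below stage \<alpha> x) \<and> end_ext B (below stage \<alpha> x) \<and> (\<forall>\<beta><\<alpha>. end_ext (stage \<beta> x) (below stage \<alpha> x)) \<and>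
   nice (stage \<alpha> x) \<and> extends (below stage \<alpha> x) (avoid stage \<alpha> x) (stage \<alpha> x)"
proof (induction \<alpha> arbitrary: x rule: less_induct)
  case (less \<alpha>)
  have up: "end_ext (stage \<gamma> y) (stage \<beta> y)" if "\<gamma> < \<beta>" "\<beta> < \<alpha>" for \<gamma> \<beta> y
    using less.IH[OF that(2), of y] that(1) end_ext_trans unfolding extends_def by blast
  have base: "end_ext B (stage \<beta> y)" if "\<beta> < \<alpha>" for \<beta> y
    using less.IH[OF that, of y] end_ext_trans unfolding extends_def by blast
  have nice_stage: "nice (stage \<beta> y)" if "\<beta> < \<alpha>" for \<beta> y
    using less.IH[OF that, of y] by blast
  have nice_B: "nice B" using good_B countable_B by (simp add: nice_def)
  have nice_below: "nice (below stage \<alpha> y)" and ends: "\<And>s. s \<in> insert B ((\<lambda>\<beta>. stage \<beta> y) ` {..<\<alpha>}) \<Longrightarrow> end_ext s (below stage \<alpha> y)" for y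
  proof -
    let ?F = "insert B ((\<lambda>\<beta>. stage \<beta> y) ` {..<\<alpha>})"
    have lin: "end_ext s t \<or> end_ext t s" if "s \<in> ?F" "t \<in> ?F" for s t
    proof -
      have "end_ext (stage \<gamma> y) (stage \<beta> y) \<or> end_ext (stage \<beta> y) (stage \<gamma> y)" if "\<gamma> < \<alpha>" "\<beta> < \<alpha>" for \<gamma> \<beta>
        using up[of \<gamma> \<beta> y] up[of \<beta> \<gamma> y] that end_ext_refl[OF nice_subset[OF nice_stage[OF that(1), of y]]]
        by (cases \<gamma> \<beta> rule: linorder_cases) auto
      then show ?thesis using that base end_ext_refl[OF nice_subset[OF nice_B]] by auto
    qed
    have sub: "snd s \<subseteq> fst s \<times> fst s" if "s \<in> ?F" for s
      using that nice_subset nice_B nice_stage by blast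
    show ends: "end_ext s (below stage \<alpha> y)" if "s \<in> ?F" for s
      unfolding below_def using end_ext_Union[OF lin sub that] by blast
    have "snd (below stage \<alpha> y) \<subseteq> fst (below stage \<alpha> y) \<times> fst (below stage \<alpha> y)"
      unfolding below_def using Union_struct_subset[OF sub] by blast
    then have "good (below stage \<alpha> y)" using good_end_ext[OF ends[of B] good_B] by blast
    moreover have "countable (fst (below stage \<alpha> y))"
      using countable_B nice_stage countable_lessThan_omega1[of \<alpha>]
      unfolding below_def Union_struct_def nice_def by (auto intro!: countable_UN)
    ultimately show "nice (below stage \<alpha> y)" by (simp add: nice_def)
  qed
  have "countable (avoid stage \<alpha> x)"
  proof -
    have "countable (fst (ext (below stage \<alpha> (guess1 \<alpha>)) {}))"
      using ext_extends[of "below stage \<alpha> (guess1 \<alpha>)" "{}"] nice_below[of "guess1 \<alpha>"]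
      unfolding extends_def nice_def by simp
    then show ?thesis by (simp add: avoid_def traces_def)
  qed
  then have e: "extends (below stage \<alpha> x) (avoid stage \<alpha> x) (stage \<alpha> x)"
    unfolding stage_unfold[of \<alpha> x] using nice_below[of x] by (intro ext_extends) (auto simp: nice_def)
  then have "nice (stage \<alpha> x)" by (simp add: extends_def nice_def)
  then show ?case using e nice_below[of x] ends[of _ x] by blast
qed

lemma nice_below: "nice (below stage \<alpha> x)" and nice_stage: "nice (stage \<alpha> x)"
  and extends_stage: "extends (below stage \<alpha> x) (avoid stage \<alpha> x) (stage \<alpha> x)"
  using chain by blast+

lemma below_stage: "end_ext (below stage \<alpha> x) (stage \<alpha> x)"
  using extends_stage by (simp add: extends_def)

lemma stage_mono: "\<beta> \<le> \<alpha> \<Longrightarrow> end_ext (stage \<beta> x) (stage \<alpha> x)"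
proof (cases "\<beta> = \<alpha>")
  case True
  then show ?thesis using end_ext_refl nice_subset nice_stage by blast
next
  case False
  assume "\<beta> \<le> \<alpha>"
  then have "\<beta> < \<alpha>" using False by simp
  then show ?thesis using chain[of \<alpha> x] below_stage end_ext_trans by blast
qed

text \<open>Both \<open>below\<close> and \<open>avoid\<close> inspect the index only below
  \<alpha>. So the stages form a tree, and a branch may be replaced by a correct guess of its
  initial segment.\<close>

lemma stage_cong: "x \<inter> {..<\<alpha>} = y \<inter> {..<\<alpha>} \<Longrightarrow> stage \<alpha> x = stage \<alpha> y"
proof (induction \<alpha> rule: less_induct)
  case (less \<alpha>)
  have "stage \<beta> x = stage \<beta> y" if "\<beta> < \<alpha>" for \<beta>
  proof (rule less.IH[OF that])
    have "z \<inter> {..<\<beta>} = z \<inter> {..<\<alpha>} \<inter> {..<\<beta>}" for z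
      using that by (auto intro: less_trans)
    then show "x \<inter> {..<\<beta>} = y \<inter> {..<\<beta>}" using less.prems by metis
  qed
  then have "(\<lambda>\<beta>. stage \<beta> x) ` {..<\<alpha>} = (\<lambda>\<beta>. stage \<beta> y) ` {..<\<alpha>}" by (intro image_cong) auto
  then have "below stage \<alpha> x = below stage \<alpha> y" by (simp add: below_def)
  then show ?case using less.prems by (simp add: stage_unfold[of \<alpha>] avoid_def)
qed

lemma below_cong: "x \<inter> {..<\<alpha>} = y \<inter> {..<\<alpha>} \<Longrightarrow> below stage \<alpha> x = below stage \<alpha> y"
proof -
  assume eq: "x \<inter> {..<\<alpha>} = y \<inter> {..<\<alpha>}"
  have "stage \<beta> x = stage \<beta> y" if "\<beta> < \<alpha>" for \<beta>
  proof (rule stage_cong)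
    have "z \<inter> {..<\<beta>} = z \<inter> {..<\<alpha>} \<inter> {..<\<beta>}" for z
      using that by (auto intro: less_trans)
    then show "x \<inter> {..<\<beta>} = y \<inter> {..<\<beta>}" using eq by metis
  qed
  then have "(\<lambda>\<beta>. stage \<beta> x) ` {..<\<alpha>} = (\<lambda>\<beta>. stage \<beta> y) ` {..<\<alpha>}" by (intro image_cong) auto
  then show ?thesis by (simp add: below_def)
qed

definition final :: "omega1 set \<Rightarrow> omega1 struct" where
  "final x = Union_struct (range (\<lambda>\<alpha>. stage \<alpha> x))"

lemma fst_final: "fst (final x) = (\<Union>\<alpha>. fst (stage \<alpha> x))"
  by (simp add: final_def Union_struct_def)

lemma stage_final: "end_ext (stage \<alpha> x) (final x)"
  unfolding final_def
proof (rule end_ext_Union)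
  fix s t assume "s \<in> range (\<lambda>\<alpha>. stage \<alpha> x)" "t \<in> range (\<lambda>\<alpha>. stage \<alpha> x)"
  then obtain \<beta> \<gamma> where "s = stage \<beta> x" "t = stage \<gamma> x" by blast
  then show "end_ext s t \<or> end_ext t s" using stage_mono linear by metis
next
  fix s assume "s \<in> range (\<lambda>\<alpha>. stage \<alpha> x)"
  then show "snd s \<subseteq> fst s \<times> fst s" using nice_subset nice_stage by blast
qed simp

lemma below_final: "end_ext (below stage \<alpha> x) (final x)"
  using below_stage stage_final end_ext_trans by blast

lemma snd_final: "snd (final x) \<subseteq> fst (final x) \<times> fst (final x)"
  unfolding final_def by (rule Union_struct_subset) (use nice_subset nice_stage in blast)

lemma models_final: "models (fst (final x)) (snd (final x)) ZFC"
  using good_end_ext[OF stage_final _ snd_final, of undefined x] nice_stage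
  by (auto simp: nice_def good_def)

lemma stage_below: "\<beta> < \<alpha> \<Longrightarrow> fst (stage \<beta> x) \<subseteq> fst (below stage \<alpha> x)"
  using chain[of \<alpha> x] end_ext_subset by blast

text \<open>A countable model would be exhausted before some stage \<sigma>, but the element
  \<open>c\<close> added there has everything from before as a member, so it would be a member of
  itself. The members of an element of stage \<alpha> all lie in that countable stage.\<close>

lemma omega1_like_final: "omega1_like (fst (final x)) (snd (final x))"
  unfolding omega1_like_def
proof (intro conjI ballI)
  show "uncountable (fst (final x))"
  proof
    assume ct: "countable (fst (final x))"
    have "\<forall>a\<in>fst (final x). \<exists>\<alpha>. a \<in> fst (stage \<alpha> x)" by (auto simp: fst_final)
    then obtain r where r: "\<And>a. a \<in> fst (final x) \<Longrightarrow> a \<in> fst (stage (r a) x)" by metis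
    obtain \<sigma> where \<sigma>: "\<And>a. a \<in> fst (final x) \<Longrightarrow> r a < \<sigma>"
      using countable_bounded_omega1[of "r ` fst (final x)"] ct by auto
    have all: "fst (final x) \<subseteq> fst (below stage \<sigma> x)" using r \<sigma> stage_below by blast
    obtain c where c: "c \<in> fst (stage \<sigma> x)" "\<forall>z\<in>fst (below stage \<sigma> x). (z, c) \<in> snd (stage \<sigma> x)"
      using extends_stage[of \<sigma> x] unfolding extends_def by blast
    interpret zfc_coll_model "fst (stage \<sigma> x)" "snd (stage \<sigma> x)" "from_nat_into (fst (stage \<sigma> x))"
      using nice_stage[of \<sigma> x] by (intro countable_good_zfc_model) (auto simp: nice_def)
    have "c \<in> fst (final x)" using c(1) by (auto simp: fst_final)
    then show False using all c mem_irrefl by blast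
  qed
  fix a assume "a \<in> fst (final x)"
  then obtain \<alpha> where \<alpha>: "a \<in> fst (stage \<alpha> x)" by (auto simp: fst_final)
  then have "{b \<in> fst (final x). (b, a) \<in> snd (final x)} \<subseteq> fst (stage \<alpha> x)"
    using end_ext_end[OF stage_final] by blast
  then show "countable {b \<in> fst (final x). (b, a) \<in> snd (final x)}"
    using nice_stage[of \<alpha> x] countable_subset by (auto simp: nice_def)
qed

text \<open>At a stage where \<open>x\<close>, \<open>y\<close> and \<open>f\<close> are guessed correctly, the new trace in the model for \<open>x\<close>
  has no counterpart in the model for \<open>y\<close>.\<close>

lemma not_isomorphic:
  assumes "x \<noteq> y"
  shows "\<not> isomorphic (fst (final x)) (inclusion (fst (final x)) (snd (final x)))
    (fst (final y)) (inclusion (fst (final y)) (snd (final y)))"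
proof
  assume "isomorphic (fst (final x)) (inclusion (fst (final x)) (snd (final x)))
    (fst (final y)) (inclusion (fst (final y)) (snd (final y)))"
  then obtain f where f: "bij_betw f (fst (final x)) (fst (final y))"
    and f_incl: "\<And>a b. a \<in> fst (final x) \<Longrightarrow> b \<in> fst (final x) \<Longrightarrow>
      (a, b) \<in> inclusion (fst (final x)) (snd (final x)) \<longleftrightarrow>
      (f a, f b) \<in> inclusion (fst (final y)) (snd (final y))"
    unfolding isomorphic_def by blast
  \<comment> \<open>Above \<delta>0 the branches have split; \<delta>1 bounds the base
    model.\<close>
  obtain \<delta>0 where \<delta>0: "\<delta>0 \<in> x \<longleftrightarrow> \<delta>0 \<notin> y" using assms by blast
  obtain \<delta>1 where \<delta>1: "\<And>b. b \<in> fst B \<Longrightarrow> b < \<delta>1" using countable_bounded_omega1[OF countable_B] by blast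
  have "\<forall>a\<in>fst (final y). \<exists>\<alpha>. a \<in> fst (stage \<alpha> y)" by (auto simp: fst_final)
  then obtain r where r: "\<And>a. a \<in> fst (final y) \<Longrightarrow> a \<in> fst (stage (r a) y)" by metis
  have "\<exists>\<sigma>. \<forall>b\<in>fst (stage \<beta> x). b < \<sigma>" for \<beta>
    using countable_bounded_omega1 nice_stage by (auto simp: nice_def)
  then obtain bd where bd: "\<And>\<beta> b. b \<in> fst (stage \<beta> x) \<Longrightarrow> b < bd \<beta>" by metis
  define X where "X = {code (0, \<beta>, \<beta>) | \<beta>. \<beta> \<in> x} \<union> {code (1, \<beta>, \<beta>) | \<beta>. \<beta> \<in> y} \<union>
    {code (2, \<beta>, f \<beta>) | \<beta>. \<beta> \<in> fst (final x)}"
  \<comment> \<open>Closure under \<open>code\<close> makes the guess at \<alpha> decode to the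
    restrictions of \<open>x\<close>, \<open>y\<close> and \<open>f\<close>. Closure under
    \<open>bd\<close> keeps the stages of \<open>x\<close> before \<alpha> inside \<alpha>, and
    closure under \<open>r\<close> puts the elements of the model for \<open>y\<close> that are
    below \<alpha> into stages before \<alpha>. With \<open>f\<close>, this sends \<open>?Ux\<close>
    into \<open>?Uy\<close>.\<close>
  define g where "g k \<beta> \<gamma> = (if k < 3 then code (k, \<beta>, \<gamma>) else if k = 3 then r \<beta>
    else if k = 4 then bd \<beta> else f \<beta>)" for k :: nat and \<beta> \<gamma>
  let ?C = "{\<alpha>. max \<delta>0 \<delta>1 < \<alpha> \<and> (\<forall>\<beta><\<alpha>. \<forall>\<gamma><\<alpha>. \<forall>k. g k \<beta> \<gamma> < \<alpha>)}"
  obtain \<alpha> where XA: "X \<inter> {..<\<alpha>} = A \<alpha>" and \<alpha>: "max \<delta>0 \<delta>1 < \<alpha>"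
    and g: "\<And>k \<beta> \<gamma>. \<beta> < \<alpha> \<Longrightarrow> \<gamma> < \<alpha> \<Longrightarrow> g k \<beta> \<gamma> < \<alpha>"
    using A[of X] club_closure_points[of "max \<delta>0 \<delta>1" g] unfolding stationary_def by blast
  have code_less: "code (k, \<beta>, \<gamma>) < \<alpha>" if "k < 3" "\<beta> < \<alpha>" "\<gamma> < \<alpha>" for k \<beta> \<gamma>
    using g[OF that(2,3), of k] that(1) by (simp add: g_def)
  have r_less: "r \<beta> < \<alpha>" and bd_less: "bd \<beta> < \<alpha>" and f_less: "f \<beta> < \<alpha>" if "\<beta> < \<alpha>" for \<beta>
    using g[OF that that, of 3] g[OF that that, of 4] g[OF that that, of 5] by (simp_all add: g_def)
  have in_A: "code (k, \<beta>, \<gamma>) \<in> A \<alpha> \<longleftrightarrow> code (k, \<beta>, \<gamma>) \<in> X" if "k < 3" "\<beta> < \<alpha>" "\<gamma> < \<alpha>" for k \<beta> \<gamma>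
    using XA code_less[OF that] by auto
  have g0: "guess0 \<alpha> = x \<inter> {..<\<alpha>}"
    using inj_code in_A[of 0] by (auto simp: guess0_def X_def inj_eq)
  have g1: "guess1 \<alpha> = y \<inter> {..<\<alpha>}"
    using inj_code in_A[of 1] by (auto simp: guess1_def X_def inj_eq)
  have g2: "(\<beta>, \<gamma>) \<in> guess2 \<alpha> \<longleftrightarrow> \<beta> < \<alpha> \<and> \<gamma> < \<alpha> \<and> \<beta> \<in> fst (final x) \<and> \<gamma> = f \<beta>" for \<beta> \<gamma>
    using inj_code in_A[of 2] by (auto simp: guess2_def X_def inj_eq)
  have neq: "x \<inter> {..<\<alpha>} \<noteq> y \<inter> {..<\<alpha>}"
    using \<delta>0 \<alpha> by auto
  let ?Ux = "below stage \<alpha> x" and ?Uy = "below stage \<alpha> y"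
  let ?Nx = "stage \<alpha> x" and ?Ny = "stage \<alpha> y"
  have "avoid stage \<alpha> y = {}" using g0 neq by (simp add: avoid_def)
  then have Ny: "?Ny = ext (below stage \<alpha> (guess1 \<alpha>)) {}"
    using stage_unfold[of \<alpha> y] below_cong[of y \<alpha> "guess1 \<alpha>"] g1 by simp
  have av: "avoid stage \<alpha> x = traces ?Ux (guess2 \<alpha>) ?Ny"
    using g0 g1 neq Ny by (simp add: avoid_def)
  have Ux_less: "b < \<alpha>" if "b \<in> fst ?Ux" for b
  proof -
    from that consider "b \<in> fst B" | \<beta> where "\<beta> < \<alpha>" "b \<in> fst (stage \<beta> x)"
      by (auto simp: below_def Union_struct_def)
    then show ?thesis
      using \<delta>1[of b] \<alpha> bd[of b] bd_less by cases (auto intro: less_trans)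
  qed
  have in_Uy: "b \<in> fst ?Uy" if "b \<in> fst (final y)" "b < \<alpha>" for b
    using r[OF that(1)] stage_below[OF r_less[OF that(2)]] by blast
  obtain d where d: "d \<in> fst ?Nx" "{u \<in> fst ?Ux. (u, d) \<in> snd ?Nx} \<notin> avoid stage \<alpha> x"
    using extends_stage[of \<alpha> x] unfolding extends_def by blast
  have dx: "d \<in> fst (final x)" using d(1) end_ext_subset[OF stage_final] by blast
  define e where "e = f d"
  have ey: "e \<in> fst (final y)" using f dx by (auto simp: e_def bij_betw_def)
  obtain c where c: "c \<in> fst ?Ny" "\<And>z. z \<in> fst ?Uy \<Longrightarrow> (z, c) \<in> snd ?Ny"
    using extends_stage[of \<alpha> y] unfolding extends_def by blast
  \<comment> \<open>The image \<open>e\<close> may enter only at a late stage \<tau>. Its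
    intersection \<open>e'\<close> with \<open>c\<close> already lies in \<open>?Ny\<close>, and a
    set from \<open>?Uy\<close> is included in \<open>e\<close> iff it is included in
    \<open>e'\<close>, because all its members belong to \<open>c\<close>.\<close>
  obtain \<tau> where \<tau>: "\<alpha> \<le> \<tau>" "e \<in> fst (stage \<tau> y)"
  proof -
    have "e \<in> fst (stage (max \<alpha> (r e)) y)"
      using r[OF ey] end_ext_subset[OF stage_mono[of "r e" "max \<alpha> (r e)" y]] by auto
    then show thesis using that[of "max \<alpha> (r e)"] by simp
  qed
  let ?T = "stage \<tau> y"
  have ext: "end_ext ?Ny ?T" using stage_mono \<tau>(1) .
  obtain e' where e': "e' \<in> fst ?Ny"
    "\<And>z. z \<in> fst ?T \<Longrightarrow> (z, e') \<in> snd ?T \<longleftrightarrow> (z, e) \<in> snd ?T \<and> (z, c) \<in> snd ?T"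
    using end_ext_trace[OF ext _ _ _ _ c(1) \<tau>(2)] nice_stage unfolding nice_def by blast
  have e'T: "e' \<in> fst ?T" using e'(1) end_ext_subset[OF ext] by blast
  have incl_e': "(b, e) \<in> inclusion (fst (final y)) (snd (final y)) \<longleftrightarrow> (b, e') \<in> inclusion (fst ?Ny) (snd ?Ny)"
    if b: "b \<in> fst ?Uy" for b
  proof -
    have bN: "b \<in> fst ?Ny" using b end_ext_subset[OF below_stage] by blast
    then have bT: "b \<in> fst ?T" using end_ext_subset[OF ext] by blast
    have "(z, c) \<in> snd ?T" if zb: "(z, b) \<in> snd ?T" for z
    proof -
      have "z \<in> fst ?Uy" using end_ext_end[OF end_ext_trans[OF below_stage ext] b zb] .
      then show ?thesis
        using c(2) end_ext_mem[OF ext _ c(1)] end_ext_subset[OF below_stage] by blast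
    qed
    then have "(b, e) \<in> inclusion (fst ?T) (snd ?T) \<longleftrightarrow> (b, e') \<in> inclusion (fst ?T) (snd ?T)"
      using e'(2) bT e'T \<tau>(2) unfolding inclusion_def by blast
    then show ?thesis
      using inclusion_end_ext[OF stage_final bT \<tau>(2)] inclusion_end_ext[OF ext bN e'(1)] by simp
  qed
  interpret Ux: zfc_coll_model "fst ?Ux" "snd ?Ux" "from_nat_into (fst ?Ux)"
    using nice_below[of \<alpha> x] by (intro countable_good_zfc_model) (auto simp: nice_def)
  have sub_x: "fst ?Ux \<subseteq> fst (final x)" using end_ext_subset[OF below_final] .
  have "(u, d) \<in> snd ?Nx \<longleftrightarrow>
      (\<exists>v b. sing ?Ux u v \<and> (v, b) \<in> guess2 \<alpha> \<and> (b, e') \<in> inclusion (fst ?Ny) (snd ?Ny))"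
    if u: "u \<in> fst ?Ux" for u
  proof -
    obtain v where v: "v \<in> fst ?Ux" "\<And>z. z \<in> fst ?Ux \<Longrightarrow> (z, v) \<in> snd ?Ux \<longleftrightarrow> z = u"
      using Ux.pairing[OF u u] by auto
    have sv: "sing ?Ux u v" using v by (simp add: sing_def)
    have unique: "w = v" if "sing ?Ux u w" for w
      using that v Ux.ext[of w v] unfolding sing_def by blast
    have vx: "v \<in> fst (final x)" using v sub_x by blast
    have "(z, v) \<in> snd (final x) \<longleftrightarrow> z = u" for z
      using end_ext_end[OF below_final v(1)] end_ext_mem[OF below_final _ v(1)] v(2) u by blast
    \<comment> \<open>Membership of \<open>u\<close> is rewritten as inclusion of its singleton
      \<open>v\<close>, which \<open>f\<close> transports.\<close>
    then have "(u, d) \<in> snd (final x) \<longleftrightarrow> (v, d) \<in> inclusion (fst (final x)) (snd (final x))"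
      using vx dx u sub_x unfolding inclusion_def by auto
    moreover have "(u, d) \<in> snd (final x) \<longleftrightarrow> (u, d) \<in> snd ?Nx"
      using end_ext_mem[OF stage_final _ d(1)] u end_ext_subset[OF below_stage] by blast
    ultimately have ud: "(u, d) \<in> snd ?Nx \<longleftrightarrow> (f v, e) \<in> inclusion (fst (final y)) (snd (final y))"
      using f_incl[OF vx dx] by (simp add: e_def)
    have fv: "f v < \<alpha>" "v < \<alpha>" using f_less Ux_less v(1) by blast+
    have g2v: "(v, b) \<in> guess2 \<alpha> \<longleftrightarrow> b = f v" for b using g2 fv vx by auto
    have "f v \<in> fst ?Uy" using in_Uy fv f vx by (auto simp: bij_betw_def)
    then have "(u, d) \<in> snd ?Nx \<longleftrightarrow> (f v, e') \<in> inclusion (fst ?Ny) (snd ?Ny)"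
      using ud incl_e' by simp
    moreover have "(\<exists>w b. sing ?Ux u w \<and> (w, b) \<in> guess2 \<alpha> \<and> (b, e') \<in> inclusion (fst ?Ny) (snd ?Ny)) \<longleftrightarrow>
        (f v, e') \<in> inclusion (fst ?Ny) (snd ?Ny)" (is "?L \<longleftrightarrow> ?R")
    proof
      assume ?L
      then obtain w b where w: "sing ?Ux u w" "(w, b) \<in> guess2 \<alpha>"
        "(b, e') \<in> inclusion (fst ?Ny) (snd ?Ny)" by (elim exE conjE)
      then show ?R using unique[OF w(1)] g2v[of b] by simp
    next
      assume ?R
      then show ?L using sv g2v[of "f v"] by (intro exI[of _ v] exI[of _ "f v"]) simp
    qed
    ultimately show ?thesis by simp
  qed
  then have "{u \<in> fst ?Ux. (u, d) \<in> snd ?Nx} \<in> traces ?Ux (guess2 \<alpha>) ?Ny"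
    unfolding traces_def using e'(1) by (intro image_eqI[of _ _ e']) auto
  then show False using d(2) av by simp
qed

end

lemma infinite_omega1: "infinite (UNIV :: omega1 set)"
  using uncountable_omega1 countable_finite by blast

lemma ex_code: "\<exists>code :: nat \<times> omega1 \<times> omega1 \<Rightarrow> omega1. inj code"
proof -
  obtain k :: "nat \<Rightarrow> omega1" where k: "inj k" using infinite_countable_subset[OF infinite_omega1] by blast
  have "|(UNIV :: omega1 set) \<times> (UNIV :: omega1 set)| \<le>o |UNIV :: omega1 set|"
    using card_of_Times_same_infinite[OF infinite_omega1] ordIso_imp_ordLeq by blast
  then obtain p :: "omega1 \<times> omega1 \<Rightarrow> omega1" where p: "inj p"
    unfolding card_of_ordLeq[symmetric] by auto
  have "inj (\<lambda>(n, \<beta>, \<gamma>). p (k n, p (\<beta>, \<gamma>)))"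
    by (rule injI) (auto dest: injD[OF p] injD[OF k])
  then show ?thesis by blast
qed

theorem theorem14:
  assumes "diamond"
    and "consistent ZFC"
  shows "\<exists>F :: (omega1 set \<times> omega1 rel) set.
           |F| =o ctwo ^c |UNIV :: omega1 set| \<and>
           (\<forall>(M, E)\<in>F. models M E ZFC \<and> omega1_like M E) \<and>
           pairwise (\<lambda>(M, E) (N, E').
             \<not> isomorphic M (inclusion M E) N (inclusion N E')) F"
proof -
  obtain M0 :: "nat set" and E0 where M0: "models M0 E0 ZFC" "collects M0 E0" "E0 \<subseteq> M0 \<times> M0"
    using ZFC_collects_model_exists[OF assms(2)] by blast
  obtain k :: "nat \<Rightarrow> omega1" where k: "inj k" using infinite_countable_subset[OF infinite_omega1] by blast
  define B where "B = (k ` M0, map_prod k k ` E0)"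
  have valid_B: "valid M0 E0 p \<Longrightarrow> valid (fst B) (snd B) p" for p
    unfolding valid_def
  proof (intro allI impI)
    fix v :: "nat \<Rightarrow> omega1" assume p: "\<forall>v. range v \<subseteq> M0 \<longrightarrow> sat M0 E0 v p" and v: "range v \<subseteq> fst B"
    have "inv k (v n) \<in> M0 \<and> k (inv k (v n)) = v n" for n
    proof -
      have "v n \<in> k ` M0" using v by (auto simp: B_def)
      then show ?thesis using k by auto
    qed
    then have w: "range (\<lambda>n. inv k (v n)) \<subseteq> M0" "(\<lambda>n. k (inv k (v n))) = v" by auto
    then show "sat (fst B) (snd B) v p"
      using sat_iso[OF inj_on_subset[OF k] M0(3) w(1), of p] p by (simp add: B_def)
  qed
  have "good B"
    using M0 valid_B unfolding good_def models_ZFC_iff collects_iff by (auto simp: B_def)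
  moreover have "countable (fst B)" by (simp add: B_def)
  moreover obtain A :: "omega1 \<Rightarrow> omega1 set" where "\<And>X. stationary {\<alpha>. X \<inter> {..<\<alpha>} = A \<alpha>}"
    using assms(1) unfolding diamond_def by blast
  moreover obtain code :: "nat \<times> omega1 \<times> omega1 \<Rightarrow> omega1" where "inj code" using ex_code by blast
  ultimately interpret model_tree B A code by unfold_locales
  have iso_refl: "isomorphic M R M R" for M :: "omega1 set" and R
    unfolding isomorphic_def by (intro exI[of _ "\<lambda>a. a"]) (auto simp: bij_betw_def)
  have inj: "inj final"
    using not_isomorphic iso_refl by (metis injI)
  have "|range final| =o |UNIV :: omega1 set set|"
    using inj by (intro ordIso_symmetric[OF card_of_ordIsoI[of final]]) (simp add: bij_betw_def)
  also have "|UNIV :: omega1 set set| =o ctwo ^c |UNIV :: omega1 set|"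
    using card_of_Pow_Func[of "UNIV :: omega1 set"]
    by (simp add: cexp_def ctwo_def Field_card_of)
  finally have "|range final| =o ctwo ^c |UNIV :: omega1 set|" .
  moreover have "\<forall>(M, E)\<in>range final. models M E ZFC \<and> omega1_like M E"
    unfolding case_prod_unfold using models_final omega1_like_final by blast
  moreover have "pairwise (\<lambda>(M, E) (N, E'). \<not> isomorphic M (inclusion M E) N (inclusion N E')) (range final)"
    unfolding pairwise_def case_prod_unfold
  proof (intro ballI impI, elim imageE)
    fix s t x y assume "s \<noteq> t" and eq: "s = final x" "t = final y"
    then have "x \<noteq> y" by blast
    then show "\<not> isomorphic (fst s) (inclusion (fst s) (snd s)) (fst t) (inclusion (fst t) (snd t))"
      unfolding eq by (rule not_isomorphic)
  qed
  ultimately show ?thesis by blast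
qed

end
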